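(* Let $\mathcal{C}$ be a smashing triangulated category, let $\mathcal{C}^0$ be an essentially small triangulated subcategory of the subcategory of compact objects of $\mathcal{C}$ such that $\mathcal{C}^0$ generates $\mathcal{C}$, and let $w^0$ be a weight structure on $\mathcal{C}^0$. Let $w$ be the unique smashing weight structure on $\mathcal{C}$ extending $w^0$ and let $t$ be the $t$-structure on $\mathcal{C}$ (left) adjacent to $w$ (both exist). Assume in addition that $R$ is a commutative unital ring, $\mathcal{C}^0$ is $R$-linear, and $\mathcal{A}$ is a weak Serre subcategory of $R\text{-}\mathrm{Mod}$. 1. Then $\mathcal{C}_{\mathcal{A}}$ is triangulated and $t$ restricts to it. 2. The heart of this restriction is naturally equivalent to the category of $R$-linear functors $(\underline{Hw}^0)^{op}\to\mathcal{A}$. 3. Let $\beta$ be an infinite cardinal; assume that $R$ is Noetherian and the $R$-module $\mathcal{C}(M,N)$ has less than $\beta$ generators for any $M,N\in\mathrm{Obj}\,\mathcal{C}^0$. Then $\mathcal{C}^0\subset\mathcal{C}_\beta$.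
   Context: Conventions: all coproducts are small; subcategories are strictly full; $X\perp Y$ means $\mathcal{C}(X,Y)=0$, for classes $D\perp E$ means $X\perp Y$ for all $X\in D$, $Y\in E$. Smashing means having all small coproducts. An object $M$ is compact if $\mathcal{C}(M,-)$ respects coproducts. $\mathcal{C}^0$ generates $\mathcal{C}$ if the smallest triangulated subcategory of $\mathcal{C}$ that contains $\mathcal{C}^0$ and is closed under $\mathcal{C}$-coproducts is $\mathcal{C}$. For $M\in\mathrm{Obj}\,\mathcal{C}^0$, $N\in\mathrm{Obj}\,\mathcal{C}$ the group $\mathcal{C}(M,N)$ is an $R$-module via the action of $R$ on $M$. A weak Serre subcategory of an abelian category is a strictly full subcategory containing the kernels and cokernels of all its morphisms and closed under extensions. $\mathcal{C}_{\mathcal{A}}$ is the full subcategory of $\mathcal{C}$ of those $N$ such that $\mathcal{C}(M,N)\in\mathcal{A}$ for every $M\in\mathrm{Obj}\,\mathcal{C}^0$. If $R$ is Noetherian and $\beta$ is an infinite cardinal, $\mathcal{C}_\beta$ denotes $\mathcal{C}_{\mathcal{A}}$ for $\mathcal{A}$ the category of $R$-modules with less than $\beta$ generators. A weight structure $w=(\mathcal{C}_{w\le 0},\mathcal{C}_{w\ge 0})$ on $\mathcal{C}$ is a pair of classes of objects closed under retracts such that $\mathcal{C}_{w\le 0}\subset \mathcal{C}_{w\le 0}[1]$, $\mathcal{C}_{w\ge 0}[1]\subset \mathcal{C}_{w\ge 0}$, $\mathcal{C}_{w\le 0}\perp \mathcal{C}_{w\ge 0}[1]$, and every object $M$ fits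 into a distinguished triangle $L_wM\to M\to R_wM\to L_wM[1]$ with $L_wM\in \mathcal{C}_{w\le 0}$, $R_wM\in\mathcal{C}_{w\ge 0}[1]$; similarly for $\mathcal{C}^0$. $\underline{Hw}^0$ is the full subcategory of $\mathcal{C}^0$ with objects $\mathcal{C}^0_{w^0\le 0}\cap \mathcal{C}^0_{w^0\ge 0}$. $w$ is smashing if $\mathcal{C}_{w\ge 0}$ is closed under $\mathcal{C}$-coproducts. $w$ extends $w^0$ if $\mathcal{C}^0_{w^0\le 0}=\mathcal{C}_{w\le 0}\cap\mathrm{Obj}\,\mathcal{C}^0$ and $\mathcal{C}^0_{w^0\ge 0}=\mathcal{C}_{w\ge 0}\cap\mathrm{Obj}\,\mathcal{C}^0$. A $t$-structure $t=(\mathcal{C}_{t\le 0},\mathcal{C}_{t\ge 0})$ on $\mathcal{C}$ (homological convention) is a pair of classes of objects closed under isomorphism such that $\mathcal{C}_{t\le 0}\subset \mathcal{C}_{t\le 0}[1]$, $\mathcal{C}_{t\ge 0}[1]\subset \mathcal{C}_{t\ge 0}$, $\mathcal{C}_{t\ge 0}[1]\perp \mathcal{C}_{t\le 0}$, and every object $M$ fits into a distinguished triangle $L_tM\to M\to R_tM\to L_tM[1]$ with $L_tM\in \mathcal{C}_{t\ge 0}$, $R_tM\in\mathcal{C}_{t\le 0}[-1]$. The heart of $t$ is the full subcategory with objects $\mathcal{C}_{t\le 0}\cap \mathcal{C}_{t\ge 0}$. $t$ restricts to a full triangulated subcategory $\mathcal{C}''$ if $(\mathcal{C}_{t\le 0}\cap\mathrm{Obj}\,\mathcal{C}'',\mathcal{C}_{t\ge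 0}\cap\mathrm{Obj}\,\mathcal{C}'')$ is a $t$-structure on $\mathcal{C}''$. $t$ is left adjacent to $w$ if $\mathcal{C}_{t\ge 0}=\mathcal{C}_{w\ge 0}$. *)

theory Defs
  imports "HOL-Algebra.Module" "HOL-Algebra.AbelCoset" "HOL-Algebra.Ring_Divisibility"
begin

unbundle cardinal_syntax

section \<open>Smallness\<close>

text \<open>
  Small sets are the sets of cardinality below a fixed uncountable regular cardinal \<open>\<kappa>\<close>.
  Taking \<open>\<kappa>\<close> strongly inaccessible gives the sets of a Grothendieck universe, but strong
  inaccessibility (not known to be satisfiable in HOL) is not required. Accordingly, local smallness
  should only be imposed on the groups \<open>C(M, N)\<close> with \<open>M\<close> in the essentially small subcategory of
  compact objects: if all Hom-sets of a nonzero category with small coproducts are small, then \<open>\<kappa>\<close>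
  is necessarily a strong limit. Below, \<open>\<kappa>\<close> always
  lives on the type of the arrows of the category under consideration. Hence every small set injects
  into that type, so that small index sets and small modules may be taken there up to bijection.
\<close>

definition universe_card :: "'u rel \<Rightarrow> bool" where
  "universe_card \<kappa> \<longleftrightarrow> Card_order \<kappa> \<and> regularCard \<kappa> \<and> natLeq <o \<kappa>"

definition small :: "'u rel \<Rightarrow> 'b set \<Rightarrow> bool" where
  "small \<kappa> X \<longleftrightarrow> |X| <o \<kappa>"


section \<open>Categories and functors\<close>

record ('o, 'a) cat =
  obj :: "'o set"
  arr :: "'a set"
  src :: "'a \<Rightarrow> 'o"
  tgt :: "'a \<Rightarrow> 'o"
  ident :: "'o \<Rightarrow> 'a"
  cmp :: "'a \<Rightarrow> 'a \<Rightarrow> 'a" (infixl \<open>\<cdot>\<index>\<close> 70)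

definition Hom :: "('o, 'a, 'z) cat_scheme \<Rightarrow> 'o \<Rightarrow> 'o \<Rightarrow> 'a set" where
  "Hom C X Y = {f \<in> arr C. src C f = X \<and> tgt C f = Y}"

locale category =
  fixes C :: "('o, 'a, 'z) cat_scheme" (structure)
  assumes src_obj: "f \<in> arr C \<Longrightarrow> src C f \<in> obj C"
    and tgt_obj: "f \<in> arr C \<Longrightarrow> tgt C f \<in> obj C"
    and ident_Hom: "X \<in> obj C \<Longrightarrow> ident C X \<in> Hom C X X"
    and cmp_Hom: "\<lbrakk>f \<in> Hom C X Y; g \<in> Hom C Y Z\<rbrakk> \<Longrightarrow> g \<cdot> f \<in> Hom C X Z"
    and cmp_ident: "f \<in> Hom C X Y \<Longrightarrow> f \<cdot> ident C X = f"
    and ident_cmp: "f \<in> Hom C X Y \<Longrightarrow> ident C Y \<cdot> f = f"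
    and cmp_assoc: "\<lbrakk>f \<in> Hom C W X; g \<in> Hom C X Y; h \<in> Hom C Y Z\<rbrakk>
      \<Longrightarrow> (h \<cdot> g) \<cdot> f = h \<cdot> (g \<cdot> f)"

definition inverse_arrows :: "('o, 'a, 'z) cat_scheme \<Rightarrow> 'o \<Rightarrow> 'o \<Rightarrow> 'a \<Rightarrow> 'a \<Rightarrow> bool" where
  "inverse_arrows C X Y f g \<longleftrightarrow> f \<in> Hom C X Y \<and> g \<in> Hom C Y X \<and>
     g \<cdot>\<^bsub>C\<^esub> f = ident C X \<and> f \<cdot>\<^bsub>C\<^esub> g = ident C Y"

definition iso_arrow :: "('o, 'a, 'z) cat_scheme \<Rightarrow> 'o \<Rightarrow> 'o \<Rightarrow> 'a \<Rightarrow> bool" where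
  "iso_arrow C X Y f \<longleftrightarrow> (\<exists>g. inverse_arrows C X Y f g)"

definition isomorphic :: "('o, 'a, 'z) cat_scheme \<Rightarrow> 'o \<Rightarrow> 'o \<Rightarrow> bool" where
  "isomorphic C X Y \<longleftrightarrow> (\<exists>f. iso_arrow C X Y f)"

definition closed_under_iso :: "('o, 'a, 'z) cat_scheme \<Rightarrow> 'o set \<Rightarrow> bool" where
  "closed_under_iso C S \<longleftrightarrow> (\<forall>X\<in>S. \<forall>Y\<in>obj C. isomorphic C X Y \<longrightarrow> Y \<in> S)"

definition closed_under_retracts :: "('o, 'a, 'z) cat_scheme \<Rightarrow> 'o set \<Rightarrow> bool" where
  "closed_under_retracts C S \<longleftrightarrow> (\<forall>X\<in>S. \<forall>Y\<in>obj C.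
     (\<exists>i\<in>Hom C Y X. \<exists>p\<in>Hom C X Y. p \<cdot>\<^bsub>C\<^esub> i = ident C Y) \<longrightarrow> Y \<in> S)"

definition full_subcat :: "('o, 'a, 'z) cat_scheme \<Rightarrow> 'o set \<Rightarrow> ('o, 'a, 'z) cat_scheme" where
  "full_subcat C S = C\<lparr>obj := obj C \<inter> S, arr := {f \<in> arr C. src C f \<in> S \<and> tgt C f \<in> S}\<rparr>"

definition opposite :: "('o, 'a, 'z) cat_scheme \<Rightarrow> ('o, 'a) cat" where
  "opposite C = \<lparr>obj = obj C, arr = arr C, src = tgt C, tgt = src C, ident = ident C,
     cmp = (\<lambda>g f. f \<cdot>\<^bsub>C\<^esub> g)\<rparr>"

definition essentially_small :: "'u rel \<Rightarrow> ('o, 'a, 'z) cat_scheme \<Rightarrow> bool" where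
  "essentially_small \<kappa> C \<longleftrightarrow>
     (\<exists>S \<subseteq> obj C. small \<kappa> S \<and> (\<forall>X\<in>obj C. \<exists>Y\<in>S. isomorphic C X Y)) \<and>
     (\<forall>X\<in>obj C. \<forall>Y\<in>obj C. small \<kappa> (Hom C X Y))"

record ('o, 'a, 'p, 'b) funct =
  fobj :: "'o \<Rightarrow> 'p"
  farr :: "'a \<Rightarrow> 'b"

definition is_functor ::
  "('o, 'a, 'z) cat_scheme \<Rightarrow> ('p, 'b, 'y) cat_scheme \<Rightarrow> ('o, 'a, 'p, 'b) funct \<Rightarrow> bool" where
  "is_functor C D F \<longleftrightarrow>
     (\<forall>X\<in>obj C. fobj F X \<in> obj D) \<and>
     (\<forall>X Y. \<forall>f\<in>Hom C X Y. farr F f \<in> Hom D (fobj F X) (fobj F Y)) \<and>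
     (\<forall>X\<in>obj C. farr F (ident C X) = ident D (fobj F X)) \<and>
     (\<forall>X Y Z. \<forall>f\<in>Hom C X Y. \<forall>g\<in>Hom C Y Z. farr F (g \<cdot>\<^bsub>C\<^esub> f) = farr F g \<cdot>\<^bsub>D\<^esub> farr F f)"

definition id_functor :: "('o, 'a, 'o, 'a) funct" where
  "id_functor = \<lparr>fobj = id, farr = id\<rparr>"

definition functor_comp ::
  "('p, 'b, 'q, 'c) funct \<Rightarrow> ('o, 'a, 'p, 'b) funct \<Rightarrow> ('o, 'a, 'q, 'c) funct" where
  "functor_comp G F = \<lparr>fobj = fobj G \<circ> fobj F, farr = farr G \<circ> farr F\<rparr>"

definition nat_trans :: "('o, 'a, 'z) cat_scheme \<Rightarrow> ('p, 'b, 'y) cat_scheme \<Rightarrow>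
    ('o, 'a, 'p, 'b) funct \<Rightarrow> ('o, 'a, 'p, 'b) funct \<Rightarrow> ('o \<Rightarrow> 'b) \<Rightarrow> bool" where
  "nat_trans C D F G \<eta> \<longleftrightarrow>
     (\<forall>X\<in>obj C. \<eta> X \<in> Hom D (fobj F X) (fobj G X)) \<and>
     (\<forall>X Y. \<forall>f\<in>Hom C X Y. \<eta> Y \<cdot>\<^bsub>D\<^esub> farr F f = farr G f \<cdot>\<^bsub>D\<^esub> \<eta> X)"

definition naturally_isomorphic :: "('o, 'a, 'z) cat_scheme \<Rightarrow> ('p, 'b, 'y) cat_scheme \<Rightarrow>
    ('o, 'a, 'p, 'b) funct \<Rightarrow> ('o, 'a, 'p, 'b) funct \<Rightarrow> bool" where
  "naturally_isomorphic C D F G \<longleftrightarrow>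
     (\<exists>\<eta>. nat_trans C D F G \<eta> \<and> (\<forall>X\<in>obj C. iso_arrow D (fobj F X) (fobj G X) (\<eta> X)))"

definition equivalence_of_categories ::
  "('o, 'a, 'z) cat_scheme \<Rightarrow> ('p, 'b, 'y) cat_scheme \<Rightarrow> ('o, 'a, 'p, 'b) funct \<Rightarrow> bool" where
  "equivalence_of_categories C D F \<longleftrightarrow> is_functor C D F \<and>
     (\<exists>G. is_functor D C G \<and>
        naturally_isomorphic C C (functor_comp G F) id_functor \<and>
        naturally_isomorphic D D (functor_comp F G) id_functor)"

text \<open>
  Functors and natural transformations are taken to be \<^const>\<open>undefined\<close> outside their domains, so
  that equality in the functor category is equality of functors and of natural transformations.
\<close>

definition functor_cat :: "('o, 'a, 'z) cat_scheme \<Rightarrow> ('p, 'b, 'y) cat_scheme \<Rightarrow>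
    (('o, 'a, 'p, 'b) funct,
     ('o, 'a, 'p, 'b) funct \<times> ('o, 'a, 'p, 'b) funct \<times> ('o \<Rightarrow> 'b)) cat" where
  "functor_cat C D =
     (let Fun = {F. is_functor C D F \<and> fobj F \<in> extensional (obj C) \<and> farr F \<in> extensional (arr C)}
      in \<lparr>obj = Fun,
          arr = {(F, G, \<eta>). F \<in> Fun \<and> G \<in> Fun \<and> nat_trans C D F G \<eta> \<and> \<eta> \<in> extensional (obj C)},
          src = (\<lambda>(F, G, \<eta>). F),
          tgt = (\<lambda>(F, G, \<eta>). G),
          ident = (\<lambda>F. (F, F, \<lambda>X\<in>obj C. ident D (fobj F X))),
          cmp = (\<lambda>(G', H, \<theta>) (F, G, \<eta>). (F, H, \<lambda>X\<in>obj C. \<theta> X \<cdot>\<^bsub>D\<^esub> \<eta> X))\<rparr>)"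


section \<open>Preadditive categories and coproducts\<close>

record ('o, 'a) preadd_cat = "('o, 'a) cat" +
  zmor :: "'o \<Rightarrow> 'o \<Rightarrow> 'a"
  amor :: "'a \<Rightarrow> 'a \<Rightarrow> 'a" (infixl \<open>\<boxplus>\<index>\<close> 65)

definition hom_group :: "('o, 'a, 'z) preadd_cat_scheme \<Rightarrow> 'o \<Rightarrow> 'o \<Rightarrow> 'a ring" where
  "hom_group C X Y = \<lparr>carrier = Hom C X Y, mult = undefined, one = undefined,
     zero = zmor C X Y, add = amor C\<rparr>"

locale preadditive_category = category C for C :: "('o, 'a, 'z) preadd_cat_scheme" (structure) +
  assumes hom_group: "\<lbrakk>X \<in> obj C; Y \<in> obj C\<rbrakk> \<Longrightarrow> abelian_group (hom_group C X Y)"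
    and cmp_add: "\<lbrakk>f \<in> Hom C X Y; f' \<in> Hom C X Y; g \<in> Hom C Y Z\<rbrakk>
      \<Longrightarrow> g \<cdot> (f \<boxplus> f') = g \<cdot> f \<boxplus> g \<cdot> f'"
    and add_cmp: "\<lbrakk>f \<in> Hom C X Y; g \<in> Hom C Y Z; g' \<in> Hom C Y Z\<rbrakk>
      \<Longrightarrow> (g \<boxplus> g') \<cdot> f = g \<cdot> f \<boxplus> g' \<cdot> f"

definition zero_object :: "('o, 'a, 'z) cat_scheme \<Rightarrow> 'o \<Rightarrow> bool" where
  "zero_object C Z \<longleftrightarrow> Z \<in> obj C \<and>
     (\<forall>X\<in>obj C. (\<exists>!f. f \<in> Hom C X Z) \<and> (\<exists>!f. f \<in> Hom C Z X))"

definition biproduct :: "('o, 'a, 'z) preadd_cat_scheme \<Rightarrow> 'o \<Rightarrow> 'o \<Rightarrow> 'o \<Rightarrow> bool" where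
  "biproduct C X Y S \<longleftrightarrow>
     (\<exists>i\<in>Hom C X S. \<exists>j\<in>Hom C Y S. \<exists>p\<in>Hom C S X. \<exists>q\<in>Hom C S Y.
        p \<cdot>\<^bsub>C\<^esub> i = ident C X \<and> q \<cdot>\<^bsub>C\<^esub> j = ident C Y \<and>
        q \<cdot>\<^bsub>C\<^esub> i = zmor C X Y \<and> p \<cdot>\<^bsub>C\<^esub> j = zmor C Y X \<and>
        i \<cdot>\<^bsub>C\<^esub> p \<boxplus>\<^bsub>C\<^esub> j \<cdot>\<^bsub>C\<^esub> q = ident C S)"

locale additive_category = preadditive_category +
  assumes zero_object_exists: "\<exists>Z. zero_object C Z"
    and biproduct_exists: "\<lbrakk>X \<in> obj C; Y \<in> obj C\<rbrakk> \<Longrightarrow> \<exists>S\<in>obj C. biproduct C X Y S"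

definition coproduct ::
  "('o, 'a, 'z) cat_scheme \<Rightarrow> 'i set \<Rightarrow> ('i \<Rightarrow> 'o) \<Rightarrow> 'o \<Rightarrow> ('i \<Rightarrow> 'a) \<Rightarrow> bool" where
  "coproduct C I X Y \<iota> \<longleftrightarrow> Y \<in> obj C \<and> (\<forall>i\<in>I. \<iota> i \<in> Hom C (X i) Y) \<and>
     (\<forall>Z\<in>obj C. \<forall>f. (\<forall>i\<in>I. f i \<in> Hom C (X i) Z) \<longrightarrow>
        (\<exists>!h. h \<in> Hom C Y Z \<and> (\<forall>i\<in>I. h \<cdot>\<^bsub>C\<^esub> \<iota> i = f i)))"

definition smashing_category :: "'a rel \<Rightarrow> ('o, 'a, 'z) cat_scheme \<Rightarrow> bool" where
  "smashing_category \<kappa> C \<longleftrightarrow>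
     (\<forall>(I :: 'a set) X. small \<kappa> I \<longrightarrow> X ` I \<subseteq> obj C \<longrightarrow> (\<exists>Y \<iota>. coproduct C I X Y \<iota>))"

definition closed_under_coproducts ::
  "'a rel \<Rightarrow> ('o, 'a, 'z) cat_scheme \<Rightarrow> 'o set \<Rightarrow> bool" where
  "closed_under_coproducts \<kappa> C S \<longleftrightarrow>
     (\<forall>(I :: 'a set) X Y \<iota>. small \<kappa> I \<longrightarrow> X ` I \<subseteq> S \<longrightarrow> coproduct C I X Y \<iota> \<longrightarrow> Y \<in> S)"

text \<open>
  Compactness of \<open>M\<close>: for every small coproduct \<open>Y\<close> of a family \<open>X\<close>, the canonical map from the
  direct sum of the groups \<open>C(M, X i)\<close> (finitely supported families \<open>g\<close>) to \<open>C(M, Y)\<close> is bijective.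
\<close>

definition compact_object :: "'a rel \<Rightarrow> ('o, 'a, 'z) preadd_cat_scheme \<Rightarrow> 'o \<Rightarrow> bool" where
  "compact_object \<kappa> C M \<longleftrightarrow> M \<in> obj C \<and>
     (\<forall>(I :: 'a set) X Y \<iota>. small \<kappa> I \<longrightarrow> X ` I \<subseteq> obj C \<longrightarrow> coproduct C I X Y \<iota> \<longrightarrow>
        bij_betw
          (\<lambda>g. finsum (hom_group C M Y) (\<lambda>i. \<iota> i \<cdot>\<^bsub>C\<^esub> g i) {i \<in> I. g i \<noteq> zmor C M (X i)})
          {g \<in> Pi\<^sub>E I (\<lambda>i. Hom C M (X i)). finite {i \<in> I. g i \<noteq> zmor C M (X i)}}
          (Hom C M Y))"


section \<open>Triangulated categories\<close>

record ('o, 'a) tri_cat = "('o, 'a) preadd_cat" +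
  sho :: "'o \<Rightarrow> 'o"
  sha :: "'a \<Rightarrow> 'a"
  tri :: "('a \<times> 'a \<times> 'a) set"

text \<open>
  Only the members of \<^const>\<open>tri\<close> that actually form a triangle matter; in particular,
  \<^const>\<open>full_subcat\<close> restricts the class of distinguished triangles correctly although it
  leaves the field \<^const>\<open>tri\<close> unchanged.
\<close>

definition dist_tri ::
  "('o, 'a, 'z) tri_cat_scheme \<Rightarrow> 'o \<Rightarrow> 'o \<Rightarrow> 'o \<Rightarrow> 'a \<Rightarrow> 'a \<Rightarrow> 'a \<Rightarrow> bool" where
  "dist_tri C X Y Z f g h \<longleftrightarrow>
     f \<in> Hom C X Y \<and> g \<in> Hom C Y Z \<and> h \<in> Hom C Z (sho C X) \<and> (f, g, h) \<in> tri C"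

text \<open>
  As usual, the shift is an automorphism of the category.
\<close>

locale triangulated_category = additive_category C
  for C :: "('o, 'a, 'z) tri_cat_scheme" (structure) +
  assumes shift_functor: "is_functor C C \<lparr>fobj = sho C, farr = sha C\<rparr>"
    and shift_additive: "\<lbrakk>f \<in> Hom C X Y; f' \<in> Hom C X Y\<rbrakk> \<Longrightarrow> sha C (f \<boxplus> f') = sha C f \<boxplus> sha C f'"
    and shift_bij_obj: "bij_betw (sho C) (obj C) (obj C)"
    and shift_bij_arr: "bij_betw (sha C) (arr C) (arr C)"
    and TR_iso: "\<lbrakk>dist_tri C X Y Z f g h;
        f' \<in> Hom C X' Y'; g' \<in> Hom C Y' Z'; h' \<in> Hom C Z' (sho C X');
        iso_arrow C X X' a; iso_arrow C Y Y' b; iso_arrow C Z Z' c;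
        b \<cdot> f = f' \<cdot> a; c \<cdot> g = g' \<cdot> b; sha C a \<cdot> h = h' \<cdot> c\<rbrakk>
      \<Longrightarrow> dist_tri C X' Y' Z' f' g' h'"
    and TR_ident: "\<lbrakk>X \<in> obj C; zero_object C Z\<rbrakk>
      \<Longrightarrow> dist_tri C X X Z (ident C X) (zmor C X Z) (zmor C Z (sho C X))"
    and TR_cone: "f \<in> Hom C X Y \<Longrightarrow> \<exists>Z g h. dist_tri C X Y Z f g h"
    and TR_rotate: "\<lbrakk>f \<in> Hom C X Y; g \<in> Hom C Y Z; h \<in> Hom C Z (sho C X)\<rbrakk>
      \<Longrightarrow> dist_tri C X Y Z f g h \<longleftrightarrow>
          dist_tri C Y Z (sho C X) g h (\<ominus>\<^bsub>hom_group C (sho C X) (sho C Y)\<^esub> sha C f)"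
    and TR_morphism: "\<lbrakk>dist_tri C X Y Z f g h; dist_tri C X' Y' Z' f' g' h';
        a \<in> Hom C X X'; b \<in> Hom C Y Y'; b \<cdot> f = f' \<cdot> a\<rbrakk>
      \<Longrightarrow> \<exists>c\<in>Hom C Z Z'. c \<cdot> g = g' \<cdot> b \<and> sha C a \<cdot> h = h' \<cdot> c"
    and TR_octahedron: "\<lbrakk>dist_tri C X Y A f u u'; dist_tri C Y Z B g v v';
        dist_tri C X Z D (g \<cdot> f) w w'\<rbrakk>
      \<Longrightarrow> \<exists>a\<in>Hom C A D. \<exists>b\<in>Hom C D B. dist_tri C A D B a b (sha C u \<cdot> v') \<and>
            a \<cdot> u = w \<cdot> g \<and> w' \<cdot> a = u' \<and> b \<cdot> w = v \<and> v' \<cdot> b = sha C f \<cdot> w'"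

text \<open>Strictly full triangulated subcategories, given by their object classes.\<close>

definition triangulated_subcat :: "('o, 'a, 'z) tri_cat_scheme \<Rightarrow> 'o set \<Rightarrow> bool" where
  "triangulated_subcat C S \<longleftrightarrow> S \<subseteq> obj C \<and> closed_under_iso C S \<and>
     (\<exists>Z\<in>S. zero_object C Z) \<and>
     sho C ` S = S \<and>
     (\<forall>X Y Z f g h. dist_tri C X Y Z f g h \<longrightarrow> X \<in> S \<longrightarrow> Y \<in> S \<longrightarrow> Z \<in> S)"

definition generates :: "'a rel \<Rightarrow> ('o, 'a, 'z) tri_cat_scheme \<Rightarrow> 'o set \<Rightarrow> bool" where
  "generates \<kappa> C S \<longleftrightarrow>
     \<Inter>{T. triangulated_subcat C T \<and> closed_under_coproducts \<kappa> C T \<and> S \<subseteq> T} = obj C"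


section \<open>Weight structures and t-structures\<close>

definition orthogonal :: "('o, 'a, 'z) preadd_cat_scheme \<Rightarrow> 'o set \<Rightarrow> 'o set \<Rightarrow> bool" where
  "orthogonal C D E \<longleftrightarrow> (\<forall>X\<in>D. \<forall>Y\<in>E. Hom C X Y = {zmor C X Y})"

definition weight_structure ::
  "('o, 'a, 'z) tri_cat_scheme \<Rightarrow> 'o set \<Rightarrow> 'o set \<Rightarrow> bool" where
  "weight_structure C wle wge \<longleftrightarrow> wle \<subseteq> obj C \<and> wge \<subseteq> obj C \<and>
     closed_under_retracts C wle \<and> closed_under_retracts C wge \<and>
     wle \<subseteq> sho C ` wle \<and> sho C ` wge \<subseteq> wge \<and>
     orthogonal C wle (sho C ` wge) \<and>
     (\<forall>M\<in>obj C. \<exists>L\<in>wle. \<exists>N\<in>sho C ` wge. \<exists>f g h. dist_tri C L M N f g h)"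

definition smashing_weight_structure ::
  "'a rel \<Rightarrow> ('o, 'a, 'z) tri_cat_scheme \<Rightarrow> 'o set \<Rightarrow> 'o set \<Rightarrow> bool" where
  "smashing_weight_structure \<kappa> C wle wge \<longleftrightarrow>
     weight_structure C wle wge \<and> closed_under_coproducts \<kappa> C wge"

text \<open>In homological convention; \<open>{N \<in> obj C. sho C N \<in> tle}\<close> is the shift of \<open>tle\<close> by \<open>-1\<close>.\<close>

definition t_structure ::
  "('o, 'a, 'z) tri_cat_scheme \<Rightarrow> 'o set \<Rightarrow> 'o set \<Rightarrow> bool" where
  "t_structure C tle tge \<longleftrightarrow> tle \<subseteq> obj C \<and> tge \<subseteq> obj C \<and>
     closed_under_iso C tle \<and> closed_under_iso C tge \<and>
     tle \<subseteq> sho C ` tle \<and> sho C ` tge \<subseteq> tge \<and>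
     orthogonal C (sho C ` tge) tle \<and>
     (\<forall>M\<in>obj C. \<exists>L\<in>tge. \<exists>N\<in>{N \<in> obj C. sho C N \<in> tle}. \<exists>f g h. dist_tri C L M N f g h)"

definition heart :: "('o, 'a, 'z) cat_scheme \<Rightarrow> 'o set \<Rightarrow> 'o set \<Rightarrow> ('o, 'a, 'z) cat_scheme" where
  "heart C Sle Sge = full_subcat C (Sle \<inter> Sge)"

definition t_restricts ::
  "('o, 'a, 'z) tri_cat_scheme \<Rightarrow> 'o set \<Rightarrow> 'o set \<Rightarrow> 'o set \<Rightarrow> bool" where
  "t_restricts C tle tge S \<longleftrightarrow> t_structure (full_subcat C S) (tle \<inter> S) (tge \<inter> S)"


section \<open>Modules\<close>

definition module_hom ::
  "('r, 'm) ring_scheme \<Rightarrow> ('r, 'a) module \<Rightarrow> ('r, 'b) module \<Rightarrow> ('a \<Rightarrow> 'b) set" where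
  "module_hom R M N = {\<phi> \<in> carrier M \<rightarrow> carrier N.
     (\<forall>x\<in>carrier M. \<forall>y\<in>carrier M. \<phi> (x \<oplus>\<^bsub>M\<^esub> y) = \<phi> x \<oplus>\<^bsub>N\<^esub> \<phi> y) \<and>
     (\<forall>r\<in>carrier R. \<forall>x\<in>carrier M. \<phi> (r \<odot>\<^bsub>M\<^esub> x) = r \<odot>\<^bsub>N\<^esub> \<phi> x)}"

text \<open>
  The category of small modules. The fields \<^const>\<open>mult\<close> and \<^const>\<open>one\<close> that modules inherit
  from rings carry no information.
\<close>

definition module_cat :: "'a rel \<Rightarrow> ('r, 'm) ring_scheme \<Rightarrow>
    (('r, 'a) module, ('r, 'a) module \<times> ('r, 'a) module \<times> ('a \<Rightarrow> 'a)) cat" where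
  "module_cat \<kappa> R =
     (let Ms = {M. module R M \<and> small \<kappa> (carrier M)}
      in \<lparr>obj = Ms,
          arr = {(M, N, \<phi>). M \<in> Ms \<and> N \<in> Ms \<and> \<phi> \<in> module_hom R M N \<inter> extensional (carrier M)},
          src = (\<lambda>(M, N, \<phi>). M),
          tgt = (\<lambda>(M, N, \<phi>). N),
          ident = (\<lambda>M. (M, M, \<lambda>x\<in>carrier M. x)),
          cmp = (\<lambda>(N', P, \<psi>) (M, N, \<phi>). (M, P, \<lambda>x\<in>carrier M. \<psi> (\<phi> x)))\<rparr>)"

text \<open>
  Kernels, cokernels and extensions are expressed by exactness of
  \<open>0 \<rightarrow> K \<rightarrow> M \<rightarrow> N\<close>, \<open>M \<rightarrow> N \<rightarrow> Q \<rightarrow> 0\<close> and \<open>0 \<rightarrow> M \<rightarrow> E \<rightarrow> N \<rightarrow> 0\<close>. Non-emptiness is part of being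
  an (additive) subcategory; the zero module is then the kernel of an identity.
\<close>

definition weak_Serre :: "'a rel \<Rightarrow> ('r, 'm) ring_scheme \<Rightarrow> ('r, 'a) module set \<Rightarrow> bool" where
  "weak_Serre \<kappa> R A \<longleftrightarrow> A \<subseteq> obj (module_cat \<kappa> R) \<and> A \<noteq> {} \<and>
     closed_under_iso (module_cat \<kappa> R) A \<and>
     (\<forall>M\<in>A. \<forall>N\<in>A. \<forall>\<phi>\<in>module_hom R M N. \<forall>K\<in>obj (module_cat \<kappa> R). \<forall>i\<in>module_hom R K M.
        inj_on i (carrier K) \<and> i ` carrier K = a_kernel M N \<phi> \<longrightarrow> K \<in> A) \<and>
     (\<forall>M\<in>A. \<forall>N\<in>A. \<forall>\<phi>\<in>module_hom R M N. \<forall>Q\<in>obj (module_cat \<kappa> R). \<forall>p\<in>module_hom R N Q.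
        \<phi> ` carrier M = a_kernel N Q p \<and> p ` carrier N = carrier Q \<longrightarrow> Q \<in> A) \<and>
     (\<forall>M\<in>A. \<forall>N\<in>A. \<forall>E\<in>obj (module_cat \<kappa> R). \<forall>i\<in>module_hom R M E. \<forall>p\<in>module_hom R E N.
        inj_on i (carrier M) \<and> i ` carrier M = a_kernel E N p \<and> p ` carrier E = carrier N
          \<longrightarrow> E \<in> A)"

definition generated_by_less ::
  "'b rel \<Rightarrow> ('r, 'm) ring_scheme \<Rightarrow> ('r, 'a) module \<Rightarrow> bool" where
  "generated_by_less \<beta> R M \<longleftrightarrow>
     (\<exists>G \<subseteq> carrier M. |G| <o \<beta> \<and> (\<forall>H. submodule H R M \<and> G \<subseteq> H \<longrightarrow> H = carrier M))"

definition modules_generated_by_less ::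
  "'a rel \<Rightarrow> 'b rel \<Rightarrow> ('r, 'm) ring_scheme \<Rightarrow> ('r, 'a) module set" where
  "modules_generated_by_less \<kappa> \<beta> R = {M \<in> obj (module_cat \<kappa> R). generated_by_less \<beta> R M}"


section \<open>Linear structures\<close>

text \<open>
  \<open>sc r f\<close> is the multiple of the arrow \<open>f\<close> by the scalar \<open>r\<close>. For a triangulated category,
  linearity includes linearity of the shift functor.
\<close>

definition linear_triangulated ::
  "('r, 'm) ring_scheme \<Rightarrow> ('o, 'a, 'z) tri_cat_scheme \<Rightarrow> ('r \<Rightarrow> 'a \<Rightarrow> 'a) \<Rightarrow> bool" where
  "linear_triangulated R C sc \<longleftrightarrow>
     (\<forall>X\<in>obj C. \<forall>Y\<in>obj C. module R
        \<lparr>carrier = Hom C X Y, mult = undefined, one = undefined, zero = zmor C X Y, add = amor C,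
         smult = sc\<rparr>) \<and>
     (\<forall>X Y Z. \<forall>f\<in>Hom C X Y. \<forall>g\<in>Hom C Y Z. \<forall>r\<in>carrier R.
        sc r (g \<cdot>\<^bsub>C\<^esub> f) = sc r g \<cdot>\<^bsub>C\<^esub> f \<and> sc r (g \<cdot>\<^bsub>C\<^esub> f) = g \<cdot>\<^bsub>C\<^esub> sc r f) \<and>
     (\<forall>f\<in>arr C. \<forall>r\<in>carrier R. sha C (sc r f) = sc r (sha C f))"

text \<open>
  The module \<open>C(M, N)\<close>, where scalars act through \<open>M\<close>; only \<open>M\<close> needs to lie in the subcategory
  on which \<open>sc\<close> is meaningful.
\<close>

definition hom_module ::
  "('o, 'a, 'z) preadd_cat_scheme \<Rightarrow> ('r \<Rightarrow> 'a \<Rightarrow> 'a) \<Rightarrow> 'o \<Rightarrow> 'o \<Rightarrow> ('r, 'a) module" where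
  "hom_module C sc M N = \<lparr>carrier = Hom C M N, mult = undefined, one = undefined,
     zero = zmor C M N, add = amor C, smult = (\<lambda>r f. f \<cdot>\<^bsub>C\<^esub> sc r (ident C M))\<rparr>"

definition objects_with_homs_in :: "('o, 'a, 'z) preadd_cat_scheme \<Rightarrow> ('r \<Rightarrow> 'a \<Rightarrow> 'a) \<Rightarrow>
    'o set \<Rightarrow> ('r, 'a) module set \<Rightarrow> 'o set" where
  "objects_with_homs_in C sc C0 A = {N \<in> obj C. \<forall>M\<in>C0. hom_module C sc M N \<in> A}"

text \<open>Linear functors from the opposite of \<open>H\<close> to the full subcategory \<open>A\<close> of modules.\<close>

definition linear_functor :: "('r, 'm) ring_scheme \<Rightarrow> ('o, 'a, 'z) preadd_cat_scheme \<Rightarrow>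
    ('r \<Rightarrow> 'a \<Rightarrow> 'a) \<Rightarrow>
    ('o, 'a, ('r, 'a) module, ('r, 'a) module \<times> ('r, 'a) module \<times> ('a \<Rightarrow> 'a)) funct \<Rightarrow> bool" where
  "linear_functor R H sc F \<longleftrightarrow>
     (let ap = (\<lambda>f. snd (snd (farr F f)))
      in \<forall>P\<in>obj H. \<forall>Q\<in>obj H. \<forall>x\<in>carrier (fobj F Q).
           (\<forall>f\<in>Hom H P Q. \<forall>g\<in>Hom H P Q. ap (f \<boxplus>\<^bsub>H\<^esub> g) x = ap f x \<oplus>\<^bsub>fobj F P\<^esub> ap g x) \<and>
           (\<forall>r\<in>carrier R. \<forall>f\<in>Hom H P Q. ap (sc r f) x = r \<odot>\<^bsub>fobj F P\<^esub> ap f x))"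

definition linear_functor_cat ::
  "'a rel \<Rightarrow> ('r, 'm) ring_scheme \<Rightarrow> ('o, 'a, 'z) preadd_cat_scheme \<Rightarrow> ('r \<Rightarrow> 'a \<Rightarrow> 'a) \<Rightarrow>
    ('r, 'a) module set \<Rightarrow> _" where
  "linear_functor_cat \<kappa> R H sc A =
     full_subcat (functor_cat (opposite H) (full_subcat (module_cat \<kappa> R) A))
       {F. linear_functor R H sc F}"

text \<open>The restricted Yoneda functor, sending \<open>N\<close> to \<open>C(-, N)\<close> on the full subcategory \<open>H\<close> of \<open>C\<close>.\<close>

definition yoneda_obj :: "('o, 'a, 'z) preadd_cat_scheme \<Rightarrow> ('r \<Rightarrow> 'a \<Rightarrow> 'a) \<Rightarrow>
    ('o, 'a, 'y) cat_scheme \<Rightarrow> 'o \<Rightarrow>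
    ('o, 'a, ('r, 'a) module, ('r, 'a) module \<times> ('r, 'a) module \<times> ('a \<Rightarrow> 'a)) funct" where
  "yoneda_obj C sc H N = \<lparr>
     fobj = (\<lambda>P\<in>obj H. hom_module C sc P N),
     farr = (\<lambda>f\<in>arr H. (hom_module C sc (tgt H f) N, hom_module C sc (src H f) N,
               \<lambda>g\<in>Hom C (tgt H f) N. g \<cdot>\<^bsub>C\<^esub> f))\<rparr>"

definition restricted_yoneda :: "('o, 'a, 'z) preadd_cat_scheme \<Rightarrow> ('r \<Rightarrow> 'a \<Rightarrow> 'a) \<Rightarrow>
    ('o, 'a, 'y) cat_scheme \<Rightarrow> _" where
  "restricted_yoneda C sc H = \<lparr>
     fobj = yoneda_obj C sc H,
     farr = (\<lambda>h. (yoneda_obj C sc H (src C h), yoneda_obj C sc H (tgt C h),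
               \<lambda>P\<in>obj H. (hom_module C sc P (src C h), hom_module C sc P (tgt C h),
                 \<lambda>g\<in>Hom C P (src C h). h \<cdot>\<^bsub>C\<^esub> g)))\<rparr>"

end

theory Submission
  imports Defs
begin

text \<open>
  Everything is read off from exact sequences of groups \<open>C(M, N)\<close>. The notation is
  \<open>wge\<close> for the common class of the weight structure and of the t-structure, \<open>Hw\<close> for the objects
  of the heart of the weight structure on \<open>C0\<close>, \<open>X[1]\<close> for the shift.

  \<^emph>\<open>The t-structure restricts.\<close> The subcategory \<open>C_A\<close> is triangulated because \<open>C(M, Z)\<close> for a cone \<open>Z\<close>
  sits in the middle of a five-term exact sequence. For truncations, let \<open>M\<close> be an object of \<open>C0\<close>.
  Two weight decompositions yield arrows \<open>M \<rightarrow> G0 \<rightarrow> G1\<close> with \<open>G0\<close> and \<open>G1\<close> in \<open>C0\<close> and \<open>wge\<close> such that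
  \<open>C(G1, L) \<rightarrow> C(G0, L) \<rightarrow> C(M, L) \<rightarrow> 0\<close> is exact for every \<open>L\<close> in \<open>wge\<close>
  (\<open>C0_wge_presentation\<close>). If \<open>L\<close> is the truncation of \<open>N\<close> that lies in \<open>wge\<close>, then
  \<open>C(G, L) = C(G, N)\<close> for all \<open>G\<close> in \<open>wge\<close>, by the orthogonality that defines the t-structure. So
  \<open>C(M, L)\<close> is the cokernel of an arrow \<open>C(G1, N) \<rightarrow> C(G0, N)\<close> of modules in \<open>A\<close>, and \<open>L\<close> is in \<open>C_A\<close>
  whenever \<open>N\<close> is (\<open>CA_truncation\<close>).

  \<^emph>\<open>The heart sees only \<open>Hw\<close>.\<close> Dually, for \<open>G\<close> in \<open>C0\<close> and \<open>wge\<close> there are arrows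
  \<open>P1 \<rightarrow> P0 \<rightarrow> G\<close> with \<open>P0\<close> and \<open>P1\<close> in \<open>Hw\<close> that make \<open>0 \<rightarrow> C(G, N) \<rightarrow> C(P0, N) \<rightarrow> C(P1, N)\<close> exact for all \<open>N\<close> in \<open>tle\<close>
  (\<open>wge_tle_presentation\<close>). Together with the first presentation and with the assumption that \<open>C0\<close>
  generates, an object of the heart of the t-structure is zero if it receives no arrows from \<open>Hw\<close>,
  and it lies in \<open>C_A\<close> if its Hom modules from \<open>Hw\<close> do. Truncating, an object \<open>Z\<close> of \<open>wge\<close> without
  arrows from \<open>Hw\<close> lies in \<open>wge[1]\<close> (\<open>in_shifted_wge_if_Hw_orthogonal\<close>) and hence has no arrows to
  \<open>tle\<close>. This applies to the cone of any arrow \<open>U \<rightarrow> K\<close> in \<open>wge\<close> that is surjective on \<open>C(P, -)\<close> for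
  \<open>P\<close> in \<open>Hw\<close>. Such an arrow exists for every \<open>K\<close> in \<open>wge\<close>, with \<open>U\<close> a small coproduct of objects of \<open>Hw\<close>. It
  plays the role of a projective cover: \<open>Hw\<close> behaves like a set of compact projective generators of
  the heart.

  \<^emph>\<open>The equivalence.\<close> The rest is the classical argument for module categories. An arrow between
  objects of the heart is determined by its effect on \<open>C(P, -)\<close>, as it is determined by its
  restriction to a cover. A natural transformation \<open>C(-, N) \<rightarrow> C(-, N')\<close> on \<open>Hw\<close> gives an arrow from a
  cover of \<open>N\<close> to \<open>N'\<close>. As the objects of \<open>Hw\<close> are compact, this arrow kills the relations, and it
  descends to \<open>N\<close> (\<open>Hw_full\<close>). A linear functor \<open>F\<close> is presented as a cokernel of
  \<open>C(-, U1) \<rightarrow> C(-, U)\<close> with coproducts \<open>U\<close> and \<open>U1\<close> of objects of \<open>Hw\<close>; the truncation to the heart of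
  the cone of \<open>U1 \<rightarrow> U\<close> represents \<open>F\<close> (\<open>functor_realized_in_heart\<close>).

  \<^emph>\<open>Generators.\<close> An object \<open>N\<close> of \<open>C0\<close> is in \<open>C_\<beta>\<close> exactly when all \<open>C(M, N)\<close> with \<open>M\<close> in \<open>C0\<close> have less
  than \<open>\<beta>\<close> generators, which is the hypothesis of the last claim.
\<close>


section \<open>Functor categories and equivalences\<close>

lemma full_subcat_simps [simp]:
  "obj (full_subcat C S) = obj C \<inter> S"
  "src (full_subcat C S) = src C"
  "tgt (full_subcat C S) = tgt C"
  "ident (full_subcat C S) = ident C"
  "cmp (full_subcat C S) = cmp C"
  by (auto simp: full_subcat_def fun_eq_iff)

lemma Hom_full_subcat: "Hom (full_subcat C S) X Y = (if X \<in> S \<and> Y \<in> S then Hom C X Y else {})"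
  by (auto simp: full_subcat_def Hom_def)

lemma full_subcat_full_subcat: "full_subcat (full_subcat C S) T = full_subcat C (S \<inter> T)"
  by (auto simp: full_subcat_def intro!: arg_cong2[where f = "\<lambda>x y. C\<lparr>obj := x, arr := y\<rparr>"])

lemma (in category) Hom_obj:
  assumes "f \<in> Hom C X Y"
  shows "X \<in> obj C" "Y \<in> obj C"
  using assms src_obj tgt_obj by (auto simp: Hom_def)

lemma category_full_subcat:
  assumes "category C"
  shows "category (full_subcat C S)"
proof -
  interpret category C by fact
  show ?thesis
  proof (unfold_locales, goal_cases)
    case (4 f X Y g Z) then show ?case
      using cmp_Hom[of f X Y g Z] by (simp add: Hom_full_subcat split: if_splits)
  next
    case (7 f W X g Y h Z) then show ?case
      using cmp_assoc[of f W X g Y h Z] by (simp add: Hom_full_subcat split: if_splits)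
  qed (auto simp: Hom_full_subcat ident_Hom cmp_ident ident_cmp split: if_splits,
      auto simp: full_subcat_def src_obj tgt_obj)
qed

lemma opposite_simps [simp]:
  "obj (opposite C) = obj C"
  "arr (opposite C) = arr C"
  "src (opposite C) = tgt C"
  "tgt (opposite C) = src C"
  "ident (opposite C) = ident C"
  "Hom (opposite C) X Y = Hom C Y X"
  "cmp (opposite C) g f = f \<cdot>\<^bsub>C\<^esub> g"
  by (auto simp: opposite_def Hom_def)

lemma category_opposite:
  assumes "category C"
  shows "category (opposite C)"
proof -
  interpret category C by fact
  show ?thesis
    by unfold_locales
      (simp_all add: src_obj tgt_obj ident_Hom cmp_ident ident_cmp cmp_Hom cmp_assoc)
qed

lemma iso_arrow_full_subcat:
  assumes "X \<in> S" "Y \<in> S"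
  shows "iso_arrow (full_subcat C S) X Y f \<longleftrightarrow> iso_arrow C X Y f"
  using assms by (simp add: iso_arrow_def inverse_arrows_def Hom_full_subcat)

lemma nat_trans_comp:
  assumes "category D" "is_functor C D F" "is_functor C D G" "is_functor C D H"
    and \<eta>: "nat_trans C D F G \<eta>" and \<theta>: "nat_trans C D G H \<theta>"
    and CH: "\<And>X Y f. f \<in> Hom C X Y \<Longrightarrow> X \<in> obj C \<and> Y \<in> obj C"
  shows "nat_trans C D F H (\<lambda>X\<in>obj C. \<theta> X \<cdot>\<^bsub>D\<^esub> \<eta> X)"
proof -
  interpret D: category D by fact
  have E: "\<eta> X \<in> Hom D (fobj F X) (fobj G X)" "\<theta> X \<in> Hom D (fobj G X) (fobj H X)"
    if "X \<in> obj C" for X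
    using \<eta> \<theta> that by (auto simp: nat_trans_def)
  have "(\<theta> Y \<cdot>\<^bsub>D\<^esub> \<eta> Y) \<cdot>\<^bsub>D\<^esub> farr F f = farr H f \<cdot>\<^bsub>D\<^esub> (\<theta> X \<cdot>\<^bsub>D\<^esub> \<eta> X)"
    if f: "f \<in> Hom C X Y" for X Y f
  proof -
    have Ff: "farr F f \<in> Hom D (fobj F X) (fobj F Y)"
      and Gf: "farr G f \<in> Hom D (fobj G X) (fobj G Y)"
      and Hf: "farr H f \<in> Hom D (fobj H X) (fobj H Y)"
      using assms(2-4) f by (auto simp: is_functor_def)
    note e = E[OF conjunct1[OF CH[OF f]]] E[OF conjunct2[OF CH[OF f]]]
    have "(\<theta> Y \<cdot>\<^bsub>D\<^esub> \<eta> Y) \<cdot>\<^bsub>D\<^esub> farr F f = \<theta> Y \<cdot>\<^bsub>D\<^esub> (\<eta> Y \<cdot>\<^bsub>D\<^esub> farr F f)"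
      using D.cmp_assoc[OF Ff e(3,4)] .
    also have "\<dots> = \<theta> Y \<cdot>\<^bsub>D\<^esub> (farr G f \<cdot>\<^bsub>D\<^esub> \<eta> X)"
      using \<eta> f by (auto simp: nat_trans_def)
    also have "\<dots> = (\<theta> Y \<cdot>\<^bsub>D\<^esub> farr G f) \<cdot>\<^bsub>D\<^esub> \<eta> X"
      using D.cmp_assoc[OF e(1) Gf e(4)] by simp
    also have "\<dots> = (farr H f \<cdot>\<^bsub>D\<^esub> \<theta> X) \<cdot>\<^bsub>D\<^esub> \<eta> X"
      using \<theta> f by (auto simp: nat_trans_def)
    also have "\<dots> = farr H f \<cdot>\<^bsub>D\<^esub> (\<theta> X \<cdot>\<^bsub>D\<^esub> \<eta> X)"
      using D.cmp_assoc[OF e(1,2) Hf] .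
    finally show ?thesis .
  qed
  then show ?thesis
    using D.cmp_Hom[OF E] CH by (auto simp: nat_trans_def)
qed

lemma obj_functor_cat:
  "F \<in> obj (functor_cat C D) \<longleftrightarrow>
    is_functor C D F \<and> fobj F \<in> extensional (obj C) \<and> farr F \<in> extensional (arr C)"
  by (simp add: functor_cat_def Let_def)

lemma Hom_functor_cat:
  "\<alpha> \<in> Hom (functor_cat C D) F G \<longleftrightarrow>
    F \<in> obj (functor_cat C D) \<and> G \<in> obj (functor_cat C D) \<and>
    (\<exists>\<eta>. \<alpha> = (F, G, \<eta>) \<and> nat_trans C D F G \<eta> \<and> \<eta> \<in> extensional (obj C))"
  by (auto simp: functor_cat_def Let_def Hom_def)

lemma ident_functor_cat:
  "ident (functor_cat C D) F = (F, F, \<lambda>X\<in>obj C. ident D (fobj F X))"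
  by (simp add: functor_cat_def Let_def)

lemma cmp_functor_cat:
  "(G', H, \<theta>) \<cdot>\<^bsub>functor_cat C D\<^esub> (F, G, \<eta>) = (F, H, \<lambda>X\<in>obj C. \<theta> X \<cdot>\<^bsub>D\<^esub> \<eta> X)"
  by (simp add: functor_cat_def Let_def)

lemma category_functor_cat:
  assumes "category C" "category D"
  shows "category (functor_cat C D)"
proof -
  interpret C: category C by fact
  interpret D: category D by fact
  let ?K = "functor_cat C D"
  note sim = Hom_functor_cat ident_functor_cat cmp_functor_cat
  have CH: "\<And>X Y f. f \<in> Hom C X Y \<Longrightarrow> X \<in> obj C \<and> Y \<in> obj C" using C.Hom_obj by blast
  have o: "F \<in> obj ?K \<Longrightarrow> is_functor C D F" for F by (simp add: obj_functor_cat)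
  have nt: "nat_trans C D F F (\<lambda>X\<in>obj C. ident D (fobj F X))" if F: "is_functor C D F" for F
  proof -
    have "ident D (fobj F Y) \<cdot>\<^bsub>D\<^esub> farr F f = farr F f \<cdot>\<^bsub>D\<^esub> ident D (fobj F X)"
      if f: "f \<in> Hom C X Y" for X Y f
    proof -
      have "farr F f \<in> Hom D (fobj F X) (fobj F Y)" using F f by (auto simp: is_functor_def)
      then show ?thesis by (simp add: D.ident_cmp D.cmp_ident)
    qed
    then show ?thesis
      using F CH D.ident_Hom by (auto simp: nat_trans_def is_functor_def)
  qed
  show ?thesis
  proof
    fix f assume "f \<in> arr ?K"
    then show "src ?K f \<in> obj ?K" "tgt ?K f \<in> obj ?K" by (auto simp: functor_cat_def Let_def)
  next
    fix X assume "X \<in> obj ?K"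
    then show "ident ?K X \<in> Hom ?K X X" using nt[OF o] by (auto simp: sim)
  next
    fix f g X Y Z assume "f \<in> Hom ?K X Y" "g \<in> Hom ?K Y Z"
    then show "g \<cdot>\<^bsub>?K\<^esub> f \<in> Hom ?K X Z"
      using nat_trans_comp[OF \<open>category D\<close> o o o _ _ CH] by (auto simp: sim)
  next
    fix f X Y assume f: "f \<in> Hom ?K X Y"
    then obtain \<eta> where e: "f = (X, Y, \<eta>)" "nat_trans C D X Y \<eta>" "\<eta> \<in> extensional (obj C)"
      by (auto simp: sim)
    then show "f \<cdot>\<^bsub>?K\<^esub> ident ?K X = f" "ident ?K Y \<cdot>\<^bsub>?K\<^esub> f = f"
      by (auto simp: sim nat_trans_def D.cmp_ident D.ident_cmp
          intro!: extensionalityI[OF restrict_extensional])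
  next
    fix f g h W X Y Z assume "f \<in> Hom ?K W X" "g \<in> Hom ?K X Y" "h \<in> Hom ?K Y Z"
    then obtain \<eta> \<theta> \<zeta> where "f = (W, X, \<eta>)" "g = (X, Y, \<theta>)" "h = (Y, Z, \<zeta>)"
      and "nat_trans C D W X \<eta>" "nat_trans C D X Y \<theta>" "nat_trans C D Y Z \<zeta>"
      by (auto simp: sim)
    moreover from this have "(\<zeta> P \<cdot>\<^bsub>D\<^esub> \<theta> P) \<cdot>\<^bsub>D\<^esub> \<eta> P = \<zeta> P \<cdot>\<^bsub>D\<^esub> (\<theta> P \<cdot>\<^bsub>D\<^esub> \<eta> P)"
      if "P \<in> obj C" for P
      using that D.cmp_assoc unfolding nat_trans_def by blast
    ultimately show "(h \<cdot>\<^bsub>?K\<^esub> g) \<cdot>\<^bsub>?K\<^esub> f = h \<cdot>\<^bsub>?K\<^esub> (g \<cdot>\<^bsub>?K\<^esub> f)"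
      by (auto simp: sim intro!: restrict_ext)
  qed
qed

text \<open>The inverse of a transformation with invertible components is natural automatically.\<close>

lemma iso_arrow_functor_cat:
  assumes "category C" "category D"
    and F: "F \<in> obj (functor_cat C D)" and G: "G \<in> obj (functor_cat C D)"
    and \<eta>: "nat_trans C D F G \<eta>" "\<eta> \<in> extensional (obj C)"
    and iso: "\<And>X. X \<in> obj C \<Longrightarrow> iso_arrow D (fobj F X) (fobj G X) (\<eta> X)"
  shows "iso_arrow (functor_cat C D) F G (F, G, \<eta>)"
proof -
  interpret C: category C by fact
  interpret D: category D by fact
  from iso obtain \<theta>0 where
    \<theta>0: "\<And>X. X \<in> obj C \<Longrightarrow> inverse_arrows D (fobj F X) (fobj G X) (\<eta> X) (\<theta>0 X)"
    unfolding iso_arrow_def by metis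
  define \<theta> where "\<theta> = restrict \<theta>0 (obj C)"
  have \<theta>: "\<eta> X \<in> Hom D (fobj F X) (fobj G X)" "\<theta> X \<in> Hom D (fobj G X) (fobj F X)"
    "\<theta> X \<cdot>\<^bsub>D\<^esub> \<eta> X = ident D (fobj F X)" "\<eta> X \<cdot>\<^bsub>D\<^esub> \<theta> X = ident D (fobj G X)" if "X \<in> obj C" for X
    using \<theta>0[OF that] that by (auto simp: \<theta>_def inverse_arrows_def)
  have "\<theta> Y \<cdot>\<^bsub>D\<^esub> farr G f = farr F f \<cdot>\<^bsub>D\<^esub> \<theta> X" if f: "f \<in> Hom C X Y" for X Y f
  proof -
    have Ff: "farr F f \<in> Hom D (fobj F X) (fobj F Y)"
      and Gf: "farr G f \<in> Hom D (fobj G X) (fobj G Y)"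
      using F G f by (auto simp: is_functor_def obj_functor_cat)
    note X = \<theta>[OF C.Hom_obj(1)[OF f]] and Y = \<theta>[OF C.Hom_obj(2)[OF f]]
    have "\<theta> Y \<cdot>\<^bsub>D\<^esub> farr G f = (\<theta> Y \<cdot>\<^bsub>D\<^esub> farr G f) \<cdot>\<^bsub>D\<^esub> (\<eta> X \<cdot>\<^bsub>D\<^esub> \<theta> X)"
      using X Y D.cmp_ident[OF D.cmp_Hom[OF Gf Y(2)]] by simp
    also have "\<dots> = \<theta> Y \<cdot>\<^bsub>D\<^esub> ((farr G f \<cdot>\<^bsub>D\<^esub> \<eta> X) \<cdot>\<^bsub>D\<^esub> \<theta> X)"
      using D.cmp_assoc[OF D.cmp_Hom[OF X(2,1)] Gf Y(2)] D.cmp_assoc[OF X(2,1) Gf] by simp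
    also have "\<dots> = \<theta> Y \<cdot>\<^bsub>D\<^esub> ((\<eta> Y \<cdot>\<^bsub>D\<^esub> farr F f) \<cdot>\<^bsub>D\<^esub> \<theta> X)"
      using \<eta> f by (auto simp: nat_trans_def)
    also have "\<dots> = (\<theta> Y \<cdot>\<^bsub>D\<^esub> \<eta> Y) \<cdot>\<^bsub>D\<^esub> (farr F f \<cdot>\<^bsub>D\<^esub> \<theta> X)"
      using D.cmp_assoc[OF D.cmp_Hom[OF X(2) Ff] Y(1,2)] D.cmp_assoc[OF X(2) Ff Y(1)] by simp
    also have "\<dots> = farr F f \<cdot>\<^bsub>D\<^esub> \<theta> X"
      using Y(3) D.ident_cmp[OF D.cmp_Hom[OF X(2) Ff]] by simp
    finally show ?thesis .
  qed
  then have "nat_trans C D G F \<theta>" using \<theta> by (auto simp: nat_trans_def)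
  moreover have "\<theta> \<in> extensional (obj C)" by (simp add: \<theta>_def)
  ultimately have "inverse_arrows (functor_cat C D) F G (F, G, \<eta>) (G, F, \<theta>)"
    using F G \<eta> \<theta> by (auto simp: inverse_arrows_def Hom_functor_cat cmp_functor_cat
        ident_functor_cat intro!: restrict_ext)
  then show ?thesis unfolding iso_arrow_def by blast
qed

text \<open>
  The quasi-inverse and the two isomorphisms are chosen objectwise; fullness transports arrows
  back, and faithfulness turns every required identity into one in the target category.
\<close>

lemma equivalence_if_fully_faithful_essentially_surjective:
  assumes "category C" "category D" and F: "is_functor C D F"
    and ff: "\<And>X Y. X \<in> obj C \<Longrightarrow> Y \<in> obj C \<Longrightarrow>
      bij_betw (farr F) (Hom C X Y) (Hom D (fobj F X) (fobj F Y))"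
    and es: "\<And>Y. Y \<in> obj D \<Longrightarrow> \<exists>X\<in>obj C. isomorphic D (fobj F X) Y"
  shows "equivalence_of_categories C D F"
proof -
  interpret C: category C by fact
  interpret D: category D by fact
  have Fo: "fobj F X \<in> obj D" if "X \<in> obj C" for X using F that by (auto simp: is_functor_def)
  have Fa: "farr F f \<in> Hom D (fobj F X) (fobj F Y)" if "f \<in> Hom C X Y" for f X Y
    using F that by (auto simp: is_functor_def)
  have Fid: "farr F (ident C X) = ident D (fobj F X)" if "X \<in> obj C" for X
    using F that by (auto simp: is_functor_def)
  have Fc: "farr F (g \<cdot>\<^bsub>C\<^esub> f) = farr F g \<cdot>\<^bsub>D\<^esub> farr F f" if "f \<in> Hom C X Y" "g \<in> Hom C Y Z"
    for f g X Y Z using F that unfolding is_functor_def by blast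
  have inj: "a = b" if "a \<in> Hom C X Y" "b \<in> Hom C X Y" "farr F a = farr F b" for a b X Y
    using ff[of X Y] C.Hom_obj[OF that(1)] that by (auto simp: bij_betw_def dest: inj_onD)
  have surj: "\<exists>a\<in>Hom C X Y. farr F a = b"
    if "b \<in> Hom D (fobj F X) (fobj F Y)" "X \<in> obj C" "Y \<in> obj C" for b X Y
    using ff[OF that(2,3)] that(1) unfolding bij_betw_def by (metis imageE)
  have "\<forall>Y\<in>obj D. \<exists>X e e'. X \<in> obj C \<and> inverse_arrows D (fobj F X) Y e e'"
    using es unfolding isomorphic_def iso_arrow_def by blast
  then obtain G0 e e' where G0: "\<And>Y. Y \<in> obj D \<Longrightarrow> G0 Y \<in> obj C"
    and ee: "\<And>Y. Y \<in> obj D \<Longrightarrow> inverse_arrows D (fobj F (G0 Y)) Y (e Y) (e' Y)"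
    by metis
  have e: "e Y \<in> Hom D (fobj F (G0 Y)) Y" and e': "e' Y \<in> Hom D Y (fobj F (G0 Y))"
    and e'e: "e' Y \<cdot>\<^bsub>D\<^esub> e Y = ident D (fobj F (G0 Y))" and ee': "e Y \<cdot>\<^bsub>D\<^esub> e' Y = ident D Y"
    if "Y \<in> obj D" for Y
    using ee[OF that] by (auto simp: inverse_arrows_def)
  have "\<exists>a. a \<in> Hom C (G0 Y) (G0 Z) \<and> farr F a = e' Z \<cdot>\<^bsub>D\<^esub> (f \<cdot>\<^bsub>D\<^esub> e Y)"
    if f: "f \<in> Hom D Y Z" for f Y Z
    using surj[of "e' Z \<cdot>\<^bsub>D\<^esub> (f \<cdot>\<^bsub>D\<^esub> e Y)" "G0 Y" "G0 Z"] G0 D.Hom_obj[OF f]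
      D.cmp_Hom[OF D.cmp_Hom[OF e f] e'] by blast
  then have "\<forall>f. \<exists>a. \<forall>Y Z. f \<in> Hom D Y Z \<longrightarrow>
      a \<in> Hom C (G0 Y) (G0 Z) \<and> farr F a = e' Z \<cdot>\<^bsub>D\<^esub> (f \<cdot>\<^bsub>D\<^esub> e Y)"
    by (simp add: Hom_def)
  then obtain G1 where "\<forall>f. \<forall>Y Z. f \<in> Hom D Y Z \<longrightarrow>
      G1 f \<in> Hom C (G0 Y) (G0 Z) \<and> farr F (G1 f) = e' Z \<cdot>\<^bsub>D\<^esub> (f \<cdot>\<^bsub>D\<^esub> e Y)"
    by metis
  then have G1: "G1 f \<in> Hom C (G0 Y) (G0 Z)" "farr F (G1 f) = e' Z \<cdot>\<^bsub>D\<^esub> (f \<cdot>\<^bsub>D\<^esub> e Y)"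
    if "f \<in> Hom D Y Z" for f Y Z using that by auto
  define G where "G = \<lparr>fobj = G0, farr = G1\<rparr>"
  have nat: "e Z \<cdot>\<^bsub>D\<^esub> farr F (G1 f) = f \<cdot>\<^bsub>D\<^esub> e Y" if f: "f \<in> Hom D Y Z" for f Y Z
  proof -
    note Y = D.Hom_obj(1)[OF f] and Z = D.Hom_obj(2)[OF f]
    have fe: "f \<cdot>\<^bsub>D\<^esub> e Y \<in> Hom D (fobj F (G0 Y)) Z" using D.cmp_Hom[OF e[OF Y] f] .
    show ?thesis unfolding G1(2)[OF f] D.cmp_assoc[OF fe e'[OF Z] e[OF Z], symmetric] ee'[OF Z]
      using D.ident_cmp[OF fe] .
  qed
  have Gf: "is_functor D C G"
    unfolding is_functor_def G_def
  proof (simp, intro conjI allI ballI)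
    fix Y assume Y: "Y \<in> obj D"
    show "G0 Y \<in> obj C" using G0 Y .
    show "G1 (ident D Y) = ident C (G0 Y)"
      using G1[OF D.ident_Hom[OF Y]] C.ident_Hom[OF G0[OF Y]] Fid[OF G0[OF Y]] D.ident_cmp[OF e[OF Y]]
        e'e[OF Y] by (auto intro: inj)
  next
    fix X Y f assume "f \<in> Hom D X Y" then show "G1 f \<in> Hom C (G0 X) (G0 Y)" using G1 by blast
  next
    fix X Y Z f g assume f: "f \<in> Hom D X Y" and g: "g \<in> Hom D Y Z"
    note X = D.Hom_obj(1)[OF f] and Y = D.Hom_obj(2)[OF f] and Z = D.Hom_obj(2)[OF g]
    note gf = D.cmp_Hom[OF f g]
    have fe: "f \<cdot>\<^bsub>D\<^esub> e X \<in> Hom D (fobj F (G0 X)) Y" using D.cmp_Hom[OF e[OF X] f] .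
    have "farr F (G1 g \<cdot>\<^bsub>C\<^esub> G1 f) = (e' Z \<cdot>\<^bsub>D\<^esub> (g \<cdot>\<^bsub>D\<^esub> e Y)) \<cdot>\<^bsub>D\<^esub> farr F (G1 f)"
      using Fc[OF G1(1)[OF f] G1(1)[OF g]] G1(2)[OF g] by simp
    also have "\<dots> = e' Z \<cdot>\<^bsub>D\<^esub> (g \<cdot>\<^bsub>D\<^esub> (e Y \<cdot>\<^bsub>D\<^esub> farr F (G1 f)))"
      using D.cmp_assoc[OF Fa[OF G1(1)[OF f]] D.cmp_Hom[OF e[OF Y] g] e'[OF Z]]
        D.cmp_assoc[OF Fa[OF G1(1)[OF f]] e[OF Y] g] by simp
    also have "\<dots> = e' Z \<cdot>\<^bsub>D\<^esub> ((g \<cdot>\<^bsub>D\<^esub> f) \<cdot>\<^bsub>D\<^esub> e X)"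
      using nat[OF f] D.cmp_assoc[OF e[OF X] f g] by simp
    finally have "farr F (G1 g \<cdot>\<^bsub>C\<^esub> G1 f) = farr F (G1 (g \<cdot>\<^bsub>D\<^esub> f))" using G1(2)[OF gf] by simp
    then show "G1 (g \<cdot>\<^bsub>D\<^esub> f) = G1 g \<cdot>\<^bsub>C\<^esub> G1 f"
      using inj[OF G1(1)[OF gf] C.cmp_Hom[OF G1(1)[OF f] G1(1)[OF g]]] by simp
  qed
  have FG: "naturally_isomorphic D D (functor_comp F G) id_functor"
    unfolding naturally_isomorphic_def nat_trans_def functor_comp_def id_functor_def G_def iso_arrow_def
    by (rule exI[of _ e]) (use e nat ee in \<open>simp, blast\<close>)
  have "\<forall>X\<in>obj C. \<exists>u v. inverse_arrows C (G0 (fobj F X)) X u v \<and> farr F u = e (fobj F X)"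
  proof
    fix X assume X: "X \<in> obj C"
    note Y = Fo[OF X]
    obtain u v where u: "u \<in> Hom C (G0 (fobj F X)) X" "farr F u = e (fobj F X)"
      and v: "v \<in> Hom C X (G0 (fobj F X))" "farr F v = e' (fobj F X)"
      using surj[OF e[OF Y] G0[OF Y] X] surj[OF e'[OF Y] X G0[OF Y]] by blast
    have "v \<cdot>\<^bsub>C\<^esub> u = ident C (G0 (fobj F X))"
      using Fc[OF u(1) v(1)] u v e'e[OF Y] Fid[OF G0[OF Y]]
      by (intro inj[OF C.cmp_Hom[OF u(1) v(1)] C.ident_Hom[OF G0[OF Y]]]) simp
    moreover have "u \<cdot>\<^bsub>C\<^esub> v = ident C X"
      using Fc[OF v(1) u(1)] u v ee'[OF Y] Fid[OF X]
      by (intro inj[OF C.cmp_Hom[OF v(1) u(1)] C.ident_Hom[OF X]]) simp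
    ultimately show "\<exists>u v. inverse_arrows C (G0 (fobj F X)) X u v \<and> farr F u = e (fobj F X)"
      using u v unfolding inverse_arrows_def by blast
  qed
  then obtain u v where uv: "\<And>X. X \<in> obj C \<Longrightarrow> inverse_arrows C (G0 (fobj F X)) X (u X) (v X)"
    and Fu: "\<And>X. X \<in> obj C \<Longrightarrow> farr F (u X) = e (fobj F X)" by metis
  have u: "u X \<in> Hom C (G0 (fobj F X)) X" if "X \<in> obj C" for X
    using uv[OF that] by (simp add: inverse_arrows_def)
  have natu: "u Y \<cdot>\<^bsub>C\<^esub> G1 (farr F f) = f \<cdot>\<^bsub>C\<^esub> u X" if f: "f \<in> Hom C X Y" for f X Y
  proof -
    note X = C.Hom_obj(1)[OF f] and Y = C.Hom_obj(2)[OF f]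
    note Gf = G1(1)[OF Fa[OF f]]
    have "farr F (u Y \<cdot>\<^bsub>C\<^esub> G1 (farr F f)) = farr F (f \<cdot>\<^bsub>C\<^esub> u X)"
      using Fc[OF Gf u[OF Y]] Fc[OF u[OF X] f] nat[OF Fa[OF f]] Fu[OF X] Fu[OF Y] by simp
    then show ?thesis using inj[OF C.cmp_Hom[OF Gf u[OF Y]] C.cmp_Hom[OF u[OF X] f]] by simp
  qed
  have GF: "naturally_isomorphic C C (functor_comp G F) id_functor"
    unfolding naturally_isomorphic_def nat_trans_def functor_comp_def id_functor_def G_def iso_arrow_def
    by (rule exI[of _ u]) (use u uv natu in \<open>simp, blast\<close>)
  show ?thesis unfolding equivalence_of_categories_def using F Gf FG GF by blast
qed


section \<open>Small modules and weak Serre subcategories\<close>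

lemma small_subset:
  assumes "small \<kappa> X" "Y \<subseteq> X"
  shows "small \<kappa> Y"
  using assms card_of_mono1 ordLeq_ordLess_trans unfolding small_def by blast

lemma small_Sigma:
  assumes "universe_card \<kappa>" "small \<kappa> S" "\<And>s. s \<in> S \<Longrightarrow> small \<kappa> (X s)"
  shows "small \<kappa> (Sigma S X)"
proof -
  have "infinite (Field \<kappa>)"
    using assms(1) Field_natLeq card_order_on_well_order_on
    by (metis cardSuc_least infinite_iff_natLeq_ordLeq ordLess_imp_ordLeq ordLeq_ordIso_trans
        card_of_Field_ordIso ordIso_symmetric universe_card_def)
  then show ?thesis
    using assms regularCard_stable stable_elim unfolding universe_card_def small_def by metis
qed

text \<open>
  Coproducts are indexed by sets of arrows; this makes an arbitrary small set available as an
  index set, since the cardinal lives on the type of arrows.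
\<close>

lemma small_reindex:
  fixes \<kappa> :: "'a rel"
  assumes "Card_order \<kappa>" "small \<kappa> X"
  obtains I :: "'a set" and e where "small \<kappa> I" "bij_betw e I X"
proof -
  obtain I :: "'a set" where I: "|X| =o |I|" "|I| <o \<kappa>"
    using assms internalize_card_of_ordLess[of X \<kappa>] unfolding small_def by blast
  then obtain e where "bij_betw e I X" using card_of_ordIso ordIso_symmetric by blast
  with I(2) that show ?thesis unfolding small_def by blast
qed

lemma obj_module_cat: "M \<in> obj (module_cat \<kappa> R) \<longleftrightarrow> module R M \<and> small \<kappa> (carrier M)"
  by (simp add: module_cat_def Let_def)

lemma Hom_module_cat:
  "a \<in> Hom (module_cat \<kappa> R) M N \<longleftrightarrow>
    M \<in> obj (module_cat \<kappa> R) \<and> N \<in> obj (module_cat \<kappa> R) \<and>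
    (\<exists>\<phi>. a = (M, N, \<phi>) \<and> \<phi> \<in> module_hom R M N \<and> \<phi> \<in> extensional (carrier M))"
  by (auto simp: module_cat_def Let_def Hom_def)

lemma ident_module_cat: "ident (module_cat \<kappa> R) M = (M, M, \<lambda>x\<in>carrier M. x)"
  by (simp add: module_cat_def Let_def)

lemma cmp_module_cat:
  "(N', P, \<psi>) \<cdot>\<^bsub>module_cat \<kappa> R\<^esub> (M, N, \<phi>) = (M, P, \<lambda>x\<in>carrier M. \<psi> (\<phi> x))"
  by (simp add: module_cat_def Let_def)

lemma module_homD:
  assumes "\<phi> \<in> module_hom R M N"
  shows "x \<in> carrier M \<Longrightarrow> \<phi> x \<in> carrier N"
    and "x \<in> carrier M \<Longrightarrow> y \<in> carrier M \<Longrightarrow> \<phi> (x \<oplus>\<^bsub>M\<^esub> y) = \<phi> x \<oplus>\<^bsub>N\<^esub> \<phi> y"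
    and "r \<in> carrier R \<Longrightarrow> x \<in> carrier M \<Longrightarrow> \<phi> (r \<odot>\<^bsub>M\<^esub> x) = r \<odot>\<^bsub>N\<^esub> \<phi> x"
  using assms by (auto simp: module_hom_def)

lemma module_hom_comp:
  assumes "\<phi> \<in> module_hom R M N" "\<psi> \<in> module_hom R N P"
  shows "(\<lambda>x. \<psi> (\<phi> x)) \<in> module_hom R M P"
  using assms by (auto simp: module_hom_def Pi_def)

lemma module_hom_restrict:
  assumes "module R M" "\<phi> \<in> module_hom R M N"
  shows "restrict \<phi> (carrier M) \<in> module_hom R M N"
proof -
  interpret module R M by fact
  show ?thesis using assms(2) by (auto simp: module_hom_def)
qed

lemma category_module_cat: "category (module_cat \<kappa> R)"
proof -
  let ?K = "module_cat \<kappa> R"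
  note sim = Hom_module_cat ident_module_cat cmp_module_cat
  show ?thesis
  proof
    fix f assume "f \<in> arr ?K"
    then show "src ?K f \<in> obj ?K" "tgt ?K f \<in> obj ?K" by (auto simp: module_cat_def Let_def)
  next
    fix M assume M: "M \<in> obj ?K"
    then have "module R M" by (simp add: obj_module_cat)
    moreover have "(\<lambda>x. x) \<in> module_hom R M M" by (simp add: module_hom_def)
    ultimately have "restrict (\<lambda>x. x) (carrier M) \<in> module_hom R M M" by (rule module_hom_restrict)
    then show "ident ?K M \<in> Hom ?K M M" using M by (simp add: sim)
  next
    fix f g M N P assume "f \<in> Hom ?K M N" "g \<in> Hom ?K N P"
    then show "g \<cdot>\<^bsub>?K\<^esub> f \<in> Hom ?K M P"
      using module_hom_restrict[OF _ module_hom_comp, of R M _ N _ P]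
      by (auto simp: sim obj_module_cat)
  next
    fix f M N assume "f \<in> Hom ?K M N"
    then show "f \<cdot>\<^bsub>?K\<^esub> ident ?K M = f" "ident ?K N \<cdot>\<^bsub>?K\<^esub> f = f"
      by (auto simp: sim module_homD intro!: extensionalityI[OF restrict_extensional])
  next
    fix f g h M N P Q assume "f \<in> Hom ?K M N" "g \<in> Hom ?K N P" "h \<in> Hom ?K P Q"
    then show "(h \<cdot>\<^bsub>?K\<^esub> g) \<cdot>\<^bsub>?K\<^esub> f = h \<cdot>\<^bsub>?K\<^esub> (g \<cdot>\<^bsub>?K\<^esub> f)"
      by (auto simp: sim module_homD intro!: restrict_ext)
  qed
qed

lemma iso_arrow_module_cat:
  assumes M: "M \<in> obj (module_cat \<kappa> R)" and N: "N \<in> obj (module_cat \<kappa> R)"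
    and \<phi>: "\<phi> \<in> module_hom R M N" "\<phi> \<in> extensional (carrier M)"
    and bij: "bij_betw \<phi> (carrier M) (carrier N)"
  shows "iso_arrow (module_cat \<kappa> R) M N (M, N, \<phi>)"
proof -
  interpret M: module R M using M by (simp add: obj_module_cat)
  interpret N: module R N using N by (simp add: obj_module_cat)
  define \<psi> where "\<psi> = restrict (inv_into (carrier M) \<phi>) (carrier N)"
  have \<psi>: "\<psi> y \<in> carrier M" "\<phi> (\<psi> y) = y" if "y \<in> carrier N" for y
    using that bij by (auto simp: \<psi>_def bij_betw_def inv_into_into f_inv_into_f)
  have \<psi>\<phi>: "\<psi> (\<phi> x) = x" if "x \<in> carrier M" for x
    using that bij module_homD(1)[OF \<phi>(1) that] by (auto simp: \<psi>_def bij_betw_def)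
  have inj: "x = y" if "x \<in> carrier M" "y \<in> carrier M" "\<phi> x = \<phi> y" for x y
    using that bij by (auto simp: bij_betw_def dest: inj_onD)
  have "\<psi> \<in> module_hom R N M"
    unfolding module_hom_def
  proof (intro CollectI conjI ballI)
    show "\<psi> \<in> carrier N \<rightarrow> carrier M" using \<psi> by blast
    show "\<psi> (x \<oplus>\<^bsub>N\<^esub> y) = \<psi> x \<oplus>\<^bsub>M\<^esub> \<psi> y" if "x \<in> carrier N" "y \<in> carrier N" for x y
      by (rule inj) (use that \<psi> in \<open>simp_all add: module_homD[OF \<phi>(1)]\<close>)
    show "\<psi> (r \<odot>\<^bsub>N\<^esub> x) = r \<odot>\<^bsub>M\<^esub> \<psi> x" if "r \<in> carrier R" "x \<in> carrier N" for r x
      by (rule inj) (use that \<psi> in \<open>simp_all add: module_homD[OF \<phi>(1)]\<close>)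
  qed
  then have "inverse_arrows (module_cat \<kappa> R) M N (M, N, \<phi>) (N, M, \<psi>)"
    using M N \<phi> \<psi> \<psi>\<phi> by (auto simp: inverse_arrows_def Hom_module_cat cmp_module_cat
        ident_module_cat \<psi>_def intro!: restrict_ext)
  then show ?thesis unfolding iso_arrow_def by blast
qed

lemma module_hom_zero:
  assumes "module R M" "module R N" "\<phi> \<in> module_hom R M N"
  shows "\<phi> \<zero>\<^bsub>M\<^esub> = \<zero>\<^bsub>N\<^esub>"
proof -
  interpret M: module R M by fact
  interpret N: module R N by fact
  have "\<phi> \<zero>\<^bsub>M\<^esub> \<oplus>\<^bsub>N\<^esub> \<phi> \<zero>\<^bsub>M\<^esub> = \<phi> \<zero>\<^bsub>M\<^esub>"
    using module_homD(2)[OF assms(3), of "\<zero>\<^bsub>M\<^esub>" "\<zero>\<^bsub>M\<^esub>"] by simp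
  then show ?thesis using module_homD(1)[OF assms(3), of "\<zero>\<^bsub>M\<^esub>"] by simp
qed

lemma module_hom_minus:
  assumes "module R M" "module R N" "\<phi> \<in> module_hom R M N" "x \<in> carrier M"
  shows "\<phi> (\<ominus>\<^bsub>M\<^esub> x) = \<ominus>\<^bsub>N\<^esub> \<phi> x"
proof -
  interpret M: module R M by fact
  interpret N: module R N by fact
  have "\<phi> (\<ominus>\<^bsub>M\<^esub> x) \<oplus>\<^bsub>N\<^esub> \<phi> x = \<zero>\<^bsub>N\<^esub>"
    using module_homD(2)[OF assms(3), of "\<ominus>\<^bsub>M\<^esub> x" x] assms(4) module_hom_zero[OF assms(1-3)]
    by (simp add: M.l_neg)
  then show ?thesis
    using module_homD(1)[OF assms(3)] assms(4) N.minus_equality by simp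
qed

lemma submodule_image:
  assumes "module R M" "module R N" and \<phi>: "\<phi> \<in> module_hom R M N"
  shows "submodule (\<phi> ` carrier M) R N"
proof -
  interpret M: module R M by fact
  interpret N: module R N by fact
  show ?thesis
  proof (rule N.submoduleI)
    show "\<phi> ` carrier M \<subseteq> carrier N" using module_homD[OF \<phi>] by blast
    show "\<zero>\<^bsub>N\<^esub> \<in> \<phi> ` carrier M" using module_hom_zero[OF assms] M.zero_closed by (metis imageI)
    show "\<ominus>\<^bsub>N\<^esub> a \<in> \<phi> ` carrier M" if a: "a \<in> \<phi> ` carrier M" for a
    proof -
      from a obtain x where "x \<in> carrier M" "a = \<phi> x" by blast
      then show ?thesis
        using module_hom_minus[OF assms, of x] by (intro image_eqI[of _ _ "\<ominus>\<^bsub>M\<^esub> x"]) simp_all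
    qed
    show "a \<oplus>\<^bsub>N\<^esub> b \<in> \<phi> ` carrier M" if ab: "a \<in> \<phi> ` carrier M" "b \<in> \<phi> ` carrier M" for a b
    proof -
      from ab obtain x y where "x \<in> carrier M" "a = \<phi> x" "y \<in> carrier M" "b = \<phi> y" by blast
      then show ?thesis
        using module_homD(2)[OF \<phi>, of x y] by (intro image_eqI[of _ _ "x \<oplus>\<^bsub>M\<^esub> y"]) simp_all
    qed
    show "r \<odot>\<^bsub>N\<^esub> a \<in> \<phi> ` carrier M" if r: "r \<in> carrier R" and a: "a \<in> \<phi> ` carrier M" for r a
    proof -
      from a obtain x where "x \<in> carrier M" "a = \<phi> x" by blast
      then show ?thesis
        using module_homD(3)[OF \<phi> r, of x] r by (intro image_eqI[of _ _ "r \<odot>\<^bsub>M\<^esub> x"]) simp_all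
    qed
  qed
qed

lemma submodule_kernel:
  assumes "module R M" "module R N" and \<phi>: "\<phi> \<in> module_hom R M N"
  shows "submodule (a_kernel M N \<phi>) R M"
proof -
  interpret M: module R M by fact
  interpret N: module R N by fact
  show ?thesis
    by (rule M.submoduleI)
      (simp_all add: a_kernel_def' module_homD[OF \<phi>] module_hom_zero[OF assms]
        module_hom_minus[OF assms] Collect_mono subset_iff)
qed

lemma
  assumes "weak_Serre \<kappa> R A"
  shows weak_Serre_obj: "M \<in> A \<Longrightarrow> M \<in> obj (module_cat \<kappa> R)"
    and weak_Serre_nonempty: "A \<noteq> {}"
    and weak_Serre_kernel: "\<lbrakk>M \<in> A; N \<in> A; \<phi> \<in> module_hom R M N; K \<in> obj (module_cat \<kappa> R);
      i \<in> module_hom R K M; inj_on i (carrier K); i ` carrier K = a_kernel M N \<phi>\<rbrakk> \<Longrightarrow> K \<in> A"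
    and weak_Serre_cokernel: "\<lbrakk>M \<in> A; N \<in> A; \<phi> \<in> module_hom R M N; Q \<in> obj (module_cat \<kappa> R);
      p \<in> module_hom R N Q; \<phi> ` carrier M = a_kernel N Q p; p ` carrier N = carrier Q\<rbrakk> \<Longrightarrow> Q \<in> A"
    and weak_Serre_extension: "\<lbrakk>M \<in> A; N \<in> A; E \<in> obj (module_cat \<kappa> R); i \<in> module_hom R M E;
      p \<in> module_hom R E N; inj_on i (carrier M); i ` carrier M = a_kernel E N p;
      p ` carrier E = carrier N\<rbrakk> \<Longrightarrow> E \<in> A"
proof -
  note w = assms[unfolded weak_Serre_def, THEN conjunct2]
  show "A \<noteq> {}" using w by simp
  show "M \<in> obj (module_cat \<kappa> R)" if "M \<in> A" using that assms[unfolded weak_Serre_def, THEN conjunct1] by blast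
  note w = w[THEN conjunct2, THEN conjunct2]
  show "K \<in> A" if "M \<in> A" "N \<in> A" "\<phi> \<in> module_hom R M N" "K \<in> obj (module_cat \<kappa> R)"
      "i \<in> module_hom R K M" "inj_on i (carrier K)" "i ` carrier K = a_kernel M N \<phi>"
    using w[THEN conjunct1, rule_format, OF that(1-5)] that(6,7) by simp
  show "Q \<in> A" if "M \<in> A" "N \<in> A" "\<phi> \<in> module_hom R M N" "Q \<in> obj (module_cat \<kappa> R)"
      "p \<in> module_hom R N Q" "\<phi> ` carrier M = a_kernel N Q p" "p ` carrier N = carrier Q"
    using w[THEN conjunct2, THEN conjunct1, rule_format, OF that(1-5)] that(6,7) by simp
  show "E \<in> A" if "M \<in> A" "N \<in> A" "E \<in> obj (module_cat \<kappa> R)" "i \<in> module_hom R M E"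
      "p \<in> module_hom R E N" "inj_on i (carrier M)" "i ` carrier M = a_kernel E N p"
      "p ` carrier E = carrier N"
    using w[THEN conjunct2, THEN conjunct2, rule_format, OF that(1-5)] that(6-8) by simp
qed

text \<open>A module isomorphic to \<open>M\<close> is a kernel of the zero endomorphism of \<open>M\<close>.\<close>

lemma weak_Serre_iso:
  assumes A: "weak_Serre \<kappa> R A" and M: "M \<in> A" and K: "K \<in> obj (module_cat \<kappa> R)"
    and i: "i \<in> module_hom R K M" "bij_betw i (carrier K) (carrier M)"
  shows "K \<in> A"
proof -
  interpret M: module R M using weak_Serre_obj[OF A M] by (simp add: obj_module_cat)
  have "(\<lambda>x. \<zero>\<^bsub>M\<^esub>) \<in> module_hom R M M" by (simp add: module_hom_def)
  moreover have "a_kernel M M (\<lambda>x. \<zero>\<^bsub>M\<^esub>) = carrier M" by (simp add: a_kernel_def')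
  ultimately show ?thesis
    using weak_Serre_kernel[OF A M M _ K i(1)] i(2) by (simp add: bij_betw_def)
qed

text \<open>
  Dually, it is a cokernel of the zero endomorphism.
\<close>

lemma weak_Serre_iso':
  assumes A: "weak_Serre \<kappa> R A" and M: "M \<in> A" and Q: "Q \<in> obj (module_cat \<kappa> R)"
    and p: "p \<in> module_hom R M Q" "bij_betw p (carrier M) (carrier Q)"
  shows "Q \<in> A"
proof -
  have mM: "module R M" and mQ: "module R Q"
    using weak_Serre_obj[OF A M] Q by (simp_all add: obj_module_cat)
  interpret M: module R M by fact
  have z: "(\<lambda>x. \<zero>\<^bsub>M\<^esub>) \<in> module_hom R M M" by (simp add: module_hom_def)
  have "a_kernel M Q p = {\<zero>\<^bsub>M\<^esub>}"
    using module_hom_zero[OF mM mQ p(1)] p(2) M.zero_closed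
    by (auto simp: a_kernel_def' bij_betw_def dest: inj_onD[of p _ _ "\<zero>\<^bsub>M\<^esub>"])
  then have "(\<lambda>x. \<zero>\<^bsub>M\<^esub>) ` carrier M = a_kernel M Q p" using M.zero_closed by auto
  then show ?thesis using weak_Serre_cokernel[OF A M M z Q p(1)] p(2) by (simp add: bij_betw_def)
qed

lemma weak_Serre_zero:
  assumes A: "weak_Serre \<kappa> R A" and K: "K \<in> obj (module_cat \<kappa> R)" "carrier K = {\<zero>\<^bsub>K\<^esub>}"
  shows "K \<in> A"
proof -
  obtain M where M: "M \<in> A" using weak_Serre_nonempty[OF A] by blast
  interpret M: module R M using weak_Serre_obj[OF A M] by (simp add: obj_module_cat)
  have "(\<lambda>x. x) \<in> module_hom R M M" by (simp add: module_hom_def)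
  moreover have "(\<lambda>x. \<zero>\<^bsub>M\<^esub>) \<in> module_hom R K M" by (simp add: module_hom_def)
  moreover have "a_kernel M M (\<lambda>x. x) = {\<zero>\<^bsub>M\<^esub>}" by (auto simp: a_kernel_def')
  ultimately show ?thesis
    using weak_Serre_kernel[OF A M M _ K(1), of "\<lambda>x. x" "\<lambda>x. \<zero>\<^bsub>M\<^esub>"] K(2) by simp
qed

text \<open>
  The middle term of a five-term exact sequence is an extension of the kernel of the last map by
  the cokernel of the first one. Both are realized as submodules, of \<open>M4\<close> and of \<open>M3\<close>, so that
  they are small and live on the same type.
\<close>

lemma weak_Serre_five:
  assumes A: "weak_Serre \<kappa> R A" and M: "M1 \<in> A" "M2 \<in> A" "M4 \<in> A" "M5 \<in> A"
    and M3: "M3 \<in> obj (module_cat \<kappa> R)"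
    and \<alpha>: "\<alpha> \<in> module_hom R M1 M2" and \<beta>: "\<beta> \<in> module_hom R M2 M3"
    and \<gamma>: "\<gamma> \<in> module_hom R M3 M4" and \<delta>: "\<delta> \<in> module_hom R M4 M5"
    and ex: "\<alpha> ` carrier M1 = a_kernel M2 M3 \<beta>" "\<beta> ` carrier M2 = a_kernel M3 M4 \<gamma>"
      "\<gamma> ` carrier M3 = a_kernel M4 M5 \<delta>"
  shows "M3 \<in> A"
proof -
  have o: "module R M" "small \<kappa> (carrier M)" if "M \<in> A" for M
    using weak_Serre_obj[OF A that] by (auto simp: obj_module_cat)
  note M3' = M3[unfolded obj_module_cat, THEN conjunct1] M3[unfolded obj_module_cat, THEN conjunct2]
  define Q where "Q = M3\<lparr>carrier := \<beta> ` carrier M2\<rparr>"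
  define K where "K = M4\<lparr>carrier := a_kernel M4 M5 \<delta>\<rparr>"
  have subQ: "\<beta> ` carrier M2 \<subseteq> carrier M3" using module_homD[OF \<beta>] by blast
  have subK: "a_kernel M4 M5 \<delta> \<subseteq> carrier M4" by (auto simp: a_kernel_def')
  have "module R Q"
    unfolding Q_def
    by (rule submodule.submodule_is_module[OF submodule_image[OF o(1)[OF M(2)] M3'(1) \<beta>] M3'(1)])
  then have Q: "Q \<in> obj (module_cat \<kappa> R)"
    using small_subset[OF M3'(2) subQ] by (simp add: obj_module_cat Q_def)
  have "module R K"
    unfolding K_def
    by (rule submodule.submodule_is_module[OF submodule_kernel[OF o(1)[OF M(3)] o(1)[OF M(4)] \<delta>] o(1)[OF M(3)]])
  then have K: "K \<in> obj (module_cat \<kappa> R)"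
    using small_subset[OF o(2)[OF M(3)] subK] by (simp add: obj_module_cat K_def)
  have \<beta>Q: "\<beta> \<in> module_hom R M2 Q" using \<beta> by (auto simp: module_hom_def Q_def)
  have "a_kernel M2 Q \<beta> = a_kernel M2 M3 \<beta>" by (auto simp: a_kernel_def' Q_def)
  then have "\<alpha> ` carrier M1 = a_kernel M2 Q \<beta>" using ex(1) by metis
  moreover have "\<beta> ` carrier M2 = carrier Q" by (simp add: Q_def)
  ultimately have QA: "Q \<in> A" by (rule weak_Serre_cokernel[OF A M(1,2) \<alpha> Q \<beta>Q])
  have "(\<lambda>x. x) \<in> module_hom R K M4" using subK by (auto simp: module_hom_def K_def)
  then have KA: "K \<in> A"
    by (rule weak_Serre_kernel[OF A M(3,4) \<delta> K]) (simp_all add: K_def)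
  have \<gamma>K: "\<gamma> \<in> module_hom R M3 K"
    using module_homD[OF \<gamma>] ex(3) unfolding module_hom_def K_def by auto
  have Qi: "(\<lambda>x. x) \<in> module_hom R Q M3" using subQ by (auto simp: module_hom_def Q_def)
  have "a_kernel M3 K \<gamma> = a_kernel M3 M4 \<gamma>" by (auto simp: a_kernel_def' K_def)
  then have "(\<lambda>x. x) ` carrier Q = a_kernel M3 K \<gamma>" using ex(2) by (simp add: Q_def)
  moreover have "\<gamma> ` carrier M3 = carrier K" using ex(3) by (simp add: K_def)
  ultimately show ?thesis
    by (intro weak_Serre_extension[OF A QA KA M3 Qi \<gamma>K]) simp_all
qed


section \<open>Preadditive categories\<close>

context preadditive_category
begin

lemma carrier_hom_group [simp]: "carrier (hom_group C X Y) = Hom C X Y"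
  and zero_hom_group [simp]: "zero (hom_group C X Y) = zmor C X Y"
  and add_hom_group [simp]: "add (hom_group C X Y) = amor C"
  by (simp_all add: hom_group_def)

lemma zmor_Hom: "X \<in> obj C \<Longrightarrow> Y \<in> obj C \<Longrightarrow> zmor C X Y \<in> Hom C X Y"
  using abelian_monoid.zero_closed[OF abelian_group.axioms(1)[OF hom_group]] by simp

lemma add_Hom: "f \<in> Hom C X Y \<Longrightarrow> g \<in> Hom C X Y \<Longrightarrow> f \<boxplus> g \<in> Hom C X Y"
  using abelian_monoid.a_closed[OF abelian_group.axioms(1)[OF hom_group[OF Hom_obj]], of f X Y f X Y f g]
  by simp

lemma cmp_zmor:
  assumes f: "f \<in> Hom C X Y" and W: "W \<in> obj C"
  shows "f \<cdot> zmor C W X = zmor C W Y"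
proof -
  note X = Hom_obj(1)[OF f] and Y = Hom_obj(2)[OF f]
  interpret A: abelian_group "hom_group C W Y" using hom_group[OF W Y] .
  interpret B: abelian_group "hom_group C W X" using hom_group[OF W X] .
  note z = zmor_Hom[OF W X]
  have "f \<cdot> zmor C W X \<boxplus> f \<cdot> zmor C W X = f \<cdot> zmor C W X"
    using cmp_add[OF z z f] B.l_zero z by simp
  then show ?thesis using A.add.r_cancel_one cmp_Hom[OF z f] by simp
qed

lemma zmor_cmp:
  assumes f: "f \<in> Hom C X Y" and W: "W \<in> obj C"
  shows "zmor C Y W \<cdot> f = zmor C X W"
proof -
  note X = Hom_obj(1)[OF f] and Y = Hom_obj(2)[OF f]
  interpret A: abelian_group "hom_group C X W" using hom_group[OF X W] .
  interpret B: abelian_group "hom_group C Y W" using hom_group[OF Y W] .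
  note z = zmor_Hom[OF Y W]
  have "zmor C Y W \<cdot> f \<boxplus> zmor C Y W \<cdot> f = zmor C Y W \<cdot> f"
    using add_cmp[OF f z z] B.l_zero z by simp
  then show ?thesis using A.add.r_cancel_one cmp_Hom[OF f z] by simp
qed

definition neg :: "'a \<Rightarrow> 'a" where
  "neg f = \<ominus>\<^bsub>hom_group C (src C f) (tgt C f)\<^esub> f"

lemma neg_eq: "f \<in> Hom C X Y \<Longrightarrow> \<ominus>\<^bsub>hom_group C X Y\<^esub> f = neg f"
  by (auto simp: neg_def Hom_def)

lemma
  assumes f: "f \<in> Hom C X Y"
  shows neg_Hom: "neg f \<in> Hom C X Y"
    and add_neg: "f \<boxplus> neg f = zmor C X Y"
    and neg_neg: "neg (neg f) = f"
    and neg_unique: "g \<in> Hom C X Y \<Longrightarrow> g \<boxplus> f = zmor C X Y \<Longrightarrow> g = neg f"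
proof -
  interpret A: abelian_group "hom_group C X Y" using hom_group[OF Hom_obj[OF f]] .
  note e = neg_eq[OF f, symmetric]
  show n: "neg f \<in> Hom C X Y" using A.a_inv_closed[of f] f by (simp add: e)
  show "f \<boxplus> neg f = zmor C X Y" using A.r_neg[of f] f by (simp add: e)
  show "neg (neg f) = f" using A.minus_minus[of f] f neg_eq[OF n] neg_eq[OF f] by simp
  show "g = neg f" if "g \<in> Hom C X Y" "g \<boxplus> f = zmor C X Y"
    using A.minus_equality[of g f] that f by (simp add: e)
qed

lemma neg_zmor:
  assumes X: "X \<in> obj C" and Y: "Y \<in> obj C"
  shows "neg (zmor C X Y) = zmor C X Y"
proof -
  interpret A: abelian_group "hom_group C X Y" using hom_group[OF X Y] .
  show ?thesis using A.minus_equality[of "zmor C X Y" "zmor C X Y"] A.l_zero zmor_Hom[OF X Y]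
      neg_eq[OF zmor_Hom[OF X Y]] by simp
qed

lemma cmp_neg:
  assumes f: "f \<in> Hom C X Y" and g: "g \<in> Hom C Y Z"
  shows "g \<cdot> neg f = neg (g \<cdot> f)" "neg g \<cdot> f = neg (g \<cdot> f)"
proof -
  interpret A: abelian_group "hom_group C X Z" using hom_group[OF Hom_obj(1)[OF f] Hom_obj(2)[OF g]] .
  note a = cmp_Hom[OF f g]
  have "g \<cdot> neg f \<boxplus> g \<cdot> f = zmor C X Z"
    using cmp_add[OF f neg_Hom[OF f] g] add_neg[OF f] cmp_zmor[OF g Hom_obj(1)[OF f]]
      A.a_comm cmp_Hom[OF neg_Hom[OF f] g] a by simp
  then show "g \<cdot> neg f = neg (g \<cdot> f)"
    by (rule neg_unique[OF a cmp_Hom[OF neg_Hom[OF f] g]])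
  have "neg g \<cdot> f \<boxplus> g \<cdot> f = zmor C X Z"
    using add_cmp[OF f g neg_Hom[OF g]] add_neg[OF g] zmor_cmp[OF f Hom_obj(2)[OF g]]
      A.a_comm cmp_Hom[OF f neg_Hom[OF g]] a by simp
  then show "neg g \<cdot> f = neg (g \<cdot> f)"
    by (rule neg_unique[OF a cmp_Hom[OF f neg_Hom[OF g]]])
qed

definition diff :: "'a \<Rightarrow> 'a \<Rightarrow> 'a" (infixl \<open>\<boxminus>\<close> 65) where
  "f \<boxminus> g = f \<boxplus> neg g"

lemma diff_Hom: "f \<in> Hom C X Y \<Longrightarrow> g \<in> Hom C X Y \<Longrightarrow> f \<boxminus> g \<in> Hom C X Y"
  by (simp add: diff_def add_Hom neg_Hom)

lemma cmp_diff: "\<lbrakk>f \<in> Hom C X Y; g \<in> Hom C X Y; h \<in> Hom C Y Z\<rbrakk> \<Longrightarrow> h \<cdot> (f \<boxminus> g) = h \<cdot> f \<boxminus> h \<cdot> g"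
  by (simp add: diff_def cmp_add[of _ X Y] neg_Hom cmp_neg(1)[of _ X Y])

lemma diff_cmp: "\<lbrakk>h \<in> Hom C X Y; f \<in> Hom C Y Z; g \<in> Hom C Y Z\<rbrakk> \<Longrightarrow> (f \<boxminus> g) \<cdot> h = f \<cdot> h \<boxminus> g \<cdot> h"
  by (simp add: diff_def add_cmp[of _ X Y] neg_Hom cmp_neg(2)[of _ X Y])

lemma diff_eq_zmor:
  assumes f: "f \<in> Hom C X Y" and g: "g \<in> Hom C X Y"
  shows "f \<boxminus> g = zmor C X Y \<longleftrightarrow> f = g"
proof
  assume "f \<boxminus> g = zmor C X Y"
  then have "f = neg (neg g)" using neg_unique[OF neg_Hom[OF g] f] by (simp add: diff_def)
  then show "f = g" using neg_neg[OF g] by simp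
next
  assume "f = g" then show "f \<boxminus> g = zmor C X Y" using add_neg[OF g] by (simp add: diff_def)
qed

lemma diff_add:
  assumes a: "a \<in> Hom C X Y" and b: "b \<in> Hom C X Y"
  shows "(a \<boxminus> b) \<boxplus> b = a"
proof -
  interpret A: abelian_group "hom_group C X Y" using hom_group[OF Hom_obj[OF a]] .
  have "(a \<boxplus> neg b) \<boxplus> b = a \<boxplus> (b \<boxplus> neg b)"
    using A.a_assoc[of a "neg b" b] A.a_comm[of b "neg b"] a b neg_Hom[OF b] by simp
  then show ?thesis using A.r_zero[of a] add_neg[OF b] a by (simp add: diff_def)
qed

lemma zero_objectI:
  assumes X: "X \<in> obj C" and z: "ident C X = zmor C X X"
  shows "zero_object C X"
proof -
  have "f = zmor C Y X" if f: "f \<in> Hom C Y X" for f Y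
    using ident_cmp[OF f] zmor_cmp[OF f X] z by simp
  moreover have "f = zmor C X Y" if f: "f \<in> Hom C X Y" for f Y
    using cmp_ident[OF f] cmp_zmor[OF f X] z by simp
  ultimately show ?thesis
    unfolding zero_object_def using X zmor_Hom by metis
qed

lemma
  assumes Z: "zero_object C Z"
  shows Hom_to_zero: "f \<in> Hom C X Z \<Longrightarrow> f = zmor C X Z"
    and Hom_from_zero: "f \<in> Hom C Z X \<Longrightarrow> f = zmor C Z X"
  using Z zmor_Hom Hom_obj unfolding zero_object_def by metis+

lemma Hom_eq_zmor_iff:
  assumes "X \<in> obj C" "Y \<in> obj C"
  shows "Hom C X Y = {zmor C X Y} \<longleftrightarrow> (\<forall>f\<in>Hom C X Y. f = zmor C X Y)"
  using zmor_Hom[OF assms] by blast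

end


section \<open>Exactness of Hom functors\<close>

context triangulated_category
begin

lemma sho_obj: "X \<in> obj C \<Longrightarrow> sho C X \<in> obj C"
  and sha_Hom: "f \<in> Hom C X Y \<Longrightarrow> sha C f \<in> Hom C (sho C X) (sho C Y)"
  and sha_ident: "X \<in> obj C \<Longrightarrow> sha C (ident C X) = ident C (sho C X)"
  and sha_cmp: "f \<in> Hom C X Y \<Longrightarrow> g \<in> Hom C Y Z \<Longrightarrow> sha C (g \<cdot> f) = sha C g \<cdot> sha C f"
  using shift_functor unfolding is_functor_def by simp_all

lemma sho_surj: "Y \<in> obj C \<Longrightarrow> \<exists>X\<in>obj C. sho C X = Y"
  using shift_bij_obj unfolding bij_betw_def by (metis imageE)

lemma sho_inj: "X \<in> obj C \<Longrightarrow> Y \<in> obj C \<Longrightarrow> sho C X = sho C Y \<Longrightarrow> X = Y"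
  using shift_bij_obj by (auto simp: bij_betw_def dest: inj_onD)

lemma sha_inj: "f \<in> Hom C X Y \<Longrightarrow> g \<in> Hom C X' Y' \<Longrightarrow> sha C f = sha C g \<Longrightarrow> f = g"
  using shift_bij_arr by (auto simp: bij_betw_def Hom_def dest: inj_onD)

lemma sha_surj:
  assumes X: "X \<in> obj C" and Y: "Y \<in> obj C" and g: "g \<in> Hom C (sho C X) (sho C Y)"
  shows "\<exists>f\<in>Hom C X Y. sha C f = g"
proof -
  have "g \<in> arr C" using g by (simp add: Hom_def)
  then obtain f where f: "f \<in> arr C" "sha C f = g"
    using shift_bij_arr unfolding bij_betw_def by (metis imageE)
  then have f': "f \<in> Hom C (src C f) (tgt C f)" by (simp add: Hom_def)
  have "sho C (src C f) = sho C X" "sho C (tgt C f) = sho C Y"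
    using sha_Hom[OF f'] f(2) g by (auto simp: Hom_def)
  then show ?thesis using sho_inj X Y Hom_obj[OF f'] f f' by metis
qed

lemma sha_zmor:
  assumes X: "X \<in> obj C" and Y: "Y \<in> obj C"
  shows "sha C (zmor C X Y) = zmor C (sho C X) (sho C Y)"
proof -
  interpret A: abelian_group "hom_group C X Y" using hom_group[OF X Y] .
  interpret B: abelian_group "hom_group C (sho C X) (sho C Y)" using hom_group sho_obj X Y by blast
  note z = zmor_Hom[OF X Y]
  have "sha C (zmor C X Y) \<boxplus> sha C (zmor C X Y) = sha C (zmor C X Y)"
    using shift_additive[OF z z] A.l_zero z by simp
  then show ?thesis using B.add.r_cancel_one sha_Hom[OF z] by simp
qed

lemma Hom_shift_zero:
  assumes X: "X \<in> obj C" and Y: "Y \<in> obj C"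
  shows "Hom C (sho C X) (sho C Y) = {zmor C (sho C X) (sho C Y)} \<longleftrightarrow> Hom C X Y = {zmor C X Y}"
  unfolding Hom_eq_zmor_iff[OF X Y] Hom_eq_zmor_iff[OF sho_obj[OF X] sho_obj[OF Y]]
  using sha_surj[OF X Y] sha_zmor[OF X Y] sha_Hom sha_inj zmor_Hom[OF X Y] by metis

lemma dist_triD:
  assumes "dist_tri C X Y Z f g h"
  shows "f \<in> Hom C X Y" "g \<in> Hom C Y Z" "h \<in> Hom C Z (sho C X)"
    "X \<in> obj C" "Y \<in> obj C" "Z \<in> obj C" "sho C X \<in> obj C" "sho C Y \<in> obj C"
  using assms Hom_obj sho_obj unfolding dist_tri_def by blast+

lemma rotate:
  assumes "dist_tri C X Y Z f g h"
  shows "dist_tri C Y Z (sho C X) g h (neg (sha C f))"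
  using TR_rotate[OF dist_triD(1-3)[OF assms]] assms neg_eq[OF sha_Hom[OF dist_triD(1)[OF assms]]]
  by simp

lemma inverse_rotate:
  assumes t: "dist_tri C X Y (sho C W) f g h" and W: "W \<in> obj C"
  shows "\<exists>k. dist_tri C W X Y k f g"
proof -
  note X = dist_triD(4)[OF t]
  obtain k where k: "k \<in> Hom C W X" "sha C k = neg h"
    using sha_surj[OF W X neg_Hom[OF dist_triD(3)[OF t]]] by blast
  have "\<ominus>\<^bsub>hom_group C (sho C W) (sho C X)\<^esub> sha C k = h"
    using neg_eq[OF sha_Hom[OF k(1)]] k(2) neg_neg[OF dist_triD(3)[OF t]] by simp
  then show ?thesis using TR_rotate[OF k(1) dist_triD(1,2)[OF t]] t by auto
qed

lemma shift_triangle: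
  assumes "dist_tri C X Y Z f g h"
  shows "\<exists>f' g' h'. dist_tri C (sho C X) (sho C Y) (sho C Z) f' g' h'"
  using rotate[OF rotate[OF rotate[OF assms]]] by blast

lemma ident_triangle:
  assumes W: "W \<in> obj C"
  shows "\<exists>Z. Z \<in> obj C \<and> dist_tri C W W Z (ident C W) (zmor C W Z) (zmor C Z (sho C W))"
  using TR_ident[OF W] zero_object_exists by (auto simp: zero_object_def)

text \<open>Exactness of \<open>C(-, W)\<close>: map the triangle to the triangle on the identity of \<open>W\<close>.\<close>

lemma exact_from1:
  assumes t: "dist_tri C X Y Z f g h" and u: "u \<in> Hom C Y W" and uf: "u \<cdot> f = zmor C X W"
  shows "\<exists>v\<in>Hom C Z W. v \<cdot> g = u"
proof -
  note W = Hom_obj(2)[OF u]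
  obtain Z0 where Z0: "Z0 \<in> obj C" "dist_tri C W W Z0 (ident C W) (zmor C W Z0) (zmor C Z0 (sho C W))"
    using ident_triangle[OF W] by blast
  obtain W0 where W0: "W0 \<in> obj C" "sho C W0 = Z0" using sho_surj Z0(1) by blast
  obtain k where k: "dist_tri C W0 W W k (ident C W) (zmor C W Z0)"
    using inverse_rotate[of W W W0] Z0(2) W0 by blast
  have "u \<cdot> f = k \<cdot> zmor C X W0"
    using uf cmp_zmor[OF dist_triD(1)[OF k] dist_triD(4)[OF t]] by simp
  then obtain c where "c \<in> Hom C Z W" "c \<cdot> g = ident C W \<cdot> u"
    using TR_morphism[OF t k zmor_Hom[OF dist_triD(4)[OF t] W0(1)] u] by blast
  then show ?thesis using ident_cmp[OF u] by auto
qed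

lemma exact_from2:
  assumes t: "dist_tri C X Y Z f g h" and u: "u \<in> Hom C Z W" and "u \<cdot> g = zmor C Y W"
  shows "\<exists>v\<in>Hom C (sho C X) W. v \<cdot> h = u"
  using exact_from1[OF rotate[OF t] u] assms(3) .

lemma exact_from3:
  assumes t: "dist_tri C X Y Z f g h" and u: "u \<in> Hom C (sho C X) W" and uh: "u \<cdot> h = zmor C Z W"
  shows "\<exists>v\<in>Hom C (sho C Y) W. v \<cdot> sha C f = u"
proof -
  note sf = sha_Hom[OF dist_triD(1)[OF t]]
  obtain v where v: "v \<in> Hom C (sho C Y) W" "v \<cdot> neg (sha C f) = u"
    using exact_from1[OF rotate[OF rotate[OF t]] u uh] by blast
  then have "neg v \<cdot> sha C f = u" using cmp_neg[OF sf v(1)] by simp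
  then show ?thesis using neg_Hom[OF v(1)] by blast
qed

text \<open>Exactness of \<open>C(W, -)\<close>: map the rotated identity triangle to the rotated triangle.\<close>

lemma exact_to1:
  assumes t: "dist_tri C X Y Z f g h" and u: "u \<in> Hom C W Y" and gu: "g \<cdot> u = zmor C W Z"
  shows "\<exists>v\<in>Hom C W X. f \<cdot> v = u"
proof -
  note W = Hom_obj(1)[OF u] and X = dist_triD(4)[OF t] and Z = dist_triD(6)[OF t]
  obtain Z0 where Z0: "Z0 \<in> obj C" "dist_tri C W W Z0 (ident C W) (zmor C W Z0) (zmor C Z0 (sho C W))"
    using ident_triangle[OF W] by blast
  note r = rotate[OF Z0(2)]
  have "zmor C Z0 Z \<cdot> zmor C W Z0 = g \<cdot> u"
    using gu zmor_cmp[OF zmor_Hom[OF W Z0(1)] Z] by simp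
  then obtain c where c: "c \<in> Hom C (sho C W) (sho C X)"
    "sha C u \<cdot> neg (sha C (ident C W)) = neg (sha C f) \<cdot> c"
    using TR_morphism[OF r rotate[OF t] u zmor_Hom[OF Z0(1) Z]] by blast
  obtain v where v: "v \<in> Hom C W X" "sha C v = c" using sha_surj[OF W X c(1)] by blast
  note sf = sha_Hom[OF dist_triD(1)[OF t]] and su = sha_Hom[OF u]
    and si = ident_Hom[OF sho_obj[OF W]]
  have "neg (sha C u) = neg (sha C f \<cdot> c)"
    using c(2) cmp_neg(1)[OF si su] cmp_neg(2)[OF c(1) sf] cmp_ident[OF su] sha_ident[OF W] by simp
  then have "sha C u = sha C f \<cdot> c"
    using neg_neg[OF su] neg_neg[OF cmp_Hom[OF c(1) sf]] by metis
  then have "sha C (f \<cdot> v) = sha C u" using sha_cmp[OF v(1) dist_triD(1)[OF t]] v(2) by simp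
  then have "f \<cdot> v = u" using sha_inj[OF cmp_Hom[OF v(1) dist_triD(1)[OF t]] u] by simp
  with v(1) show ?thesis by blast
qed

lemma exact_to2:
  assumes t: "dist_tri C X Y Z f g h" and u: "u \<in> Hom C W Z" and "h \<cdot> u = zmor C W (sho C X)"
  shows "\<exists>v\<in>Hom C W Y. g \<cdot> v = u"
  using exact_to1[OF rotate[OF t] u] assms(3) .

lemma exact_to3:
  assumes t: "dist_tri C X Y Z f g h" and u: "u \<in> Hom C W (sho C X)"
    and z: "sha C f \<cdot> u = zmor C W (sho C Y)"
  shows "\<exists>v\<in>Hom C W Z. h \<cdot> v = u"
proof -
  note sf = sha_Hom[OF dist_triD(1)[OF t]]
  have "neg (sha C f) \<cdot> u = neg (zmor C W (sho C Y))" using cmp_neg(2)[OF u sf] z by simp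
  also have "\<dots> = zmor C W (sho C Y)"
    using neg_zmor[OF Hom_obj(1)[OF u] dist_triD(8)[OF t]] .
  finally show ?thesis using exact_to1[OF rotate[OF rotate[OF t]] u] by blast
qed

lemma triangle_cmp_zero:
  assumes t: "dist_tri C X Y Z f g h"
  shows "g \<cdot> f = zmor C X Z"
proof -
  note X = dist_triD(4)[OF t] and f = dist_triD(1)[OF t]
  obtain Z0 where Z0: "Z0 \<in> obj C" "dist_tri C X X Z0 (ident C X) (zmor C X Z0) (zmor C Z0 (sho C X))"
    using ident_triangle[OF X] by blast
  obtain c where c: "c \<in> Hom C Z0 Z" "c \<cdot> zmor C X Z0 = g \<cdot> f"
    using TR_morphism[OF Z0(2) t ident_Hom[OF X] f] by blast
  then show ?thesis using cmp_zmor[OF c(1) X] by simp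
qed

lemma triangle_cmp_zero':
  assumes t: "dist_tri C X Y Z f g h"
  shows "h \<cdot> g = zmor C Y (sho C X)"
  using triangle_cmp_zero[OF rotate[OF t]] .

lemma triangle_cmp_zero'':
  assumes t: "dist_tri C X Y Z f g h"
  shows "sha C f \<cdot> h = zmor C Z (sho C Y)"
proof -
  note sf = sha_Hom[OF dist_triD(1)[OF t]] and h = dist_triD(3)[OF t]
  have "neg (sha C f) \<cdot> h = zmor C Z (sho C Y)"
    using triangle_cmp_zero[OF rotate[OF rotate[OF t]]] .
  then have "neg (neg (sha C f \<cdot> h)) = neg (zmor C Z (sho C Y))" using cmp_neg(2)[OF h sf] by simp
  also have "\<dots> = zmor C Z (sho C Y)"
    using neg_zmor[OF dist_triD(6,8)[OF t]] .
  finally show ?thesis using neg_neg[OF cmp_Hom[OF h sf]] by simp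
qed

end


section \<open>Triangulated subcategories, coproducts and generation\<close>

lemma dist_tri_full_subcat:
  "dist_tri (full_subcat C S) X Y Z f g h \<longleftrightarrow>
    dist_tri C X Y Z f g h \<and> X \<in> S \<and> Y \<in> S \<and> Z \<in> S \<and> sho C X \<in> S"
  by (auto simp: dist_tri_def Hom_full_subcat full_subcat_def Hom_def)

lemma orthogonalD:
  "orthogonal C D E \<Longrightarrow> X \<in> D \<Longrightarrow> Y \<in> E \<Longrightarrow> u \<in> Hom C X Y \<Longrightarrow> u = zmor C X Y"
  by (auto simp: orthogonal_def)

lemma (in category) coproduct_eqI:
  assumes "coproduct C I X U \<iota>" and f: "f \<in> Hom C U Z" and g: "g \<in> Hom C U Z"
    and "\<And>i. i \<in> I \<Longrightarrow> f \<cdot> \<iota> i = g \<cdot> \<iota> i"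
  shows "f = g"
proof -
  have "\<forall>i\<in>I. g \<cdot> \<iota> i \<in> Hom C (X i) Z"
    using assms(1) cmp_Hom[OF _ g] by (auto simp: coproduct_def)
  then have "\<exists>!h. h \<in> Hom C U Z \<and> (\<forall>i\<in>I. h \<cdot> \<iota> i = g \<cdot> \<iota> i)"
    using assms(1) Hom_obj(2)[OF f] unfolding coproduct_def by simp
  then show ?thesis using f g assms(4) by blast
qed

lemma coproduct_map:
  assumes "coproduct C I X U \<iota>" "Z \<in> obj C" "\<And>i. i \<in> I \<Longrightarrow> f i \<in> Hom C (X i) Z"
  shows "\<exists>h\<in>Hom C U Z. \<forall>i\<in>I. h \<cdot>\<^bsub>C\<^esub> \<iota> i = f i"
proof -
  have "\<exists>!h. h \<in> Hom C U Z \<and> (\<forall>i\<in>I. h \<cdot>\<^bsub>C\<^esub> \<iota> i = f i)"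
    using assms unfolding coproduct_def by simp
  then show ?thesis by blast
qed

lemma coproductD:
  assumes "coproduct C I X U \<iota>"
  shows "U \<in> obj C" "i \<in> I \<Longrightarrow> \<iota> i \<in> Hom C (X i) U"
  using assms by (auto simp: coproduct_def)

lemma (in preadditive_category) coproduct_projections:
  assumes U: "coproduct C I X U \<iota>" and X: "X ` I \<subseteq> obj C"
  shows "\<exists>\<pi>. \<forall>j\<in>I. \<pi> j \<in> Hom C U (X j) \<and>
    (\<forall>i\<in>I. \<pi> j \<cdot> \<iota> i = (if i = j then ident C (X j) else zmor C (X i) (X j)))"
proof (intro bchoice ballI)
  fix j assume j: "j \<in> I"
  have "(if i = j then ident C (X j) else zmor C (X i) (X j)) \<in> Hom C (X i) (X j)" if "i \<in> I" for i
    using X that j by (auto intro: ident_Hom zmor_Hom)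
  then show "\<exists>p. p \<in> Hom C U (X j) \<and>
    (\<forall>i\<in>I. p \<cdot> \<iota> i = (if i = j then ident C (X j) else zmor C (X i) (X j)))"
    using coproduct_map[OF U, of "X j" "\<lambda>i. if i = j then ident C (X j) else zmor C (X i) (X j)"] X j
    by blast
qed

text \<open>
  This principle is the only form in which compactness enters: an arrow from a compact object
  into a coproduct is a finite sum of arrows that factor through the summands.
\<close>

lemma (in preadditive_category) compact_induct [consumes 5, case_names zero add summand]:
  fixes I :: "'a set"
  assumes P: "compact_object \<kappa> C P" and "small \<kappa> I" "X ` I \<subseteq> obj C"
    and U: "coproduct C I X U \<iota>" and z: "z \<in> Hom C P U"
    and zero: "Q (zmor C P U)"
    and add: "\<And>a b. \<lbrakk>a \<in> Hom C P U; b \<in> Hom C P U; Q a; Q b\<rbrakk> \<Longrightarrow> Q (a \<boxplus> b)"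
    and summand: "\<And>i b. \<lbrakk>i \<in> I; b \<in> Hom C P (X i)\<rbrakk> \<Longrightarrow> Q (\<iota> i \<cdot> b)"
  shows "Q z"
proof -
  interpret A: abelian_group "hom_group C P U" using hom_group[OF Hom_obj[OF z]] .
  let ?s = "\<lambda>g. {i \<in> I. g i \<noteq> zmor C P (X i)}"
  have "bij_betw (\<lambda>g. finsum (hom_group C P U) (\<lambda>i. \<iota> i \<cdot> g i) (?s g))
      {g \<in> Pi\<^sub>E I (\<lambda>i. Hom C P (X i)). finite (?s g)} (Hom C P U)"
    using assms(1-4) unfolding compact_object_def by blast
  then obtain g where g: "g \<in> Pi\<^sub>E I (\<lambda>i. Hom C P (X i))" "finite (?s g)"
    and zg: "z = finsum (hom_group C P U) (\<lambda>i. \<iota> i \<cdot> g i) (?s g)"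
    using z unfolding bij_betw_def by blast
  have gi: "\<iota> i \<cdot> g i \<in> Hom C P U" "Q (\<iota> i \<cdot> g i)" if "i \<in> I" for i
    using PiE_mem[OF g(1) that] cmp_Hom[OF _ coproductD(2)[OF U that]] summand[OF that] by auto
  have "J \<subseteq> I \<Longrightarrow> finsum (hom_group C P U) (\<lambda>i. \<iota> i \<cdot> g i) J \<in> Hom C P U \<and>
      Q (finsum (hom_group C P U) (\<lambda>i. \<iota> i \<cdot> g i) J)" if "finite J" for J
    using that
  proof induction
    case empty then show ?case using zero zmor_Hom[OF Hom_obj[OF z]] by simp
  next
    case (insert j J)
    have "finsum (hom_group C P U) (\<lambda>i. \<iota> i \<cdot> g i) (insert j J) =
        \<iota> j \<cdot> g j \<boxplus> finsum (hom_group C P U) (\<lambda>i. \<iota> i \<cdot> g i) J"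
      using A.finsum_insert[OF insert(1,2), of "\<lambda>i. \<iota> i \<cdot> g i"] gi insert(4) by auto
    then show ?case using insert gi[of j] add add_Hom by auto
  qed
  then show ?thesis using g(2) zg by auto
qed

context triangulated_category
begin

lemma triangulated_subcatD:
  assumes S: "triangulated_subcat C S"
  shows "X \<in> S \<Longrightarrow> X \<in> obj C"
    and "X \<in> S \<Longrightarrow> sho C X \<in> S"
    and "X \<in> obj C \<Longrightarrow> sho C X \<in> S \<Longrightarrow> X \<in> S"
    and "X \<in> S \<Longrightarrow> \<exists>Y\<in>S. sho C Y = X"
    and "dist_tri C X Y Z f g h \<Longrightarrow> X \<in> S \<Longrightarrow> Y \<in> S \<Longrightarrow> Z \<in> S"
proof -
  have so: "X \<in> S \<Longrightarrow> X \<in> obj C" for X using S by (auto simp: triangulated_subcat_def)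
  then show "X \<in> S \<Longrightarrow> X \<in> obj C" .
  have sh: "sho C ` S = S" using S by (simp add: triangulated_subcat_def)
  then show "X \<in> S \<Longrightarrow> sho C X \<in> S" by blast
  show ex: "X \<in> S \<Longrightarrow> \<exists>Y\<in>S. sho C Y = X" for X using sh by (metis imageE)
  show "X \<in> obj C \<Longrightarrow> sho C X \<in> S \<Longrightarrow> X \<in> S" using ex[of "sho C X"] sho_inj so by metis
  show "dist_tri C X Y Z f g h \<Longrightarrow> X \<in> S \<Longrightarrow> Y \<in> S \<Longrightarrow> Z \<in> S"
    using S unfolding triangulated_subcat_def by blast
qed

text \<open>
  The objects without nonzero arrows to the right orthogonal of \<open>S\<close> form a localizing
  subcategory containing \<open>S\<close>.
\<close>

lemma zero_object_if_orthogonal_to_generators: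
  assumes S: "triangulated_subcat C S" and gen: "generates \<kappa> C S"
    and N: "N \<in> obj C" and NS: "\<And>M u. M \<in> S \<Longrightarrow> u \<in> Hom C M N \<Longrightarrow> u = zmor C M N"
  shows "zero_object C N"
proof -
  define D where "D = {N \<in> obj C. \<forall>M\<in>S. Hom C M N = {zmor C M N}}"
  define T where "T = {X \<in> obj C. \<forall>N\<in>D. Hom C X N = {zmor C X N}}"
  note SD = triangulated_subcatD[OF S]
  have TI: "X \<in> T" if "X \<in> obj C" "\<And>N u. N \<in> D \<Longrightarrow> u \<in> Hom C X N \<Longrightarrow> u = zmor C X N" for X
    using that Hom_eq_zmor_iff[OF that(1)] by (auto simp: T_def D_def)
  have TD: "X \<in> obj C" "N \<in> D \<Longrightarrow> u \<in> Hom C X N \<Longrightarrow> u = zmor C X N" if "X \<in> T" for X N u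
    using that by (auto simp: T_def)
  have Dsho: "sho C N \<in> D" if N: "N \<in> D" for N
  proof -
    have No: "N \<in> obj C" using N by (simp add: D_def)
    have "Hom C M (sho C N) = {zmor C M (sho C N)}" if M: "M \<in> S" for M
    proof -
      obtain M' where "M' \<in> S" "sho C M' = M" using SD(4)[OF M] by blast
      then show ?thesis using Hom_shift_zero[of M' N] SD(1) No N by (auto simp: D_def)
    qed
    then show ?thesis using sho_obj[OF No] by (simp add: D_def)
  qed
  have Dunsho: "\<exists>N'\<in>D. sho C N' = N" if N: "N \<in> D" for N
  proof -
    obtain N' where N': "N' \<in> obj C" "sho C N' = N" using N sho_surj[of N] unfolding D_def by blast
    have "Hom C M N' = {zmor C M N'}" if "M \<in> S" for M
      using Hom_shift_zero[of M N'] SD(1,2)[OF that] N N' by (auto simp: D_def)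
    then show ?thesis using N' by (auto simp: D_def)
  qed
  have iso: "Y \<in> T" if X: "X \<in> T" and Y: "Y \<in> obj C" and f: "f \<in> Hom C X Y" "g \<in> Hom C Y X"
    "f \<cdot> g = ident C Y" for X Y f g
  proof (rule TI[OF Y])
    fix N u assume N: "N \<in> D" and u: "u \<in> Hom C Y N"
    have "u = (u \<cdot> f) \<cdot> g" using cmp_assoc[OF f(2,1) u] f(3) cmp_ident[OF u] by simp
    also have "u \<cdot> f = zmor C X N" using TD(2)[OF X N cmp_Hom[OF f(1) u]] .
    also have "zmor C X N \<cdot> g = zmor C Y N" using zmor_cmp[OF f(2)] Hom_obj(2)[OF u] by simp
    finally show "u = zmor C Y N" .
  qed
  have sT: "sho C X \<in> T \<longleftrightarrow> X \<in> T" if X: "X \<in> obj C" for X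
  proof
    assume sX: "sho C X \<in> T"
    have "Hom C X N = {zmor C X N}" if N: "N \<in> D" for N
    proof -
      have No: "N \<in> obj C" using N by (simp add: D_def)
      have "Hom C (sho C X) (sho C N) = {zmor C (sho C X) (sho C N)}"
        using sX Dsho[OF N] by (simp add: T_def)
      then show ?thesis using Hom_shift_zero[OF X No] by simp
    qed
    then show "X \<in> T" using X by (simp add: T_def)
  next
    assume XT: "X \<in> T"
    have "Hom C (sho C X) N = {zmor C (sho C X) N}" if N: "N \<in> D" for N
    proof -
      obtain N' where N': "N' \<in> D" "sho C N' = N" using Dunsho[OF N] by blast
      then have No: "N' \<in> obj C" by (simp add: D_def)
      have "Hom C X N' = {zmor C X N'}" using XT N'(1) by (simp add: T_def)
      then show ?thesis using Hom_shift_zero[OF X No] N'(2) by simp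
    qed
    then show "sho C X \<in> T" using sho_obj[OF X] by (simp add: T_def)
  qed
  have "triangulated_subcat C T"
    unfolding triangulated_subcat_def
  proof (intro conjI allI impI)
    show "T \<subseteq> obj C" by (auto simp: T_def)
    show "closed_under_iso C T"
      unfolding closed_under_iso_def isomorphic_def iso_arrow_def inverse_arrows_def using iso by blast
    obtain Z where Z: "zero_object C Z" using zero_object_exists by blast
    then have "Z \<in> T" using TI Hom_from_zero[OF Z] by (simp add: zero_object_def)
    with Z show "\<exists>Z\<in>T. zero_object C Z" by blast
    show "sho C ` T = T"
    proof
      show "sho C ` T \<subseteq> T" using sT TD(1) by blast
      show "T \<subseteq> sho C ` T"
      proof
        fix X assume "X \<in> T"
        moreover from this obtain Y where "Y \<in> obj C" "sho C Y = X" using sho_surj TD(1) by blast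
        ultimately show "X \<in> sho C ` T" using sT by blast
      qed
    qed
  next
    fix X Y Z f g h assume t: "dist_tri C X Y Z f g h" and X: "X \<in> T" and Y: "Y \<in> T"
    show "Z \<in> T"
    proof (rule TI[OF dist_triD(6)[OF t]])
      fix N u assume N: "N \<in> D" and u: "u \<in> Hom C Z N"
      have "u \<cdot> g = zmor C Y N" using TD(2)[OF Y N cmp_Hom[OF dist_triD(2)[OF t] u]] .
      then obtain v where v: "v \<in> Hom C (sho C X) N" "v \<cdot> h = u" using exact_from2[OF t u] by blast
      have "sho C X \<in> T" using sT[OF TD(1)[OF X]] X by simp
      then have "v = zmor C (sho C X) N" using TD(2) N v(1) by blast
      then show "u = zmor C Z N" using v(2) zmor_cmp[OF dist_triD(3)[OF t] Hom_obj(2)[OF u]] by simp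
    qed
  qed
  moreover have "closed_under_coproducts \<kappa> C T"
    unfolding closed_under_coproducts_def
  proof (intro allI impI)
    fix I :: "'a set" and X Y \<iota> assume X: "X ` I \<subseteq> T" and Y: "coproduct C I X Y \<iota>"
    show "Y \<in> T"
    proof (rule TI[OF coproductD(1)[OF Y]])
      fix N u assume N: "N \<in> D" and u: "u \<in> Hom C Y N"
      note No = Hom_obj(2)[OF u]
      show "u = zmor C Y N"
      proof (rule coproduct_eqI[OF Y u zmor_Hom[OF Hom_obj[OF u]]])
        fix i assume i: "i \<in> I"
        note \<iota> = coproductD(2)[OF Y i]
        show "u \<cdot> \<iota> i = zmor C Y N \<cdot> \<iota> i"
          using TD(2)[OF _ N cmp_Hom[OF \<iota> u]] X i zmor_cmp[OF \<iota> No] by auto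
      qed
    qed
  qed
  moreover have "S \<subseteq> T" using SD(1) by (auto simp: T_def D_def)
  ultimately have "\<Inter>{T. triangulated_subcat C T \<and> closed_under_coproducts \<kappa> C T \<and> S \<subseteq> T} \<subseteq> T"
    by blast
  then have NT: "N \<in> T" using gen N unfolding generates_def by blast
  have "Hom C M N = {zmor C M N}" if M: "M \<in> S" for M
    using Hom_eq_zmor_iff[OF SD(1)[OF M] N] NS[OF M] by blast
  then have "N \<in> D" using N by (simp add: D_def)
  then have "ident C N = zmor C N N" using TD(2)[OF NT] N ident_Hom by blast
  then show ?thesis using zero_objectI[OF N] by simp
qed

end


section \<open>Adjacent weight and t-structures\<close>

text \<open>
  The class \<open>wge\<close> belongs both to the weight structure and to the t-structure: this is adjacency.
  That the weight structure extends the one on \<open>C0\<close> is expressed by intersecting its classes with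
  \<open>C0\<close>.
\<close>

locale adjacent_structures = triangulated_category C
  for C :: "('o, 'a) tri_cat" (structure) +
  fixes \<kappa> :: "'a rel" and C0 wle wge tle :: "'o set"
  assumes universe: "universe_card \<kappa>"
    and smashing: "smashing_category \<kappa> C"
    and C0_triangulated: "triangulated_subcat C C0"
    and C0_compact: "M \<in> C0 \<Longrightarrow> compact_object \<kappa> C M"
    and C0_small: "essentially_small \<kappa> (full_subcat C C0)"
    and hom_small: "M \<in> C0 \<Longrightarrow> N \<in> obj C \<Longrightarrow> small \<kappa> (Hom C M N)"
    and C0_generates: "generates \<kappa> C C0"
    and weight_C0: "weight_structure (full_subcat C C0) (wle \<inter> C0) (wge \<inter> C0)"
    and weight: "smashing_weight_structure \<kappa> C wle wge"
    and t: "t_structure C tle wge"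
begin

lemma
  shows wge_obj: "X \<in> wge \<Longrightarrow> X \<in> obj C"
    and tle_obj: "X \<in> tle \<Longrightarrow> X \<in> obj C"
    and wge_sho: "X \<in> wge \<Longrightarrow> sho C X \<in> wge"
    and wle_wge: "X \<in> wle \<Longrightarrow> Y \<in> wge \<Longrightarrow> u \<in> Hom C X (sho C Y) \<Longrightarrow> u = zmor C X (sho C Y)"
    and wge_tle: "X \<in> wge \<Longrightarrow> N \<in> tle \<Longrightarrow> u \<in> Hom C (sho C X) N \<Longrightarrow> u = zmor C (sho C X) N"
    and wge_coproduct: "small \<kappa> (I :: 'a set) \<Longrightarrow> X' ` I \<subseteq> wge \<Longrightarrow> coproduct C I X' Y \<iota> \<Longrightarrow> Y \<in> wge"
proof -
  have w: "wge \<subseteq> obj C" "sho C ` wge \<subseteq> wge" "orthogonal C wle (sho C ` wge)"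
    "closed_under_coproducts \<kappa> C wge"
    using weight by (simp_all add: smashing_weight_structure_def weight_structure_def)
  have t': "tle \<subseteq> obj C" "orthogonal C (sho C ` wge) tle" using t by (simp_all add: t_structure_def)
  show "X \<in> wge \<Longrightarrow> X \<in> obj C" "X \<in> tle \<Longrightarrow> X \<in> obj C"
    "X \<in> wge \<Longrightarrow> sho C X \<in> wge"
    using w t' by auto
  show "X \<in> wle \<Longrightarrow> Y \<in> wge \<Longrightarrow> u \<in> Hom C X (sho C Y) \<Longrightarrow> u = zmor C X (sho C Y)"
    using orthogonalD[OF w(3)] by blast
  show "X \<in> wge \<Longrightarrow> N \<in> tle \<Longrightarrow> u \<in> Hom C (sho C X) N \<Longrightarrow> u = zmor C (sho C X) N"
    using orthogonalD[OF t'(2)] by blast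
  show "small \<kappa> (I :: 'a set) \<Longrightarrow> X' ` I \<subseteq> wge \<Longrightarrow> coproduct C I X' Y \<iota> \<Longrightarrow> Y \<in> wge"
    using w(4) unfolding closed_under_coproducts_def by blast
qed

lemma wge_retract:
  assumes "X \<in> wge" "i \<in> Hom C Y X" "p \<in> Hom C X Y" "p \<cdot> i = ident C Y"
  shows "Y \<in> wge"
proof -
  have "closed_under_retracts C wge"
    using weight by (simp add: smashing_weight_structure_def weight_structure_def)
  then show ?thesis using assms Hom_obj(1)[OF assms(2)] unfolding closed_under_retracts_def by blast
qed

lemma wle_retract:
  assumes "X \<in> wle" "i \<in> Hom C Y X" "p \<in> Hom C X Y" "p \<cdot> i = ident C Y"
  shows "Y \<in> wle"
proof -
  have "closed_under_retracts C wle"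
    using weight by (simp add: smashing_weight_structure_def weight_structure_def)
  then show ?thesis using assms Hom_obj(1)[OF assms(2)] unfolding closed_under_retracts_def by blast
qed

lemma tle_unshift:
  assumes "N \<in> tle"
  shows "\<exists>N'\<in>tle. sho C N' = N"
proof -
  have "tle \<subseteq> sho C ` tle" using t by (simp add: t_structure_def)
  then show ?thesis using assms by blast
qed

lemmas C0_obj = triangulated_subcatD(1)[OF C0_triangulated]
  and C0_sho = triangulated_subcatD(2)[OF C0_triangulated]

lemma wge_perp:
  assumes X: "X \<in> wge" and N: "N \<in> obj C" "sho C N \<in> tle" and u: "u \<in> Hom C X N"
  shows "u = zmor C X N"
proof -
  have "sha C u = sha C (zmor C X N)"
    using wge_tle[OF X N(2) sha_Hom[OF u]] sha_zmor[OF wge_obj[OF X] N(1)] by simp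
  then show ?thesis using sha_inj[OF u zmor_Hom[OF wge_obj[OF X] N(1)]] by simp
qed

lemma t_decomposition:
  assumes "M \<in> obj C"
  shows "\<exists>L N f g h. L \<in> wge \<and> N \<in> obj C \<and> sho C N \<in> tle \<and> dist_tri C L M N f g h"
proof -
  have "\<forall>M\<in>obj C. \<exists>L\<in>wge. \<exists>N\<in>{N \<in> obj C. sho C N \<in> tle}. \<exists>f g h. dist_tri C L M N f g h"
    using t by (simp add: t_structure_def)
  then show ?thesis using assms by blast
qed

lemma t_decomposition_shifted:
  assumes "Z \<in> obj C"
  shows "\<exists>L N f g h. L \<in> wge \<and> N \<in> tle \<and> dist_tri C (sho C L) Z N f g h"
proof -
  obtain Z' where Z': "Z' \<in> obj C" "sho C Z' = Z" using sho_surj assms by blast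
  then show ?thesis using t_decomposition[OF Z'(1)] shift_triangle by metis
qed

text \<open>
  As \<open>wge\<close> is a class of the t-structure, arrows from an extension of its objects to the other term
  of a t-decomposition vanish, which makes the extension a retract of an object of \<open>wge\<close>; as \<open>wge\<close>
  is a class of the weight structure, it is closed under retracts.
\<close>

lemma wge_extension:
  assumes T: "dist_tri C X Y Z f g h" and X: "X \<in> wge" and Z: "Z \<in> wge"
  shows "Y \<in> wge"
proof -
  obtain L N l n k where L: "L \<in> wge" and N: "N \<in> obj C" "sho C N \<in> tle"
    and d: "dist_tri C L Y N l n k"
    using t_decomposition[OF dist_triD(5)[OF T]] by blast
  note n = dist_triD(2)[OF d]
  have "n \<cdot> f = zmor C X N" by (rule wge_perp[OF X N cmp_Hom[OF dist_triD(1)[OF T] n]])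
  then obtain v where v: "v \<in> Hom C Z N" "v \<cdot> g = n" using exact_from1[OF T n] by blast
  have "v = zmor C Z N" by (rule wge_perp[OF Z N v(1)])
  then have "n = zmor C Y N" using v(2) zmor_cmp[OF dist_triD(2)[OF T] N(1)] by simp
  then have "n \<cdot> ident C Y = zmor C Y N" using cmp_ident[OF n] by simp
  then obtain s where "s \<in> Hom C Y L" "l \<cdot> s = ident C Y"
    using exact_to1[OF d ident_Hom[OF dist_triD(5)[OF T]]] by blast
  then show ?thesis using wge_retract[OF L _ dist_triD(1)[OF d]] by blast
qed

lemma C0_decomposition:
  assumes "M \<in> C0"
  shows "\<exists>L N f g h. L \<in> wle \<and> L \<in> C0 \<and> N \<in> wge \<and> N \<in> C0 \<and> dist_tri C L M (sho C N) f g h"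
proof -
  have dec: "\<forall>M\<in>obj (full_subcat C C0). \<exists>L\<in>wle \<inter> C0. \<exists>N\<in>sho (full_subcat C C0) ` (wge \<inter> C0).
      \<exists>f g h. dist_tri (full_subcat C C0) L M N f g h"
    using weight_C0 unfolding weight_structure_def by simp
  have "M \<in> obj (full_subcat C C0)" using C0_obj[OF assms] assms by simp
  from bspec[OF dec this] obtain L N f g h where L: "L \<in> wle \<inter> C0"
    and N: "N \<in> sho (full_subcat C C0) ` (wge \<inter> C0)"
    and d: "dist_tri (full_subcat C C0) L M N f g h"
    by (elim bexE exE)
  have "sho (full_subcat C C0) = sho C" by (simp add: full_subcat_def)
  with N obtain N' where "N' \<in> wge \<inter> C0" "N = sho C N'" by (metis imageE)
  then show ?thesis using L d unfolding dist_tri_full_subcat by blast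
qed

abbreviation Hw :: "'o set" where
  "Hw \<equiv> wle \<inter> wge \<inter> C0"

text \<open>
  A weight decomposition \<open>Q \<rightarrow> M[1] \<rightarrow> G[1]\<close> rotates to a triangle \<open>M \<rightarrow> G \<rightarrow> Q \<rightarrow> M[1]\<close>. The obstruction to
  extending an arrow \<open>M \<rightarrow> L\<close> to \<open>G\<close> is an arrow \<open>Q \<rightarrow> L[1]\<close>, which is zero for \<open>L\<close> in \<open>wge\<close> because
  \<open>Q\<close> is in \<open>wle\<close>.
\<close>

lemma C0_to_wge:
  assumes M: "M \<in> C0"
  shows "\<exists>G Q m k f. G \<in> wge \<and> G \<in> C0 \<and> Q \<in> C0 \<and> dist_tri C M G Q m k f \<and>
    (\<forall>L\<in>wge. \<forall>u\<in>Hom C M L. \<exists>v\<in>Hom C G L. v \<cdot> m = u)"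
proof -
  obtain Q G f g h where Q: "Q \<in> wle" "Q \<in> C0" and G: "G \<in> wge" "G \<in> C0"
    and d: "dist_tri C Q (sho C M) (sho C G) f g h"
    using C0_decomposition[OF C0_sho[OF M]] by blast
  obtain k where "dist_tri C G Q (sho C M) k f g" using inverse_rotate[OF d C0_obj[OF G(2)]] by blast
  then obtain m where T: "dist_tri C M G Q m k f" using inverse_rotate[OF _ C0_obj[OF M]] by blast
  have "\<exists>v\<in>Hom C G L. v \<cdot> m = u" if L: "L \<in> wge" and u: "u \<in> Hom C M L" for L u
  proof -
    have "sha C u \<cdot> f = zmor C Q (sho C L)"
      by (rule wle_wge[OF Q(1) L cmp_Hom[OF dist_triD(3)[OF T] sha_Hom[OF u]]])
    then obtain v' where v': "v' \<in> Hom C (sho C G) (sho C L)" "v' \<cdot> sha C m = sha C u"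
      using exact_from3[OF T sha_Hom[OF u]] by blast
    obtain v where v: "v \<in> Hom C G L" "sha C v = v'"
      using sha_surj[OF C0_obj[OF G(2)] wge_obj[OF L] v'(1)] by blast
    have "sha C (v \<cdot> m) = sha C u" using sha_cmp[OF dist_triD(1)[OF T] v(1)] v v' by simp
    then have "v \<cdot> m = u" using sha_inj[OF cmp_Hom[OF dist_triD(1)[OF T] v(1)] u] by simp
    then show ?thesis using v(1) by blast
  qed
  then show ?thesis using G Q(2) T by blast
qed

text \<open>
  The right exact sequence \<open>C(G1, L) \<rightarrow> C(G0, L) \<rightarrow> C(M, L) \<rightarrow> 0\<close>: the previous construction is applied
  to \<open>M\<close> and then to the cone of \<open>M \<rightarrow> G0\<close>.
\<close>

lemma C0_wge_presentation:
  assumes M: "M \<in> C0"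
  obtains G0 G1 m d where "G0 \<in> wge" "G0 \<in> C0" "G1 \<in> wge" "G1 \<in> C0"
    "m \<in> Hom C M G0" "d \<in> Hom C G0 G1" "d \<cdot> m = zmor C M G1"
    "\<And>L u. L \<in> wge \<Longrightarrow> u \<in> Hom C M L \<Longrightarrow> \<exists>v\<in>Hom C G0 L. v \<cdot> m = u"
    "\<And>L v. L \<in> wge \<Longrightarrow> v \<in> Hom C G0 L \<Longrightarrow> v \<cdot> m = zmor C M L \<Longrightarrow> \<exists>y\<in>Hom C G1 L. y \<cdot> d = v"
proof -
  obtain G0 Q m k f where G0: "G0 \<in> wge" "G0 \<in> C0" and Q: "Q \<in> C0" and T: "dist_tri C M G0 Q m k f"
    and m: "\<forall>L\<in>wge. \<forall>u\<in>Hom C M L. \<exists>v\<in>Hom C G0 L. v \<cdot> m = u"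
    using C0_to_wge[OF M] by blast
  obtain G1 Q' m' k' f' where G1: "G1 \<in> wge" "G1 \<in> C0" and T': "dist_tri C Q G1 Q' m' k' f'"
    and m': "\<forall>L\<in>wge. \<forall>u\<in>Hom C Q L. \<exists>v\<in>Hom C G1 L. v \<cdot> m' = u"
    using C0_to_wge[OF Q] by blast
  note mH = dist_triD(1)[OF T] and kH = dist_triD(2)[OF T] and m'H = dist_triD(1)[OF T']
  show ?thesis
  proof (rule that[OF G0 G1 mH cmp_Hom[OF kH m'H]])
    show "(m' \<cdot> k) \<cdot> m = zmor C M G1"
      using cmp_assoc[OF mH kH m'H] triangle_cmp_zero[OF T] cmp_zmor[OF m'H C0_obj[OF M]] by simp
    show "\<exists>v\<in>Hom C G0 L. v \<cdot> m = u" if "L \<in> wge" "u \<in> Hom C M L" for L u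
      using m that by blast
    show "\<exists>y\<in>Hom C G1 L. y \<cdot> (m' \<cdot> k) = v"
      if L: "L \<in> wge" and v: "v \<in> Hom C G0 L" "v \<cdot> m = zmor C M L" for L v
    proof -
      obtain y' where y': "y' \<in> Hom C Q L" "y' \<cdot> k = v" using exact_from1[OF T v] by blast
      obtain y where y: "y \<in> Hom C G1 L" "y \<cdot> m' = y'" using m' L y'(1) by blast
      have "y \<cdot> (m' \<cdot> k) = v" using cmp_assoc[OF kH m'H y(1)] y(2) y'(2) by simp
      then show ?thesis using y(1) by blast
    qed
  qed
qed

text \<open>
  The weight decomposition \<open>P \<rightarrow> G \<rightarrow> G'[1]\<close> of an object of \<open>wge\<close> has its first term in \<open>Hw\<close>, since \<open>P\<close>
  is an extension of \<open>G\<close> by \<open>G'\<close>. An arrow from \<open>G\<close> that vanishes on \<open>P\<close> factors through \<open>G'[1]\<close>, which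
  has no arrows to \<open>tle\<close>.
\<close>

lemma wge_from_Hw:
  assumes G: "G \<in> wge" "G \<in> C0"
  shows "\<exists>P G' k p q. P \<in> Hw \<and> G' \<in> wge \<and> G' \<in> C0 \<and> dist_tri C G' P G k p q \<and>
    (\<forall>N\<in>tle. \<forall>u\<in>Hom C G N. u \<cdot> p = zmor C P N \<longrightarrow> u = zmor C G N)"
proof -
  obtain P G' p q r where P: "P \<in> wle" "P \<in> C0" and G': "G' \<in> wge" "G' \<in> C0"
    and d: "dist_tri C P G (sho C G') p q r"
    using C0_decomposition[OF G(2)] by blast
  obtain k where T: "dist_tri C G' P G k p q" using inverse_rotate[OF d wge_obj[OF G'(1)]] by blast
  have "u = zmor C G N" if N: "N \<in> tle" and u: "u \<in> Hom C G N" "u \<cdot> p = zmor C P N" for N u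
  proof -
    obtain v where v: "v \<in> Hom C (sho C G') N" "v \<cdot> q = u" using exact_from1[OF d u] by blast
    have "v = zmor C (sho C G') N" using wge_tle[OF G'(1) N v(1)] .
    then show ?thesis using v(2) zmor_cmp[OF dist_triD(2)[OF d] tle_obj[OF N]] by simp
  qed
  moreover have "P \<in> wge" using wge_extension[OF T G'(1) G(1)] .
  ultimately show ?thesis using P G' T by blast
qed

text \<open>
  The left exact sequence \<open>0 \<rightarrow> C(G, N) \<rightarrow> C(P0, N) \<rightarrow> C(P1, N)\<close>: the previous construction is applied to
  \<open>G\<close> and then to the fibre of \<open>P0 \<rightarrow> G\<close>.
\<close>

lemma wge_tle_presentation:
  assumes G: "G \<in> wge" "G \<in> C0"
  obtains P0 P1 p e where "P0 \<in> Hw" "P1 \<in> Hw" "p \<in> Hom C P0 G" "e \<in> Hom C P1 P0" "p \<cdot> e = zmor C P1 G"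
    "\<And>N u. N \<in> tle \<Longrightarrow> u \<in> Hom C G N \<Longrightarrow> u \<cdot> p = zmor C P0 N \<Longrightarrow> u = zmor C G N"
    "\<And>N v. N \<in> tle \<Longrightarrow> v \<in> Hom C P0 N \<Longrightarrow> v \<cdot> e = zmor C P1 N \<Longrightarrow> \<exists>u\<in>Hom C G N. u \<cdot> p = v"
proof -
  obtain P0 G' k p q where P0: "P0 \<in> Hw" and G': "G' \<in> wge" "G' \<in> C0"
    and T: "dist_tri C G' P0 G k p q"
    and p: "\<forall>N\<in>tle. \<forall>u\<in>Hom C G N. u \<cdot> p = zmor C P0 N \<longrightarrow> u = zmor C G N"
    using wge_from_Hw[OF G] by blast
  obtain P1 G'' k' p' q' where P1: "P1 \<in> Hw" and T': "dist_tri C G'' P1 G' k' p' q'"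
    and p': "\<forall>N\<in>tle. \<forall>u\<in>Hom C G' N. u \<cdot> p' = zmor C P1 N \<longrightarrow> u = zmor C G' N"
    using wge_from_Hw[OF G'] by blast
  note kH = dist_triD(1)[OF T] and pH = dist_triD(2)[OF T] and p'H = dist_triD(2)[OF T']
  show ?thesis
  proof (rule that[OF P0 P1 pH cmp_Hom[OF p'H kH]])
    show "p \<cdot> (k \<cdot> p') = zmor C P1 G"
      using cmp_assoc[OF p'H kH pH] triangle_cmp_zero[OF T] zmor_cmp[OF p'H wge_obj[OF G(1)]] by simp
    show "u = zmor C G N" if "N \<in> tle" "u \<in> Hom C G N" "u \<cdot> p = zmor C P0 N" for N u
      using p that by blast
    show "\<exists>u\<in>Hom C G N. u \<cdot> p = v"
      if N: "N \<in> tle" and v: "v \<in> Hom C P0 N" "v \<cdot> (k \<cdot> p') = zmor C P1 N" for N v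
    proof -
      have "(v \<cdot> k) \<cdot> p' = zmor C P1 N" using v(2) cmp_assoc[OF p'H kH v(1)] by simp
      then have "v \<cdot> k = zmor C G' N" using p' N cmp_Hom[OF kH v(1)] by blast
      then show ?thesis using exact_from1[OF T v(1)] by blast
    qed
  qed
qed

text \<open>
  The two presentations propagate vanishing of arrows from \<open>Hw\<close> to the objects of \<open>C0\<close> in \<open>wge\<close>, and
  from those to all of \<open>C0\<close>, which generates.
\<close>

lemma heart_zero_object:
  assumes N: "N \<in> tle" "N \<in> wge" and z: "\<And>P u. P \<in> Hw \<Longrightarrow> u \<in> Hom C P N \<Longrightarrow> u = zmor C P N"
  shows "zero_object C N"
proof (rule zero_object_if_orthogonal_to_generators[OF C0_triangulated C0_generates tle_obj[OF N(1)]])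
  have G: "u = zmor C G N" if "G \<in> wge" "G \<in> C0" and u: "u \<in> Hom C G N" for G u
    using wge_tle_presentation[OF that(1,2)] z cmp_Hom[OF _ u] u N(1) by metis
  fix M u assume M: "M \<in> C0" and u: "u \<in> Hom C M N"
  obtain G0 G1 m d where m: "G0 \<in> wge" "G0 \<in> C0" "m \<in> Hom C M G0"
    "\<And>L u. L \<in> wge \<Longrightarrow> u \<in> Hom C M L \<Longrightarrow> \<exists>v\<in>Hom C G0 L. v \<cdot> m = u"
    by (rule C0_wge_presentation[OF M]) blast
  obtain v where v: "v \<in> Hom C G0 N" "v \<cdot> m = u" using m(4)[OF N(2) u] by blast
  then show "u = zmor C M N" using G[OF m(1,2) v(1)] zmor_cmp[OF m(3) Hom_obj(2)[OF u]] by simp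
qed

text \<open>
  The degree zero part of an object of \<open>wge\<close> for the t-structure is detected on \<open>Hw\<close>, since
  arrows from \<open>Hw\<close> to \<open>Z\<close> and to its truncation coincide.
\<close>

lemma in_shifted_wge_if_Hw_orthogonal:
  assumes Z: "Z \<in> wge" and z: "\<And>P u. P \<in> Hw \<Longrightarrow> u \<in> Hom C P Z \<Longrightarrow> u = zmor C P Z"
  shows "\<exists>K\<in>wge. sho C K = Z"
proof -
  note Zo = wge_obj[OF Z]
  obtain L N f g h where L: "L \<in> wge" and N: "N \<in> tle" and T: "dist_tri C (sho C L) Z N f g h"
    using t_decomposition_shifted[OF Zo] by blast
  note g = dist_triD(2)[OF T] and f = dist_triD(1)[OF T]
  have Nw: "N \<in> wge" using wge_extension[OF rotate[OF T] Z] wge_sho[OF wge_sho[OF L]] by blast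
  have "u = zmor C P N" if P: "P \<in> Hw" and u: "u \<in> Hom C P N" for P u
  proof -
    have "h \<cdot> u = zmor C P (sho C (sho C L))"
      using wle_wge[OF _ wge_sho[OF L] cmp_Hom[OF u dist_triD(3)[OF T]]] P by blast
    then obtain v where v: "v \<in> Hom C P Z" "g \<cdot> v = u" using exact_to2[OF T u] by blast
    then show ?thesis using z[OF P v(1)] cmp_zmor[OF g Hom_obj(1)[OF u]] by simp
  qed
  then have "zero_object C N" using heart_zero_object[OF N Nw] by blast
  then have "g = zmor C Z N" using Hom_to_zero g by blast
  then have "g \<cdot> ident C Z = zmor C Z N" using cmp_ident[OF g] by simp
  then obtain s where s: "s \<in> Hom C Z (sho C L)" "f \<cdot> s = ident C Z"
    using exact_to1[OF T ident_Hom[OF Zo]] by blast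
  obtain K where K: "K \<in> obj C" "sho C K = Z" using sho_surj[OF Zo] by blast
  obtain s' f' where s': "s' \<in> Hom C K L" "sha C s' = s" and f': "f' \<in> Hom C L K" "sha C f' = f"
    using sha_surj[OF K(1) wge_obj[OF L]] sha_surj[OF wge_obj[OF L] K(1)] s(1) f K(2) by metis
  have "sha C (f' \<cdot> s') = sha C (ident C K)"
    using sha_cmp[OF s'(1) f'(1)] s'(2) f'(2) s(2) sha_ident[OF K(1)] K(2) by simp
  then have "f' \<cdot> s' = ident C K" using sha_inj[OF cmp_Hom[OF s'(1) f'(1)] ident_Hom[OF K(1)]] by simp
  then have "K \<in> wge" using wge_retract[OF L s'(1) f'(1)] by simp
  then show ?thesis using K(2) by blast
qed

lemma cone_of_Hw_surjection:
  assumes T: "dist_tri C U K Z u v w" and U: "U \<in> wge" and K: "K \<in> wge"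
    and surj: "\<And>P y. P \<in> Hw \<Longrightarrow> y \<in> Hom C P K \<Longrightarrow> \<exists>z\<in>Hom C P U. u \<cdot> z = y"
  shows "\<exists>K'\<in>wge. sho C K' = Z"
proof (rule in_shifted_wge_if_Hw_orthogonal)
  show "Z \<in> wge" using wge_extension[OF rotate[OF T] K wge_sho[OF U]] .
  fix P y assume P: "P \<in> Hw" and y: "y \<in> Hom C P Z"
  have "w \<cdot> y = zmor C P (sho C U)"
    using wle_wge[OF _ U cmp_Hom[OF y dist_triD(3)[OF T]]] P by blast
  then obtain x where x: "x \<in> Hom C P K" "v \<cdot> x = y" using exact_to2[OF T y] by blast
  then obtain z where z: "z \<in> Hom C P U" "u \<cdot> z = x" using surj[OF P] by blast
  note u = dist_triD(1)[OF T] and v = dist_triD(2)[OF T]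
  have "y = (v \<cdot> u) \<cdot> z" using x z cmp_assoc[OF z(1) u v] by simp
  then show "y = zmor C P Z" using triangle_cmp_zero[OF T] zmor_cmp[OF z(1) dist_triD(6)[OF T]] by simp
qed

end


section \<open>Fullness and faithfulness on the heart of the weight structure\<close>

context adjacent_structures
begin

lemma Hw_representatives:
  obtains S where "S \<subseteq> Hw" "small \<kappa> S"
    "\<And>P. P \<in> Hw \<Longrightarrow> \<exists>Q\<in>S. \<exists>a\<in>Hom C P Q. \<exists>b\<in>Hom C Q P. b \<cdot> a = ident C P"
proof -
  obtain S0 where S0: "S0 \<subseteq> obj (full_subcat C C0)" "small \<kappa> S0"
    and iso: "\<forall>X\<in>obj (full_subcat C C0). \<exists>Y\<in>S0. isomorphic (full_subcat C C0) X Y"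
    using C0_small unfolding essentially_small_def by blast
  show thesis
  proof (rule that[of "S0 \<inter> Hw"])
    show "S0 \<inter> Hw \<subseteq> Hw" by blast
    show "small \<kappa> (S0 \<inter> Hw)" using small_subset[OF S0(2)] by blast
    fix P assume P: "P \<in> Hw"
    then have "P \<in> obj (full_subcat C C0)" using C0_obj by simp
    then obtain Q a where Q: "Q \<in> S0" and "iso_arrow (full_subcat C C0) P Q a"
      using iso unfolding isomorphic_def by blast
    moreover have QC: "Q \<in> C0" using Q S0(1) by auto
    ultimately have "iso_arrow C P Q a" using P by (simp add: iso_arrow_full_subcat)
    then obtain b where a: "a \<in> Hom C P Q" and b: "b \<in> Hom C Q P" "b \<cdot> a = ident C P" "a \<cdot> b = ident C Q"
      unfolding iso_arrow_def inverse_arrows_def by blast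
    have "Q \<in> Hw" using wle_retract[OF _ b(1) a b(3)] wge_retract[OF _ b(1) a b(3)] P QC by blast
    then show "\<exists>Q\<in>S0 \<inter> Hw. \<exists>a\<in>Hom C P Q. \<exists>b\<in>Hom C Q P. b \<cdot> a = ident C P"
      using Q a b by blast
  qed
qed

text \<open>
  The coproduct of the objects \<open>P\<close> over all pairs of some \<open>P\<close> in \<open>S\<close> and a label in \<open>E P\<close>. The labels
  will be arrows from \<open>P\<close>, or elements of the value of a functor at \<open>P\<close>.
\<close>

lemma labelled_coproduct:
  assumes S: "S \<subseteq> Hw" "small \<kappa> S" and E: "\<And>P. P \<in> S \<Longrightarrow> small \<kappa> (E P)"
  shows "\<exists>(I :: 'a set) X U \<iota> x. small \<kappa> I \<and> coproduct C I X U \<iota> \<and> U \<in> wge \<and>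
    (\<forall>i\<in>I. X i \<in> S \<and> x i \<in> E (X i)) \<and> (\<forall>P\<in>S. \<forall>y\<in>E P. \<exists>i\<in>I. X i = P \<and> x i = y)"
proof -
  have "small \<kappa> (Sigma S E)" using small_Sigma[OF universe S(2) E] .
  then obtain I :: "'a set" and e where I: "small \<kappa> I" and e: "bij_betw e I (Sigma S E)"
    using small_reindex universe unfolding universe_card_def by metis
  define X where "X = (\<lambda>i. fst (e i))"
  define x where "x = (\<lambda>i. snd (e i))"
  have eI: "e ` I = Sigma S E" using e by (simp add: bij_betw_def)
  have Xx: "X i \<in> S \<and> x i \<in> E (X i)" if "i \<in> I" for i
  proof -
    have "e i \<in> Sigma S E" using eI that by blast
    then show ?thesis unfolding X_def x_def by auto
  qed
  have XI: "X ` I \<subseteq> wge" using Xx S(1) by blast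
  then have "X ` I \<subseteq> obj C" using wge_obj by blast
  then obtain U \<iota> where U: "coproduct C I X U \<iota>"
    using smashing I unfolding smashing_category_def by blast
  have "\<exists>i\<in>I. X i = P \<and> x i = y" if "P \<in> S" "y \<in> E P" for P y
  proof -
    have "(P, y) \<in> e ` I" using eI that by simp
    then obtain i where "i \<in> I" "e i = (P, y)" by (metis imageE)
    then show ?thesis unfolding X_def x_def by (intro bexI[of _ i]) simp_all
  qed
  then show ?thesis using I U wge_coproduct[OF I XI U] Xx by blast
qed

text \<open>
  The summands are labelled by all arrows to \<open>K\<close> from representatives of the isomorphism classes in
  \<open>Hw\<close>.
\<close>

lemma Hw_cover:
  assumes K: "K \<in> wge"
  shows "\<exists>(I :: 'a set) X U \<iota> u x. small \<kappa> I \<and> X ` I \<subseteq> Hw \<and> coproduct C I X U \<iota> \<and> U \<in> wge \<and>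
    u \<in> Hom C U K \<and> (\<forall>i\<in>I. x i \<in> Hom C (X i) K \<and> u \<cdot> \<iota> i = x i) \<and>
    (\<forall>P\<in>Hw. \<forall>y\<in>Hom C P K. \<exists>z\<in>Hom C P U. u \<cdot> z = y)"
proof -
  note Ko = wge_obj[OF K]
  obtain S where S: "S \<subseteq> Hw" "small \<kappa> S"
    and rep: "\<And>P. P \<in> Hw \<Longrightarrow> \<exists>Q\<in>S. \<exists>a\<in>Hom C P Q. \<exists>b\<in>Hom C Q P. b \<cdot> a = ident C P"
    by (rule Hw_representatives) blast
  have "small \<kappa> (Hom C P K)" if "P \<in> S" for P using hom_small[OF _ Ko] S(1) that by blast
  from labelled_coproduct[where E = "\<lambda>P. Hom C P K", OF S this]
  obtain I :: "'a set" and X U \<iota> x where I: "small \<kappa> I" and U: "coproduct C I X U \<iota>" "U \<in> wge"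
    and Xx: "\<forall>i\<in>I. X i \<in> S \<and> x i \<in> Hom C (X i) K"
    and onto: "\<forall>P\<in>S. \<forall>y\<in>Hom C P K. \<exists>i\<in>I. X i = P \<and> x i = y"
    by blast
  obtain u where u: "u \<in> Hom C U K" "\<forall>i\<in>I. u \<cdot> \<iota> i = x i"
    using coproduct_map[OF U(1) Ko] Xx by metis
  have "\<exists>z\<in>Hom C P U. u \<cdot> z = y" if P: "P \<in> Hw" and y: "y \<in> Hom C P K" for P y
  proof -
    obtain Q a b where Q: "Q \<in> S" and a: "a \<in> Hom C P Q" and b: "b \<in> Hom C Q P" "b \<cdot> a = ident C P"
      using rep[OF P] by blast
    obtain i where i: "i \<in> I" "X i = Q" "x i = y \<cdot> b" using onto Q cmp_Hom[OF b(1) y] by blast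
    have \<iota>: "\<iota> i \<in> Hom C Q U" using coproductD(2)[OF U(1) i(1)] i(2) by simp
    have "u \<cdot> (\<iota> i \<cdot> a) = (y \<cdot> b) \<cdot> a" using cmp_assoc[OF a \<iota> u(1)] u(2) i by simp
    also have "\<dots> = y" using cmp_assoc[OF a b(1) y] b(2) cmp_ident[OF y] by simp
    finally show ?thesis using cmp_Hom[OF a \<iota>] by blast
  qed
  moreover have "X ` I \<subseteq> Hw" using Xx S(1) by blast
  ultimately show ?thesis using I U u Xx by blast
qed

text \<open>
  The arrow \<open>f\<close> vanishes on a cover of \<open>K\<close>, so it factors through the cone of the cover. That cone
  lies in \<open>wge[1]\<close> and has no arrows to \<open>tle\<close>.
\<close>

lemma Hw_separates:
  assumes K: "K \<in> wge" and N: "N \<in> tle" and f: "f \<in> Hom C K N"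
    and z: "\<And>P y. P \<in> Hw \<Longrightarrow> y \<in> Hom C P K \<Longrightarrow> f \<cdot> y = zmor C P N"
  shows "f = zmor C K N"
proof -
  from Hw_cover[OF K]
  obtain I :: "'a set" and X U \<iota> u x where "small \<kappa> I" and X: "X ` I \<subseteq> Hw" and U: "coproduct C I X U \<iota>" "U \<in> wge"
    and u: "u \<in> Hom C U K" and x: "\<forall>i\<in>I. x i \<in> Hom C (X i) K \<and> u \<cdot> \<iota> i = x i"
    and onto: "\<forall>P\<in>Hw. \<forall>y\<in>Hom C P K. \<exists>z\<in>Hom C P U. u \<cdot> z = y"
    by blast
  note Uo = wge_obj[OF U(2)] and No = tle_obj[OF N]
  have "f \<cdot> u = zmor C U N"
  proof (rule coproduct_eqI[OF U(1) cmp_Hom[OF u f] zmor_Hom[OF Uo No]])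
    fix i assume i: "i \<in> I"
    note \<iota> = coproductD(2)[OF U(1) i]
    show "(f \<cdot> u) \<cdot> \<iota> i = zmor C U N \<cdot> \<iota> i"
      using cmp_assoc[OF \<iota> u f] bspec[OF x i] z[of "X i" "x i"] X i zmor_cmp[OF \<iota> No] by auto
  qed
  obtain Z v w where T: "dist_tri C U K Z u v w" using TR_cone[OF u] by blast
  obtain K' where K': "K' \<in> wge" "sho C K' = Z" using cone_of_Hw_surjection[OF T U(2) K] onto by blast
  obtain f' where f': "f' \<in> Hom C Z N" "f' \<cdot> v = f" using exact_from1[OF T f \<open>f \<cdot> u = zmor C U N\<close>] by blast
  have "f' = zmor C Z N" using wge_tle[OF K'(1) N] f'(1) K'(2) by simp
  then show ?thesis using f'(2) zmor_cmp[OF dist_triD(2)[OF T] No] by simp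
qed

lemma Hw_faithful:
  assumes N: "N \<in> wge" and N': "N' \<in> tle" and f: "f \<in> Hom C N N'" and g: "g \<in> Hom C N N'"
    and eq: "\<And>P y. P \<in> Hw \<Longrightarrow> y \<in> Hom C P N \<Longrightarrow> f \<cdot> y = g \<cdot> y"
  shows "f = g"
proof -
  have "f \<boxminus> g = zmor C N N'"
  proof (rule Hw_separates[OF N N' diff_Hom[OF f g]])
    fix P y assume P: "P \<in> Hw" and y: "y \<in> Hom C P N"
    have "f \<cdot> y \<boxminus> g \<cdot> y = zmor C P N'"
      using diff_eq_zmor[OF cmp_Hom[OF y f] cmp_Hom[OF y g]] eq[OF P y] by simp
    then show "(f \<boxminus> g) \<cdot> y = zmor C P N'" using diff_cmp[OF y f g] by simp
  qed
  then show ?thesis using diff_eq_zmor[OF f g] by simp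
qed

text \<open>
  Evaluating the transformation on the summands of a cover \<open>u\<close> of \<open>N\<close> gives an arrow \<open>g\<close> from the cover
  to \<open>N'\<close>. By compactness, \<open>g\<close> induces the transformation on arrows that factor through \<open>u\<close>, so it
  vanishes on the fibre of \<open>u\<close> by \<open>Hw_separates\<close> and factors through \<open>u\<close>.
\<close>

lemma Hw_full:
  assumes N: "N \<in> wge" and N': "N' \<in> tle"
    and \<phi>: "\<And>P y. P \<in> Hw \<Longrightarrow> y \<in> Hom C P N \<Longrightarrow> \<phi> P y \<in> Hom C P N'"
    and add: "\<And>P y z. P \<in> Hw \<Longrightarrow> y \<in> Hom C P N \<Longrightarrow> z \<in> Hom C P N \<Longrightarrow> \<phi> P (y \<boxplus> z) = \<phi> P y \<boxplus> \<phi> P z"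
    and nat: "\<And>P Q a y. P \<in> Hw \<Longrightarrow> Q \<in> Hw \<Longrightarrow> a \<in> Hom C P Q \<Longrightarrow> y \<in> Hom C Q N \<Longrightarrow>
      \<phi> P (y \<cdot> a) = \<phi> Q y \<cdot> a"
  shows "\<exists>h\<in>Hom C N N'. \<forall>P\<in>Hw. \<forall>y\<in>Hom C P N. h \<cdot> y = \<phi> P y"
proof -
  note No = wge_obj[OF N] and N'o = tle_obj[OF N']
  have zero: "\<phi> P (zmor C P N) = zmor C P N'" if P: "P \<in> Hw" for P
  proof -
    note Po = C0_obj[of P]
    have zz: "zmor C P P \<in> Hom C P P" "zmor C P N \<in> Hom C P N" using P Po zmor_Hom No by auto
    have "\<phi> P (zmor C P N) = \<phi> P (zmor C P N) \<cdot> zmor C P P"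
      using nat[OF P P zz] cmp_zmor[OF zz(2)] P Po by simp
    then show ?thesis using cmp_zmor[OF \<phi>[OF P zz(2)]] P Po by simp
  qed
  from Hw_cover[OF N]
  obtain I :: "'a set" and X U \<iota> u x where I: "small \<kappa> I" and X: "X ` I \<subseteq> Hw"
    and U: "coproduct C I X U \<iota>" "U \<in> wge"
    and u: "u \<in> Hom C U N" and x: "\<forall>i\<in>I. x i \<in> Hom C (X i) N \<and> u \<cdot> \<iota> i = x i"
    and onto: "\<forall>P\<in>Hw. \<forall>y\<in>Hom C P N. \<exists>z\<in>Hom C P U. u \<cdot> z = y"
    by blast
  have "\<phi> (X i) (x i) \<in> Hom C (X i) N'" if "i \<in> I" for i using \<phi> x X that by blast
  then obtain g where g: "g \<in> Hom C U N'" "\<forall>i\<in>I. g \<cdot> \<iota> i = \<phi> (X i) (x i)"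
    using coproduct_map[OF U(1) N'o, of "\<lambda>i. \<phi> (X i) (x i)"] by blast
  have gz: "g \<cdot> z = \<phi> P (u \<cdot> z)" if P: "P \<in> Hw" and z: "z \<in> Hom C P U" for P z
  proof -
    have PC: "P \<in> C0" and Po: "P \<in> obj C" using P C0_obj by auto
    have Xo: "X ` I \<subseteq> obj C" using X wge_obj by blast
    show ?thesis
    proof (induction rule: compact_induct[OF C0_compact[OF PC] I Xo U(1) z])
      case 1
      show ?case using cmp_zmor[OF g(1) Po] cmp_zmor[OF u Po] zero[OF P] by simp
    next
      case (2 a b)
      show ?case
        using 2 cmp_add[OF 2(1,2) g(1)] cmp_add[OF 2(1,2) u]
          add[OF P cmp_Hom[OF 2(1) u] cmp_Hom[OF 2(2) u]] by simp
    next
      case (3 i b)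
      note \<iota> = coproductD(2)[OF U(1) 3(1)]
      have "X i \<in> Hw" using X 3(1) by blast
      then show ?case
        using cmp_assoc[OF 3(2) \<iota> g(1)] cmp_assoc[OF 3(2) \<iota> u] g(2) bspec[OF x 3(1)] 3
          nat[OF P _ 3(2), of "x i"] by simp
    qed
  qed
  obtain Z v w where T: "dist_tri C U N Z u v w" using TR_cone[OF u] by blast
  obtain K where K: "K \<in> wge" "sho C K = Z" using cone_of_Hw_surjection[OF T U(2) N] onto by blast
  obtain k where T': "dist_tri C K U N k u v" using inverse_rotate T K wge_obj by blast
  note k = dist_triD(1)[OF T']
  have "g \<cdot> k = zmor C K N'"
  proof (rule Hw_separates[OF K(1) N' cmp_Hom[OF k g(1)]])
    fix P y assume P: "P \<in> Hw" and y: "y \<in> Hom C P K"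
    have "(g \<cdot> k) \<cdot> y = \<phi> P (u \<cdot> (k \<cdot> y))" using cmp_assoc[OF y k g(1)] gz[OF P cmp_Hom[OF y k]] by simp
    also have "u \<cdot> (k \<cdot> y) = zmor C P N"
      using cmp_assoc[OF y k u] triangle_cmp_zero[OF T'] zmor_cmp[OF y No] by simp
    finally show "(g \<cdot> k) \<cdot> y = zmor C P N'" using zero[OF P] by simp
  qed
  then obtain h where h: "h \<in> Hom C N N'" "h \<cdot> u = g" using exact_from1[OF T' g(1)] by blast
  have "h \<cdot> y = \<phi> P y" if P: "P \<in> Hw" and y: "y \<in> Hom C P N" for P y
  proof -
    obtain z where z: "z \<in> Hom C P U" "u \<cdot> z = y" using onto P y by blast
    then show ?thesis using cmp_assoc[OF z(1) u h(1)] h(2) gz[OF P z(1)] by simp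
  qed
  then show ?thesis using h(1) by blast
qed

end


section \<open>Objects of the heart with prescribed Hom functors\<close>

context adjacent_structures
begin

text \<open>
  An additive contravariant functor on \<open>Hw\<close>, with values \<open>FM\<close> and action \<open>ap\<close> on arrows, is
  represented by an object of the heart: it has a presentation by coproducts of objects of \<open>Hw\<close>,
  and the cone of the presenting arrow, truncated, has the right Hom groups, because neither the
  shifted first term of the presentation nor the removed part of the truncation receives arrows
  from \<open>Hw\<close>.
\<close>

lemma functor_realized_in_heart:
  fixes FM :: "'o \<Rightarrow> ('a, 'm) ring_scheme" and ap :: "'a \<Rightarrow> 'a \<Rightarrow> 'a"
  assumes FM: "\<And>P. P \<in> Hw \<Longrightarrow> abelian_group (FM P)" "\<And>P. P \<in> Hw \<Longrightarrow> small \<kappa> (carrier (FM P))"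
    and ap_closed: "\<And>P Q f x. P \<in> Hw \<Longrightarrow> Q \<in> Hw \<Longrightarrow> f \<in> Hom C P Q \<Longrightarrow> x \<in> carrier (FM Q) \<Longrightarrow>
      ap f x \<in> carrier (FM P)"
    and ap_add: "\<And>P Q f x y. P \<in> Hw \<Longrightarrow> Q \<in> Hw \<Longrightarrow> f \<in> Hom C P Q \<Longrightarrow> x \<in> carrier (FM Q) \<Longrightarrow>
      y \<in> carrier (FM Q) \<Longrightarrow> ap f (x \<oplus>\<^bsub>FM Q\<^esub> y) = ap f x \<oplus>\<^bsub>FM P\<^esub> ap f y"
    and ap_ident: "\<And>P x. P \<in> Hw \<Longrightarrow> x \<in> carrier (FM P) \<Longrightarrow> ap (ident C P) x = x"
    and ap_cmp: "\<And>P Q T f g x. P \<in> Hw \<Longrightarrow> Q \<in> Hw \<Longrightarrow> T \<in> Hw \<Longrightarrow> f \<in> Hom C P Q \<Longrightarrow> g \<in> Hom C Q T \<Longrightarrow>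
      x \<in> carrier (FM T) \<Longrightarrow> ap (g \<cdot> f) x = ap f (ap g x)"
    and add_ap: "\<And>P Q f g x. P \<in> Hw \<Longrightarrow> Q \<in> Hw \<Longrightarrow> f \<in> Hom C P Q \<Longrightarrow> g \<in> Hom C P Q \<Longrightarrow>
      x \<in> carrier (FM Q) \<Longrightarrow> ap (f \<boxplus> g) x = ap f x \<oplus>\<^bsub>FM P\<^esub> ap g x"
  shows "\<exists>N \<theta>. N \<in> tle \<and> N \<in> wge \<and>
    (\<forall>P\<in>Hw. bij_betw (\<theta> P) (Hom C P N) (carrier (FM P))) \<and>
    (\<forall>P\<in>Hw. \<forall>y\<in>Hom C P N. \<forall>z\<in>Hom C P N. \<theta> P (y \<boxplus> z) = \<theta> P y \<oplus>\<^bsub>FM P\<^esub> \<theta> P z) \<and>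
    (\<forall>P\<in>Hw. \<forall>Q\<in>Hw. \<forall>f\<in>Hom C P Q. \<forall>y\<in>Hom C Q N. \<theta> P (y \<cdot> f) = ap f (\<theta> Q y))"
proof -
  have Hwo: "P \<in> obj C" if "P \<in> Hw" for P using that C0_obj by blast
  have ap_zero: "ap f \<zero>\<^bsub>FM Q\<^esub> = \<zero>\<^bsub>FM P\<^esub>" if P: "P \<in> Hw" and Q: "Q \<in> Hw" and f: "f \<in> Hom C P Q" for P Q f
  proof -
    interpret A: abelian_group "FM P" using FM P by blast
    interpret B: abelian_group "FM Q" using FM Q by blast
    have "ap f \<zero>\<^bsub>FM Q\<^esub> \<oplus>\<^bsub>FM P\<^esub> ap f \<zero>\<^bsub>FM Q\<^esub> = ap f \<zero>\<^bsub>FM Q\<^esub>"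
      using ap_add[OF P Q f B.zero_closed B.zero_closed] by simp
    then show ?thesis using ap_closed[OF P Q f B.zero_closed] by simp
  qed
  have zero_ap: "ap (zmor C P Q) x = \<zero>\<^bsub>FM P\<^esub>"
    if P: "P \<in> Hw" and Q: "Q \<in> Hw" and x: "x \<in> carrier (FM Q)" for P Q x
  proof -
    interpret A: abelian_group "FM P" using FM P by blast
    interpret H: abelian_group "hom_group C P Q" using hom_group Hwo P Q by blast
    note z = zmor_Hom[OF Hwo[OF P] Hwo[OF Q]]
    have "ap (zmor C P Q) x \<oplus>\<^bsub>FM P\<^esub> ap (zmor C P Q) x = ap (zmor C P Q) x"
      using add_ap[OF P Q z z x] H.l_zero z by simp
    then show ?thesis using ap_closed[OF P Q z x] by simp
  qed
  obtain S where S: "S \<subseteq> Hw" "small \<kappa> S"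
    and rep: "\<And>P. P \<in> Hw \<Longrightarrow> \<exists>Q\<in>S. \<exists>a\<in>Hom C P Q. \<exists>b\<in>Hom C Q P. b \<cdot> a = ident C P"
    by (rule Hw_representatives) blast
  have "small \<kappa> (carrier (FM P))" if "P \<in> S" for P using FM(2) S(1) that by blast
  from labelled_coproduct[where E = "\<lambda>P. carrier (FM P)", OF S this]
  obtain I :: "'a set" and X U \<iota> x where I: "small \<kappa> I" and U: "coproduct C I X U \<iota>" "U \<in> wge"
    and Xx: "\<forall>i\<in>I. X i \<in> S \<and> x i \<in> carrier (FM (X i))"
    and onto: "\<forall>P\<in>S. \<forall>y\<in>carrier (FM P). \<exists>i\<in>I. X i = P \<and> x i = y"
    by blast
  have X: "X i \<in> Hw" and x: "x i \<in> carrier (FM (X i))" if "i \<in> I" for i using Xx S(1) that by blast+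
  have Xo: "X ` I \<subseteq> obj C" using X Hwo by blast
  note Uo = wge_obj[OF U(2)] and \<iota> = coproductD(2)[OF U(1)]
  \<comment> \<open>Projections let the components of an arrow to \<open>U\<close> be recovered additively and naturally.\<close>
  obtain \<pi> where \<pi>_all: "\<forall>j\<in>I. \<pi> j \<in> Hom C U (X j) \<and>
    (\<forall>i\<in>I. \<pi> j \<cdot> \<iota> i = (if i = j then ident C (X j) else zmor C (X i) (X j)))"
    using coproduct_projections[OF U(1) Xo] by blast
  have \<pi>: "\<pi> j \<in> Hom C U (X j)" if "j \<in> I" for j using \<pi>_all that by blast
  have \<pi>\<iota>: "\<pi> j \<cdot> \<iota> i = (if i = j then ident C (X j) else zmor C (X i) (X j))"
    if "i \<in> I" "j \<in> I" for i j using \<pi>_all that by blast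
  \<comment> \<open>\<open>\<epsilon>\<close> is the surjection \<open>C(-, U) \<rightarrow> F\<close> sending the inclusion of a summand to its label.\<close>
  define supp where "supp P z = {i \<in> I. \<pi> i \<cdot> z \<noteq> zmor C P (X i)}" for P z
  define \<epsilon> where "\<epsilon> P z = finsum (FM P) (\<lambda>i. ap (\<pi> i \<cdot> z) (x i)) (supp P z)" for P z
  have term_closed: "ap (\<pi> i \<cdot> z) (x i) \<in> carrier (FM P)"
    if P: "P \<in> Hw" and z: "z \<in> Hom C P U" and i: "i \<in> I" for P z i
    using ap_closed[OF P X[OF i] cmp_Hom[OF z \<pi>[OF i]] x[OF i]] .
  have induct: "Q z" if P: "P \<in> Hw" and z: "z \<in> Hom C P U" and "Q (zmor C P U)"
    "\<And>a b. \<lbrakk>a \<in> Hom C P U; b \<in> Hom C P U; Q a; Q b\<rbrakk> \<Longrightarrow> Q (a \<boxplus> b)"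
    "\<And>i b. \<lbrakk>i \<in> I; b \<in> Hom C P (X i)\<rbrakk> \<Longrightarrow> Q (\<iota> i \<cdot> b)" for Q z P
    using compact_induct[OF C0_compact I Xo U(1) z, of Q] that(3-5) P by blast
  have \<pi>\<iota>b: "\<pi> j \<cdot> (\<iota> i \<cdot> b) = (if i = j then b else zmor C P (X j))"
    if i: "i \<in> I" and j: "j \<in> I" and b: "b \<in> Hom C P (X i)" for i j b P
    using cmp_assoc[OF b \<iota>[OF i] \<pi>[OF j]] \<pi>\<iota>[OF i j] ident_cmp[OF b] zmor_cmp[OF b] Xo j by auto
  have supp_zero: "supp P (zmor C P U) = {}" if P: "P \<in> Hw" for P
    using cmp_zmor[OF \<pi> Hwo[OF P]] by (auto simp: supp_def)
  have supp_add: "supp P (a \<boxplus> b) \<subseteq> supp P a \<union> supp P b"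
    if P: "P \<in> Hw" and a: "a \<in> Hom C P U" and b: "b \<in> Hom C P U" for P a b
  proof
    fix i assume i: "i \<in> supp P (a \<boxplus> b)"
    then have iI: "i \<in> I" by (simp add: supp_def)
    interpret H: abelian_group "hom_group C P (X i)" using hom_group Hwo X P iI by blast
    show "i \<in> supp P a \<union> supp P b"
      using i cmp_add[OF a b \<pi>[OF iI]] iI H.l_zero[OF H.zero_closed] by (auto simp: supp_def)
  qed
  have supp_\<iota>: "supp P (\<iota> i \<cdot> b) \<subseteq> {i}" if i: "i \<in> I" and b: "b \<in> Hom C P (X i)" for P i b
  proof
    fix j assume "j \<in> supp P (\<iota> i \<cdot> b)"
    then have j: "j \<in> I" "\<pi> j \<cdot> (\<iota> i \<cdot> b) \<noteq> zmor C P (X j)" by (simp_all add: supp_def)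
    then show "j \<in> {i}" using \<pi>\<iota>b[OF i j(1) b] by (cases "i = j") simp_all
  qed
  have supp_fin: "finite (supp P z)" if P: "P \<in> Hw" and z: "z \<in> Hom C P U" for P z
    using P z
  proof (rule induct)
    show "finite (supp P (zmor C P U))" using supp_zero[OF P] by simp
    show "finite (supp P (a \<boxplus> b))"
      if "a \<in> Hom C P U" "b \<in> Hom C P U" "finite (supp P a)" "finite (supp P b)" for a b
      using supp_add[OF P that(1,2)] that(3,4) finite_subset by blast
    show "finite (supp P (\<iota> i \<cdot> b))" if "i \<in> I" "b \<in> Hom C P (X i)" for i b
      using supp_\<iota>[OF that] finite_subset by blast
  qed
  have \<epsilon>_sup: "\<epsilon> P z = finsum (FM P) (\<lambda>i. ap (\<pi> i \<cdot> z) (x i)) J"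
    if P: "P \<in> Hw" and z: "z \<in> Hom C P U" and J: "finite J" "supp P z \<subseteq> J" "J \<subseteq> I" for P z J
  proof -
    interpret A: abelian_group "FM P" using FM P by blast
    show ?thesis
      unfolding \<epsilon>_def
    proof (rule A.add.finprod_mono_neutral_cong_left[OF J(1,2)])
      show "ap (\<pi> i \<cdot> z) (x i) = \<zero>\<^bsub>FM P\<^esub>" if "i \<in> J - supp P z" for i
      proof -
        have "i \<in> I" "\<pi> i \<cdot> z = zmor C P (X i)" using that J(3) by (auto simp: supp_def)
        then show ?thesis using zero_ap[OF P X x] by simp
      qed
      show "(\<lambda>i. ap (\<pi> i \<cdot> z) (x i)) \<in> J \<rightarrow> carrier (FM P)" using term_closed[OF P z] J(3) by blast
    qed simp
  qed
  have \<epsilon>_closed: "\<epsilon> P z \<in> carrier (FM P)" if P: "P \<in> Hw" and z: "z \<in> Hom C P U" for P z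
  proof -
    interpret A: abelian_group "FM P" using FM P by blast
    show ?thesis unfolding \<epsilon>_def using term_closed[OF P z]
      by (intro A.finsum_closed) (auto simp: supp_def)
  qed
  have \<epsilon>_zero: "\<epsilon> P (zmor C P U) = \<zero>\<^bsub>FM P\<^esub>" if P: "P \<in> Hw" for P
  proof -
    interpret A: abelian_group "FM P" using FM P by blast
    show ?thesis by (simp add: \<epsilon>_def supp_zero[OF P])
  qed
  have \<epsilon>_add: "\<epsilon> P (a \<boxplus> b) = \<epsilon> P a \<oplus>\<^bsub>FM P\<^esub> \<epsilon> P b"
    if P: "P \<in> Hw" and a: "a \<in> Hom C P U" and b: "b \<in> Hom C P U" for P a b
  proof -
    interpret A: abelian_group "FM P" using FM P by blast
    let ?J = "supp P a \<union> supp P b"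
    have J: "finite ?J" "?J \<subseteq> I" using supp_fin[OF P a] supp_fin[OF P b] by (auto simp: supp_def)
    have "\<epsilon> P (a \<boxplus> b) = finsum (FM P) (\<lambda>i. ap (\<pi> i \<cdot> (a \<boxplus> b)) (x i)) ?J"
      using \<epsilon>_sup[OF P add_Hom[OF a b] J(1) supp_add[OF P a b] J(2)] .
    also have "\<dots> = finsum (FM P) (\<lambda>i. ap (\<pi> i \<cdot> a) (x i) \<oplus>\<^bsub>FM P\<^esub> ap (\<pi> i \<cdot> b) (x i)) ?J"
    proof (rule A.finsum_cong'[OF refl])
      show "(\<lambda>i. ap (\<pi> i \<cdot> a) (x i) \<oplus>\<^bsub>FM P\<^esub> ap (\<pi> i \<cdot> b) (x i)) \<in> ?J \<rightarrow> carrier (FM P)"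
        using term_closed[OF P a] term_closed[OF P b] J(2) by blast
      fix i assume "i \<in> ?J"
      then have i: "i \<in> I" using J(2) by blast
      show "ap (\<pi> i \<cdot> (a \<boxplus> b)) (x i) = ap (\<pi> i \<cdot> a) (x i) \<oplus>\<^bsub>FM P\<^esub> ap (\<pi> i \<cdot> b) (x i)"
        using cmp_add[OF a b \<pi>[OF i]] add_ap[OF P X[OF i] cmp_Hom[OF a \<pi>[OF i]] cmp_Hom[OF b \<pi>[OF i]] x[OF i]]
        by simp
    qed
    also have "\<dots> = finsum (FM P) (\<lambda>i. ap (\<pi> i \<cdot> a) (x i)) ?J \<oplus>\<^bsub>FM P\<^esub>
        finsum (FM P) (\<lambda>i. ap (\<pi> i \<cdot> b) (x i)) ?J"
      using term_closed[OF P a] term_closed[OF P b] J(2) by (intro A.finsum_addf) blast+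
    also have "\<dots> = \<epsilon> P a \<oplus>\<^bsub>FM P\<^esub> \<epsilon> P b"
      using \<epsilon>_sup[OF P a J(1) _ J(2)] \<epsilon>_sup[OF P b J(1) _ J(2)] by simp
    finally show ?thesis .
  qed
  have \<epsilon>_\<iota>: "\<epsilon> P (\<iota> i \<cdot> b) = ap b (x i)" if P: "P \<in> Hw" and i: "i \<in> I" and b: "b \<in> Hom C P (X i)" for P i b
  proof -
    interpret A: abelian_group "FM P" using FM P by blast
    have "\<epsilon> P (\<iota> i \<cdot> b) = finsum (FM P) (\<lambda>j. ap (\<pi> j \<cdot> (\<iota> i \<cdot> b)) (x j)) {i}"
      using \<epsilon>_sup[OF P cmp_Hom[OF b \<iota>[OF i]] _ supp_\<iota>[OF i b]] i by simp
    also have "\<dots> = ap b (x i)"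
      using \<pi>\<iota>b[OF i i b] ap_closed[OF P X[OF i] b x[OF i]] by simp
    finally show ?thesis .
  qed
  have \<epsilon>_nat: "\<epsilon> P (z \<cdot> f) = ap f (\<epsilon> Q z)"
    if P: "P \<in> Hw" and Q: "Q \<in> Hw" and f: "f \<in> Hom C P Q" and z: "z \<in> Hom C Q U" for P Q f z
    using Q z
  proof (rule induct)
    show "\<epsilon> P (zmor C Q U \<cdot> f) = ap f (\<epsilon> Q (zmor C Q U))"
      using zmor_cmp[OF f Uo] \<epsilon>_zero P Q ap_zero[OF P Q f] by simp
    show "\<epsilon> P ((a \<boxplus> b) \<cdot> f) = ap f (\<epsilon> Q (a \<boxplus> b))"
      if a: "a \<in> Hom C Q U" and b: "b \<in> Hom C Q U"
        and "\<epsilon> P (a \<cdot> f) = ap f (\<epsilon> Q a)" "\<epsilon> P (b \<cdot> f) = ap f (\<epsilon> Q b)" for a b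
      using that(3,4) add_cmp[OF f a b] \<epsilon>_add[OF P cmp_Hom[OF f a] cmp_Hom[OF f b]] \<epsilon>_add[OF Q a b]
        ap_add[OF P Q f \<epsilon>_closed[OF Q a] \<epsilon>_closed[OF Q b]] by simp
    show "\<epsilon> P ((\<iota> i \<cdot> b) \<cdot> f) = ap f (\<epsilon> Q (\<iota> i \<cdot> b))" if i: "i \<in> I" and b: "b \<in> Hom C Q (X i)" for i b
      using cmp_assoc[OF f b \<iota>[OF i]] \<epsilon>_\<iota>[OF P i cmp_Hom[OF f b]] \<epsilon>_\<iota>[OF Q i b]
        ap_cmp[OF P Q X[OF i] f b x[OF i]] by simp
  qed
  \<comment> \<open>The second coproduct is labelled by the kernel of \<open>\<epsilon>\<close>, so \<open>C(-, U1) \<rightarrow> C(-, U) \<rightarrow> F\<close> is exact.\<close>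
  have "small \<kappa> {k \<in> Hom C P U. \<epsilon> P k = \<zero>\<^bsub>FM P\<^esub>}" if P: "P \<in> S" for P
  proof -
    have "P \<in> C0" using S(1) P by blast
    then show ?thesis using small_subset[OF hom_small[OF _ Uo], of P] by simp
  qed
  from labelled_coproduct[where E = "\<lambda>P. {k \<in> Hom C P U. \<epsilon> P k = \<zero>\<^bsub>FM P\<^esub>}", OF S this]
  obtain I1 :: "'a set" and X1 U1 \<iota>1 k where I1: "small \<kappa> I1" and U1: "coproduct C I1 X1 U1 \<iota>1" "U1 \<in> wge"
    and X1: "\<forall>i\<in>I1. X1 i \<in> S \<and> k i \<in> {k \<in> Hom C (X1 i) U. \<epsilon> (X1 i) k = \<zero>\<^bsub>FM (X1 i)\<^esub>}"
    and onto1: "\<forall>P\<in>S. \<forall>y\<in>{k \<in> Hom C P U. \<epsilon> P k = \<zero>\<^bsub>FM P\<^esub>}. \<exists>i\<in>I1. X1 i = P \<and> k i = y"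
    by blast
  have X1H: "X1 i \<in> Hw" and k: "k i \<in> Hom C (X1 i) U" and \<epsilon>k: "\<epsilon> (X1 i) (k i) = \<zero>\<^bsub>FM (X1 i)\<^esub>"
    if "i \<in> I1" for i using X1 S(1) that by blast+
  note \<iota>1 = coproductD(2)[OF U1(1)]
  obtain d where d: "d \<in> Hom C U1 U" and d\<iota>: "\<forall>i\<in>I1. d \<cdot> \<iota>1 i = k i"
    using coproduct_map[OF U1(1) Uo] k by blast
  have \<epsilon>d: "\<epsilon> P (d \<cdot> v) = \<zero>\<^bsub>FM P\<^esub>" if P: "P \<in> Hw" and v: "v \<in> Hom C P U1" for P v
  proof -
    interpret A: abelian_group "FM P" using FM P by blast
    have PC: "P \<in> C0" using P by blast
    have X1o: "X1 ` I1 \<subseteq> obj C" using X1H Hwo by blast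
    show ?thesis
    proof (induction rule: compact_induct[OF C0_compact[OF PC] I1 X1o U1(1) v])
      case 1 show ?case using cmp_zmor[OF d Hwo[OF P]] \<epsilon>_zero[OF P] by simp
    next
      case (2 a b)
      then show ?case
        using cmp_add[OF 2(1,2) d] \<epsilon>_add[OF P cmp_Hom[OF 2(1) d] cmp_Hom[OF 2(2) d]] by simp
    next
      case (3 i b)
      have "d \<cdot> (\<iota>1 i \<cdot> b) = k i \<cdot> b" using cmp_assoc[OF 3(2) \<iota>1[OF 3(1)] d] d\<iota> 3(1) by simp
      then show ?case
        using \<epsilon>_nat[OF P X1H[OF 3(1)] 3(2) k[OF 3(1)]] \<epsilon>k[OF 3(1)] ap_zero[OF P X1H[OF 3(1)] 3(2)] by simp
    qed
  qed
  have ker\<epsilon>: "\<exists>v\<in>Hom C P U1. d \<cdot> v = z" if P: "P \<in> Hw" and z: "z \<in> Hom C P U" "\<epsilon> P z = \<zero>\<^bsub>FM P\<^esub>" for P z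
  proof -
    obtain Q a b where Q: "Q \<in> S" and a: "a \<in> Hom C P Q" and b: "b \<in> Hom C Q P" "b \<cdot> a = ident C P"
      using rep[OF P] by blast
    have QH: "Q \<in> Hw" using Q S(1) by blast
    have "\<epsilon> Q (z \<cdot> b) = \<zero>\<^bsub>FM Q\<^esub>" using \<epsilon>_nat[OF QH P b(1) z(1)] z(2) ap_zero[OF QH P b(1)] by simp
    then obtain i where i: "i \<in> I1" "X1 i = Q" "k i = z \<cdot> b" using onto1 Q cmp_Hom[OF b(1) z(1)] by blast
    have \<iota>i: "\<iota>1 i \<in> Hom C Q U1" using \<iota>1[OF i(1)] i(2) by simp
    have "d \<cdot> (\<iota>1 i \<cdot> a) = (z \<cdot> b) \<cdot> a" using cmp_assoc[OF a \<iota>i d] d\<iota> i by simp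
    also have "\<dots> = z" using cmp_assoc[OF a b(1) z(1)] b(2) cmp_ident[OF z(1)] by simp
    finally show ?thesis using cmp_Hom[OF a \<iota>i] by blast
  qed
  \<comment> \<open>The cone \<open>Z\<close> already has \<open>C(P, Z) = F P\<close>; the truncation \<open>N\<close> moves it into the heart.\<close>
  obtain Z p w where T: "dist_tri C U1 U Z d p w" using TR_cone[OF d] by blast
  have Z: "Z \<in> wge" using wge_extension[OF rotate[OF T] U(2) wge_sho[OF U1(2)]] .
  obtain L N l n h where L: "L \<in> wge" and N: "N \<in> tle" and T': "dist_tri C (sho C L) Z N l n h"
    using t_decomposition_shifted[OF wge_obj[OF Z]] by blast
  have Nw: "N \<in> wge" using wge_extension[OF rotate[OF T'] Z wge_sho[OF wge_sho[OF L]]] .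
  note p = dist_triD(2)[OF T] and n = dist_triD(2)[OF T']
  define q where "q = n \<cdot> p"
  have q: "q \<in> Hom C U N" unfolding q_def using cmp_Hom[OF p n] .
  have q_onto: "\<exists>z\<in>Hom C P U. q \<cdot> z = y" if P: "P \<in> Hw" and y: "y \<in> Hom C P N" for P y
  proof -
    have "h \<cdot> y = zmor C P (sho C (sho C L))"
      using wle_wge[OF _ wge_sho[OF L] cmp_Hom[OF y dist_triD(3)[OF T']]] P by blast
    then obtain y' where y': "y' \<in> Hom C P Z" "n \<cdot> y' = y" using exact_to2[OF T' y] by blast
    have "w \<cdot> y' = zmor C P (sho C U1)"
      using wle_wge[OF _ U1(2) cmp_Hom[OF y'(1) dist_triD(3)[OF T]]] P by blast
    then obtain z where z: "z \<in> Hom C P U" "p \<cdot> z = y'" using exact_to2[OF T y'(1)] by blast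
    then show ?thesis using cmp_assoc[OF z(1) p n] y'(2) by (auto simp: q_def)
  qed
  have q_ker: "q \<cdot> z = zmor C P N \<longleftrightarrow> \<epsilon> P z = \<zero>\<^bsub>FM P\<^esub>" if P: "P \<in> Hw" and z: "z \<in> Hom C P U" for P z
  proof
    assume "q \<cdot> z = zmor C P N"
    then have "n \<cdot> (p \<cdot> z) = zmor C P N" using cmp_assoc[OF z p n] by (simp add: q_def)
    then obtain s where s: "s \<in> Hom C P (sho C L)" "l \<cdot> s = p \<cdot> z"
      using exact_to1[OF T' cmp_Hom[OF z p]] by blast
    have "s = zmor C P (sho C L)" using wle_wge[OF _ L s(1)] P by blast
    then have "p \<cdot> z = zmor C P Z" using s(2) cmp_zmor[OF dist_triD(1)[OF T'] Hwo[OF P]] by simp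
    then obtain v where "v \<in> Hom C P U1" "d \<cdot> v = z" using exact_to1[OF T z] by blast
    then show "\<epsilon> P z = \<zero>\<^bsub>FM P\<^esub>" using \<epsilon>d[OF P] by blast
  next
    assume "\<epsilon> P z = \<zero>\<^bsub>FM P\<^esub>"
    then obtain v where v: "v \<in> Hom C P U1" "d \<cdot> v = z" using ker\<epsilon>[OF P z] by blast
    have "p \<cdot> z = zmor C P Z"
      using cmp_assoc[OF v(1) d p] v(2) triangle_cmp_zero[OF T] zmor_cmp[OF v(1) wge_obj[OF Z]] by simp
    then show "q \<cdot> z = zmor C P N"
      using cmp_assoc[OF z p n] cmp_zmor[OF n Hwo[OF P]] by (simp add: q_def)
  qed
  have q_eq: "q \<cdot> z = q \<cdot> z' \<longleftrightarrow> \<epsilon> P z = \<epsilon> P z'"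
    if P: "P \<in> Hw" and z: "z \<in> Hom C P U" "z' \<in> Hom C P U" for P z z'
  proof -
    interpret A: abelian_group "FM P" using FM P by blast
    note zz = diff_Hom[OF z]
    have "\<epsilon> P z = \<epsilon> P (z \<boxminus> z') \<oplus>\<^bsub>FM P\<^esub> \<epsilon> P z'" using \<epsilon>_add[OF P zz z(2)] diff_add[OF z] by simp
    then have "\<epsilon> P (z \<boxminus> z') = \<zero>\<^bsub>FM P\<^esub> \<longleftrightarrow> \<epsilon> P z = \<epsilon> P z'"
      using A.add.r_cancel_one[OF \<epsilon>_closed[OF P z(2)] \<epsilon>_closed[OF P zz]] by auto
    moreover have "q \<cdot> (z \<boxminus> z') = zmor C P N \<longleftrightarrow> q \<cdot> z = q \<cdot> z'"
      using cmp_diff[OF z q] diff_eq_zmor[OF cmp_Hom[OF z(1) q] cmp_Hom[OF z(2) q]] by simp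
    ultimately show ?thesis using q_ker[OF P zz] by blast
  qed
  \<comment> \<open>Both \<open>\<epsilon>\<close> and composition with \<open>q\<close> are surjective with the same kernel; \<open>\<theta>\<close> compares them.\<close>
  define \<theta> where "\<theta> P y = \<epsilon> P (SOME z. z \<in> Hom C P U \<and> q \<cdot> z = y)" for P y
  have \<theta>: "\<theta> P (q \<cdot> z) = \<epsilon> P z" if P: "P \<in> Hw" and z: "z \<in> Hom C P U" for P z
  proof -
    let ?z = "SOME z'. z' \<in> Hom C P U \<and> q \<cdot> z' = q \<cdot> z"
    have "?z \<in> Hom C P U \<and> q \<cdot> ?z = q \<cdot> z" by (rule someI[of _ z]) (use z in simp)
    then show ?thesis using q_eq[OF P _ z, of ?z] unfolding \<theta>_def by blast
  qed
  have "bij_betw (\<theta> P) (Hom C P N) (carrier (FM P))" if P: "P \<in> Hw" for P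
    unfolding bij_betw_def
  proof
    show "inj_on (\<theta> P) (Hom C P N)"
    proof (rule inj_onI)
      fix y y' assume y: "y \<in> Hom C P N" "y' \<in> Hom C P N" and eq: "\<theta> P y = \<theta> P y'"
      obtain z z' where z: "z \<in> Hom C P U" "q \<cdot> z = y" and z': "z' \<in> Hom C P U" "q \<cdot> z' = y'"
        using q_onto[OF P y(1)] q_onto[OF P y(2)] by blast
      then show "y = y'" using eq \<theta>[OF P z(1)] \<theta>[OF P z'(1)] q_eq[OF P z(1) z'(1)] by simp
    qed
    show "\<theta> P ` Hom C P N = carrier (FM P)"
    proof
      show "\<theta> P ` Hom C P N \<subseteq> carrier (FM P)"
      proof
        fix e assume "e \<in> \<theta> P ` Hom C P N"
        then obtain y where y: "y \<in> Hom C P N" "e = \<theta> P y" by blast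
        then obtain z where "z \<in> Hom C P U" "q \<cdot> z = y" using q_onto[OF P y(1)] by blast
        then show "e \<in> carrier (FM P)" using \<theta>[OF P] \<epsilon>_closed[OF P] y(2) by auto
      qed
      show "carrier (FM P) \<subseteq> \<theta> P ` Hom C P N"
      proof
        fix e assume e: "e \<in> carrier (FM P)"
        obtain Q a b where Q: "Q \<in> S" and a: "a \<in> Hom C P Q" and b: "b \<in> Hom C Q P" "b \<cdot> a = ident C P"
          using rep[OF P] by blast
        have QH: "Q \<in> Hw" using Q S(1) by blast
        obtain i where i: "i \<in> I" "X i = Q" "x i = ap b e" using onto Q ap_closed[OF QH P b(1) e] by blast
        have aX: "a \<in> Hom C P (X i)" using a i(2) by simp
        have z: "\<iota> i \<cdot> a \<in> Hom C P U" using cmp_Hom[OF aX \<iota>[OF i(1)]] .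
        have "\<theta> P (q \<cdot> (\<iota> i \<cdot> a)) = e"
          using \<theta>[OF P z] \<epsilon>_\<iota>[OF P i(1) aX] i(3) ap_cmp[OF P QH P a b(1) e] b(2) ap_ident[OF P e] by simp
        then show "e \<in> \<theta> P ` Hom C P N" using cmp_Hom[OF z q] by blast
      qed
    qed
  qed
  moreover have "\<theta> P (y \<boxplus> y') = \<theta> P y \<oplus>\<^bsub>FM P\<^esub> \<theta> P y'"
    if P: "P \<in> Hw" and y: "y \<in> Hom C P N" "y' \<in> Hom C P N" for P y y'
  proof -
    obtain z z' where z: "z \<in> Hom C P U" "q \<cdot> z = y" and z': "z' \<in> Hom C P U" "q \<cdot> z' = y'"
      using q_onto[OF P y(1)] q_onto[OF P y(2)] by blast
    then show ?thesis
      using cmp_add[OF z(1) z'(1) q] \<theta>[OF P] \<epsilon>_add[OF P z(1) z'(1)] \<theta>[OF P add_Hom[OF z(1) z'(1)]] by auto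
  qed
  moreover have "\<theta> P (y \<cdot> f) = ap f (\<theta> Q y)"
    if P: "P \<in> Hw" and Q: "Q \<in> Hw" and f: "f \<in> Hom C P Q" and y: "y \<in> Hom C Q N" for P Q f y
  proof -
    obtain z where z: "z \<in> Hom C Q U" "q \<cdot> z = y" using q_onto[OF Q y] by blast
    then show ?thesis
      using cmp_assoc[OF f z(1) q] \<theta>[OF Q z(1)] \<theta>[OF P cmp_Hom[OF f z(1)]] \<epsilon>_nat[OF P Q f z(1)] by simp
  qed
  ultimately show ?thesis using N Nw by blast
qed

end


section \<open>Objects with Hom modules in a weak Serre subcategory\<close>

text \<open>
  Linearity is only available on \<open>C0\<close>; it makes every \<open>C(M, N)\<close> with \<open>M\<close> in \<open>C0\<close> a module on which
  scalars act by precomposition.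
\<close>

locale linear_adjacent_structures = adjacent_structures C \<kappa> C0 wle wge tle
  for C :: "('o, 'a) tri_cat" (structure) and \<kappa> C0 wle wge tle +
  fixes R :: "'r ring" and sc :: "'r \<Rightarrow> 'a \<Rightarrow> 'a" and A :: "('r, 'a) module set"
  assumes R: "cring R"
    and linear: "linear_triangulated R (full_subcat C C0) sc"
    and A: "weak_Serre \<kappa> R A"
begin

abbreviation "hm \<equiv> hom_module C sc"
abbreviation "CA \<equiv> objects_with_homs_in C sc C0 A"

lemma hm_simps [simp]:
  "carrier (hm M N) = Hom C M N" "zero (hm M N) = zmor C M N" "add (hm M N) = amor C"
  "smult (hm M N) r f = f \<cdot> sc r (ident C M)"
  by (simp_all add: hom_module_def)

lemma sc_module:
  assumes "M \<in> C0" "N \<in> C0"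
  shows "module R \<lparr>carrier = Hom C M N, mult = undefined, one = undefined, zero = zmor C M N,
    add = amor C, smult = sc\<rparr>"
proof -
  have "zmor (full_subcat C C0) = zmor C" "amor (full_subcat C C0) = amor C"
    by (simp_all add: full_subcat_def)
  moreover have "M \<in> obj (full_subcat C C0)" "N \<in> obj (full_subcat C C0)"
    using assms C0_obj by simp_all
  ultimately show ?thesis
    using linear assms unfolding linear_triangulated_def by (simp add: Hom_full_subcat)
qed

lemma sc_Hom: "M \<in> C0 \<Longrightarrow> N \<in> C0 \<Longrightarrow> r \<in> carrier R \<Longrightarrow> f \<in> Hom C M N \<Longrightarrow> sc r f \<in> Hom C M N"
  using module.smult_closed[OF sc_module] by simp

lemma sc_ident: "M \<in> C0 \<Longrightarrow> r \<in> carrier R \<Longrightarrow> sc r (ident C M) \<in> Hom C M M"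
  using sc_Hom ident_Hom C0_obj by simp

lemma sc_cmp:
  assumes "f \<in> Hom C M N" "g \<in> Hom C N P" "M \<in> C0" "N \<in> C0" "P \<in> C0" "r \<in> carrier R"
  shows "sc r (g \<cdot> f) = sc r g \<cdot> f" "sc r (g \<cdot> f) = g \<cdot> sc r f"
proof -
  have fg: "f \<in> Hom (full_subcat C C0) M N" "g \<in> Hom (full_subcat C C0) N P"
    using assms by (simp_all add: Hom_full_subcat)
  show "sc r (g \<cdot> f) = sc r g \<cdot> f" "sc r (g \<cdot> f) = g \<cdot> sc r f"
    using linear[unfolded linear_triangulated_def, THEN conjunct2, THEN conjunct1, rule_format,
        OF fg assms(6)] by (simp, metis full_subcat_simps(5))
qed

text \<open>Scalars are central, as both sides are \<open>sc r f\<close>.\<close>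

lemma sc_eq:
  assumes f: "f \<in> Hom C M N" and M: "M \<in> C0" and N: "N \<in> C0" and r: "r \<in> carrier R"
  shows "f \<cdot> sc r (ident C M) = sc r f" "sc r (ident C N) \<cdot> f = sc r f"
  using sc_cmp(2)[OF ident_Hom[OF C0_obj[OF M]] f M M N r] cmp_ident[OF f]
    sc_cmp(1)[OF f ident_Hom[OF C0_obj[OF N]] M N N r] ident_cmp[OF f] by simp_all

lemma sha_sc:
  assumes "M \<in> C0" "r \<in> carrier R"
  shows "sha C (sc r (ident C M)) = sc r (ident C (sho C M))"
proof -
  have "\<forall>f\<in>arr (full_subcat C C0). \<forall>r\<in>carrier R.
      sha (full_subcat C C0) (sc r f) = sc r (sha (full_subcat C C0) f)"
    using linear unfolding linear_triangulated_def by simp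
  moreover have "ident C M \<in> arr (full_subcat C C0)"
    using ident_Hom[OF C0_obj[OF assms(1)]] assms(1) by (simp add: full_subcat_def Hom_def)
  moreover have "sha (full_subcat C C0) = sha C" by (simp add: full_subcat_def)
  ultimately have "sha C (sc r (ident C M)) = sc r (sha C (ident C M))" using assms(2) by simp
  then show ?thesis using sha_ident[OF C0_obj[OF assms(1)]] by simp
qed

lemma hm_module:
  assumes M: "M \<in> C0" and N: "N \<in> obj C"
  shows "module R (hm M N)"
proof -
  note Mo = C0_obj[OF M]
  note i = ident_Hom[OF Mo]
  interpret S: module R "\<lparr>carrier = Hom C M M, mult = undefined, one = undefined, zero = zmor C M M,
    add = amor C, smult = sc\<rparr>" using sc_module[OF M M] .
  have ag: "abelian_group (hm M N)"
  proof -
    interpret G: abelian_group "hom_group C M N" using hom_group[OF Mo N] .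
    have "\<exists>g\<in>Hom C M N. g \<boxplus> f = zmor C M N" if "f \<in> Hom C M N" for f
      using G.l_neg[of f] G.a_inv_closed[of f] that by auto
    then show ?thesis
      using G.a_assoc G.a_comm G.l_zero G.zero_closed G.a_closed by (intro abelian_groupI) simp_all
  qed
  show ?thesis
  proof (rule moduleI[OF R ag])
    fix r f assume r: "r \<in> carrier R" and f: "f \<in> carrier (hm M N)"
    then show "r \<odot>\<^bsub>hm M N\<^esub> f \<in> carrier (hm M N)" using cmp_Hom[OF sc_ident[OF M r]] by simp
  next
    fix r s f assume r: "r \<in> carrier R" and s: "s \<in> carrier R" and f: "f \<in> carrier (hm M N)"
    then have fH: "f \<in> Hom C M N" by simp
    show "(r \<oplus>\<^bsub>R\<^esub> s) \<odot>\<^bsub>hm M N\<^esub> f = (r \<odot>\<^bsub>hm M N\<^esub> f) \<oplus>\<^bsub>hm M N\<^esub> (s \<odot>\<^bsub>hm M N\<^esub> f)"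
      using S.smult_l_distr[OF r s] i cmp_add[OF sc_ident[OF M r] sc_ident[OF M s] fH] by simp
    have "sc (r \<otimes>\<^bsub>R\<^esub> s) (ident C M) = sc (s \<otimes>\<^bsub>R\<^esub> r) (ident C M)" using r s S.R.m_comm by simp
    also have "\<dots> = sc s (sc r (ident C M))" using S.smult_assoc1[OF s r] i by simp
    also have "\<dots> = sc s (ident C M) \<cdot> sc r (ident C M)"
      using sc_eq(2)[OF sc_ident[OF M r] M M s] by simp
    finally show "(r \<otimes>\<^bsub>R\<^esub> s) \<odot>\<^bsub>hm M N\<^esub> f = r \<odot>\<^bsub>hm M N\<^esub> (s \<odot>\<^bsub>hm M N\<^esub> f)"
      using cmp_assoc[OF sc_ident[OF M r] sc_ident[OF M s] fH] by simp
  next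
    fix r f g assume r: "r \<in> carrier R" and "f \<in> carrier (hm M N)" "g \<in> carrier (hm M N)"
    then show "r \<odot>\<^bsub>hm M N\<^esub> (f \<oplus>\<^bsub>hm M N\<^esub> g) = (r \<odot>\<^bsub>hm M N\<^esub> f) \<oplus>\<^bsub>hm M N\<^esub> (r \<odot>\<^bsub>hm M N\<^esub> g)"
      using add_cmp[OF sc_ident[OF M r]] by simp
  next
    fix f assume "f \<in> carrier (hm M N)"
    then show "\<one>\<^bsub>R\<^esub> \<odot>\<^bsub>hm M N\<^esub> f = f" using S.smult_one i cmp_ident by simp
  qed
qed

lemma hm_obj: "M \<in> C0 \<Longrightarrow> N \<in> obj C \<Longrightarrow> hm M N \<in> obj (module_cat \<kappa> R)"
  using hm_module hom_small by (simp add: obj_module_cat)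

lemma postcomp_hom:
  assumes M: "M \<in> C0" and h: "h \<in> Hom C N N'"
  shows "(\<lambda>g. h \<cdot> g) \<in> module_hom R (hm M N) (hm M N')"
  using cmp_Hom[OF _ h] cmp_add[OF _ _ h] cmp_assoc[OF sc_ident[OF M] _ h]
  by (auto simp: module_hom_def)

lemma precomp_hom:
  assumes M: "M \<in> C0" "M' \<in> C0" and f: "f \<in> Hom C M M'"
  shows "(\<lambda>g. g \<cdot> f) \<in> module_hom R (hm M' N) (hm M N)"
proof -
  have "(g \<cdot> sc r (ident C M')) \<cdot> f = (g \<cdot> f) \<cdot> sc r (ident C M)"
    if "r \<in> carrier R" "g \<in> Hom C M' N" for r g
    using cmp_assoc[OF f sc_ident[OF M(2) that(1)] that(2)]
      cmp_assoc[OF sc_ident[OF M(1) that(1)] f that(2)] sc_eq[OF f M that(1)] by simp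
  then show ?thesis
    using cmp_Hom[OF f] add_cmp[OF f] by (auto simp: module_hom_def)
qed

lemma shift_hom:
  assumes M: "M \<in> C0" and N: "N \<in> obj C"
  shows "sha C \<in> module_hom R (hm M N) (hm (sho C M) (sho C N))"
    and "bij_betw (sha C) (Hom C M N) (Hom C (sho C M) (sho C N))"
proof -
  show "sha C \<in> module_hom R (hm M N) (hm (sho C M) (sho C N))"
    using sha_Hom shift_additive sha_cmp[OF sc_ident[OF M]] sha_sc[OF M] by (auto simp: module_hom_def)
  show "bij_betw (sha C) (Hom C M N) (Hom C (sho C M) (sho C N))"
    using sha_inj sha_Hom sha_surj[OF C0_obj[OF M] N] unfolding bij_betw_def inj_on_def by blast
qed

lemma CA_iff: "N \<in> CA \<longleftrightarrow> N \<in> obj C \<and> (\<forall>M\<in>C0. hm M N \<in> A)"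
  by (simp add: objects_with_homs_in_def)

lemma CA_sho_iff:
  assumes N: "N \<in> obj C"
  shows "sho C N \<in> CA \<longleftrightarrow> N \<in> CA"
proof -
  note s = shift_hom[OF _ N]
  show ?thesis
  proof
    assume "sho C N \<in> CA"
    then have "hm M N \<in> A" if "M \<in> C0" for M
      using weak_Serre_iso[OF A _ hm_obj[OF that N] s(1)[OF that]] s(2)[OF that] C0_sho[OF that]
      by (simp add: CA_iff)
    then show "N \<in> CA" using N by (simp add: CA_iff)
  next
    assume NA: "N \<in> CA"
    have "hm M (sho C N) \<in> A" if M: "M \<in> C0" for M
    proof -
      obtain M' where M': "M' \<in> C0" "sho C M' = M"
        using triangulated_subcatD(4)[OF C0_triangulated M] by blast
      then show ?thesis
        using weak_Serre_iso'[OF A _ hm_obj[OF M sho_obj[OF N]], of "hm M' N" "sha C"] s[OF M'(1)] NA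
        by (simp add: CA_iff)
    qed
    then show "sho C N \<in> CA" using sho_obj[OF N] by (simp add: CA_iff)
  qed
qed

lemma CA_cone:
  assumes T: "dist_tri C X Y Z f g h" and X: "X \<in> CA" and Y: "Y \<in> CA"
  shows "Z \<in> CA"
proof -
  note f = dist_triD(1)[OF T] and g = dist_triD(2)[OF T] and h = dist_triD(3)[OF T]
  note Xo = dist_triD(4)[OF T] and Yo = dist_triD(5)[OF T] and Zo = dist_triD(6)[OF T]
  have sX: "sho C X \<in> CA" "sho C Y \<in> CA" using CA_sho_iff Xo Yo X Y by simp_all
  have "hm M Z \<in> A" if M: "M \<in> C0" for M
  proof (rule weak_Serre_five[OF A _ _ _ _ hm_obj[OF M Zo]])
    note Mo = C0_obj[OF M]
    show "hm M X \<in> A" "hm M Y \<in> A" "hm M (sho C X) \<in> A" "hm M (sho C Y) \<in> A"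
      using X Y sX M by (simp_all add: CA_iff)
    show "(\<lambda>u. f \<cdot> u) \<in> module_hom R (hm M X) (hm M Y)" "(\<lambda>u. g \<cdot> u) \<in> module_hom R (hm M Y) (hm M Z)"
      "(\<lambda>u. h \<cdot> u) \<in> module_hom R (hm M Z) (hm M (sho C X))"
      "(\<lambda>u. sha C f \<cdot> u) \<in> module_hom R (hm M (sho C X)) (hm M (sho C Y))"
      using postcomp_hom[OF M] f g h sha_Hom[OF f] by blast+
    have "g \<cdot> (f \<cdot> u) = zmor C M Z" if "u \<in> Hom C M X" for u
      using cmp_assoc[OF that f g] triangle_cmp_zero[OF T] zmor_cmp[OF that Zo] by simp
    then show "(\<lambda>u. f \<cdot> u) ` carrier (hm M X) = a_kernel (hm M Y) (hm M Z) (\<lambda>u. g \<cdot> u)"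
      using exact_to1[OF T] cmp_Hom[OF _ f] by (auto simp: a_kernel_def' image_iff) metis
    have "h \<cdot> (g \<cdot> u) = zmor C M (sho C X)" if "u \<in> Hom C M Y" for u
      using cmp_assoc[OF that g h] triangle_cmp_zero'[OF T] zmor_cmp[OF that sho_obj[OF Xo]] by simp
    then show "(\<lambda>u. g \<cdot> u) ` carrier (hm M Y) = a_kernel (hm M Z) (hm M (sho C X)) (\<lambda>u. h \<cdot> u)"
      using exact_to2[OF T] cmp_Hom[OF _ g] by (auto simp: a_kernel_def' image_iff) metis
    have "sha C f \<cdot> (h \<cdot> u) = zmor C M (sho C Y)" if "u \<in> Hom C M Z" for u
      using cmp_assoc[OF that h sha_Hom[OF f]] triangle_cmp_zero''[OF T] zmor_cmp[OF that sho_obj[OF Yo]]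
      by simp
    then show "(\<lambda>u. h \<cdot> u) ` carrier (hm M Z) =
        a_kernel (hm M (sho C X)) (hm M (sho C Y)) (\<lambda>u. sha C f \<cdot> u)"
      using exact_to3[OF T] cmp_Hom[OF _ h] by (auto simp: a_kernel_def' image_iff) metis
  qed
  then show ?thesis using Zo by (simp add: CA_iff)
qed

lemma CA_iso:
  assumes N: "N \<in> CA" and f: "f \<in> Hom C N N'" "g \<in> Hom C N' N" "g \<cdot> f = ident C N" "f \<cdot> g = ident C N'"
  shows "N' \<in> CA"
proof -
  note N'o = Hom_obj(2)[OF f(1)]
  have "hm M N' \<in> A" if M: "M \<in> C0" for M
  proof (rule weak_Serre_iso'[OF A _ hm_obj[OF M N'o] postcomp_hom[OF M f(1)]])
    show "hm M N \<in> A" using N M by (simp add: CA_iff)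
    have "g \<cdot> (f \<cdot> u) = u" if "u \<in> Hom C M N" for u
      using cmp_assoc[OF that f(1,2)] f(3) ident_cmp[OF that] by simp
    moreover have "f \<cdot> (g \<cdot> u) = u" if "u \<in> Hom C M N'" for u
      using cmp_assoc[OF that f(2,1)] f(4) ident_cmp[OF that] by simp
    ultimately have "bij_betw (\<lambda>u. f \<cdot> u) (Hom C M N) (Hom C M N')"
      using cmp_Hom f(1,2) by (intro bij_betw_byWitness[where f' = "\<lambda>u. g \<cdot> u"]) auto
    then show "bij_betw (\<lambda>u. f \<cdot> u) (carrier (hm M N)) (carrier (hm M N'))" by simp
  qed
  then show ?thesis using N'o by (simp add: CA_iff)
qed

lemma CA_triangulated: "triangulated_subcat C CA"
  unfolding triangulated_subcat_def
proof (intro conjI allI impI)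
  show "CA \<subseteq> obj C" by (auto simp: CA_iff)
  show "closed_under_iso C CA"
    unfolding closed_under_iso_def isomorphic_def iso_arrow_def inverse_arrows_def
    using CA_iso by metis
  obtain Z where Z: "zero_object C Z" using zero_object_exists by blast
  then have Zo: "Z \<in> obj C" by (simp add: zero_object_def)
  have "hm M Z \<in> A" if M: "M \<in> C0" for M
  proof -
    have "Hom C M Z = {zmor C M Z}"
      unfolding Hom_eq_zmor_iff[OF C0_obj[OF M] Zo] using Hom_to_zero[OF Z] by blast
    then show ?thesis using weak_Serre_zero[OF A hm_obj[OF M Zo]] by simp
  qed
  then have "Z \<in> CA" using Zo by (simp add: CA_iff)
  then show "\<exists>Z\<in>CA. zero_object C Z" using Z by blast
  have "X \<in> sho C ` CA" if X: "X \<in> CA" for X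
  proof -
    obtain Y where "Y \<in> obj C" "sho C Y = X" using sho_surj X by (auto simp: CA_iff)
    then show ?thesis using CA_sho_iff X by blast
  qed
  then show "sho C ` CA = CA" using CA_sho_iff by (auto simp: CA_iff)
  show "Z \<in> CA" if "dist_tri C X Y Z f g h" "X \<in> CA" "Y \<in> CA" for X Y Z f g h
    using CA_cone that by blast
qed

text \<open>
  For \<open>N\<close> in \<open>wge\<close> it suffices to test objects of \<open>wge\<close>: the presentation of \<open>M\<close> exhibits
  \<open>C(M, N)\<close> as a cokernel.
\<close>

lemma CA_if_wge:
  assumes N: "N \<in> wge" and G: "\<And>G. G \<in> wge \<Longrightarrow> G \<in> C0 \<Longrightarrow> hm G N \<in> A"
  shows "N \<in> CA"
proof -
  note No = wge_obj[OF N]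
  have "hm M N \<in> A" if M: "M \<in> C0" for M
  proof -
    obtain G0 G1 m d where G0: "G0 \<in> wge" "G0 \<in> C0" and G1: "G1 \<in> wge" "G1 \<in> C0"
      and m: "m \<in> Hom C M G0" and d: "d \<in> Hom C G0 G1" and dm: "d \<cdot> m = zmor C M G1"
      and onto: "\<And>L u. L \<in> wge \<Longrightarrow> u \<in> Hom C M L \<Longrightarrow> \<exists>v\<in>Hom C G0 L. v \<cdot> m = u"
      and ker: "\<And>L v. L \<in> wge \<Longrightarrow> v \<in> Hom C G0 L \<Longrightarrow> v \<cdot> m = zmor C M L \<Longrightarrow> \<exists>y\<in>Hom C G1 L. y \<cdot> d = v"
      by (rule C0_wge_presentation[OF M]) blast
    show ?thesis
    proof (rule weak_Serre_cokernel[OF A G[OF G1] G[OF G0] precomp_hom[OF G0(2) G1(2) d]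
          hm_obj[OF M No] precomp_hom[OF M G0(2) m]])
      have "(y \<cdot> d) \<cdot> m = zmor C M N" if "y \<in> Hom C G1 N" for y
        using cmp_assoc[OF m d that] dm cmp_zmor[OF that C0_obj[OF M]] by simp
      then show "(\<lambda>g. g \<cdot> d) ` carrier (hm G1 N) = a_kernel (hm G0 N) (hm M N) (\<lambda>g. g \<cdot> m)"
        using ker[OF N] cmp_Hom[OF d] by (auto simp: a_kernel_def' image_iff)
      show "(\<lambda>g. g \<cdot> m) ` carrier (hm G0 N) = carrier (hm M N)"
        using onto[OF N] cmp_Hom[OF m] by (auto simp: image_iff)
    qed
  qed
  then show ?thesis using No by (simp add: CA_iff)
qed

text \<open>
  For \<open>G\<close> in \<open>wge\<close>, the orthogonality of \<open>G\<close> and \<open>G[1]\<close> to \<open>S\<close> makes \<open>C(G, L) \<rightarrow> C(G, N)\<close> bijective.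
\<close>

lemma CA_truncation:
  assumes N: "N \<in> CA" and L: "L \<in> wge" and S: "S \<in> obj C" "sho C S \<in> tle"
    and T: "dist_tri C L N S l n k"
  shows "L \<in> CA"
proof (rule CA_if_wge[OF L])
  fix G assume G: "G \<in> wge" "G \<in> C0"
  note l = dist_triD(1)[OF T] and Lo = wge_obj[OF L] and Go = C0_obj[OF G(2)]
  have "inj_on (\<lambda>u. l \<cdot> u) (Hom C G L)"
  proof (rule inj_onI)
    fix u v assume u: "u \<in> Hom C G L" and v: "v \<in> Hom C G L" and eq: "l \<cdot> u = l \<cdot> v"
    note uv = diff_Hom[OF u v]
    have "l \<cdot> (u \<boxminus> v) = zmor C G N"
      using cmp_diff[OF u v l] eq diff_eq_zmor[OF cmp_Hom[OF u l] cmp_Hom[OF v l]] by simp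
    then have "sha C l \<cdot> sha C (u \<boxminus> v) = zmor C (sho C G) (sho C N)"
      using sha_cmp[OF uv l] sha_zmor[OF Go dist_triD(5)[OF T]] by simp
    then obtain w where w: "w \<in> Hom C (sho C G) S" "k \<cdot> w = sha C (u \<boxminus> v)"
      using exact_to3[OF T sha_Hom[OF uv]] by blast
    have "w = zmor C (sho C G) S" using wge_perp[OF wge_sho[OF G(1)] S w(1)] .
    then have "sha C (u \<boxminus> v) = sha C (zmor C G L)"
      using w(2) cmp_zmor[OF dist_triD(3)[OF T] sho_obj[OF Go]] sha_zmor[OF Go Lo] by simp
    then have "u \<boxminus> v = zmor C G L" using sha_inj[OF uv zmor_Hom[OF Go Lo]] by simp
    then show "u = v" using diff_eq_zmor[OF u v] by simp
  qed
  moreover have "(\<lambda>u. l \<cdot> u) ` Hom C G L = Hom C G N"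
  proof -
    have "\<exists>u\<in>Hom C G L. l \<cdot> u = y" if y: "y \<in> Hom C G N" for y
      using exact_to1[OF T y wge_perp[OF G(1) S cmp_Hom[OF y dist_triD(2)[OF T]]]] .
    then show ?thesis using cmp_Hom[OF _ l] by (auto simp: image_iff)
  qed
  ultimately have "bij_betw (\<lambda>u. l \<cdot> u) (carrier (hm G L)) (carrier (hm G N))"
    by (simp add: bij_betw_def)
  moreover have "hm G N \<in> A" using N G(2) by (simp add: CA_iff)
  ultimately show "hm G L \<in> A" using weak_Serre_iso[OF A _ hm_obj[OF G(2) Lo] postcomp_hom[OF G(2) l]] by blast
qed

lemma t_restricts_to_CA: "t_restricts C tle wge CA"
  unfolding t_restricts_def t_structure_def
proof (intro conjI)
  let ?D = "full_subcat C CA"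
  have sho: "sho ?D = sho C" and zm: "zmor ?D = zmor C" by (simp_all add: full_subcat_def)
  have t': "closed_under_iso C tle" "closed_under_iso C wge" "orthogonal C (sho C ` wge) tle"
    using t by (simp_all add: t_structure_def)
  have CAo: "N \<in> obj C" if "N \<in> CA" for N using that by (simp add: CA_iff)
  show "tle \<inter> CA \<subseteq> obj ?D" "wge \<inter> CA \<subseteq> obj ?D" using CAo by auto
  have "closed_under_iso ?D (S \<inter> CA)" if "closed_under_iso C S" for S
    using that unfolding closed_under_iso_def isomorphic_def
    by (auto simp: iso_arrow_full_subcat) blast
  then show "closed_under_iso ?D (tle \<inter> CA)" "closed_under_iso ?D (wge \<inter> CA)" using t' by blast+
  show "tle \<inter> CA \<subseteq> sho ?D ` (tle \<inter> CA)"
  proof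
    fix N assume N: "N \<in> tle \<inter> CA"
    then obtain N' where N': "N' \<in> tle" "sho C N' = N" using tle_unshift by blast
    then have "N' \<in> CA" using N CA_sho_iff[OF tle_obj[OF N'(1)]] by blast
    then show "N \<in> sho ?D ` (tle \<inter> CA)" using N' sho by auto
  qed
  show "sho ?D ` (wge \<inter> CA) \<subseteq> wge \<inter> CA" using sho wge_sho CA_sho_iff CAo by auto
  show "orthogonal ?D (sho ?D ` (wge \<inter> CA)) (tle \<inter> CA)"
    using t'(3) CA_sho_iff CAo unfolding orthogonal_def sho zm Hom_full_subcat by auto
  show "\<forall>M\<in>obj ?D. \<exists>L\<in>wge \<inter> CA. \<exists>N\<in>{N \<in> obj ?D. sho ?D N \<in> tle \<inter> CA}.
      \<exists>f g h. dist_tri ?D L M N f g h"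
  proof
    fix M assume "M \<in> obj ?D"
    then have M: "M \<in> obj C" "M \<in> CA" by auto
    obtain L N f g h where L: "L \<in> wge" and N: "N \<in> obj C" "sho C N \<in> tle"
      and T: "dist_tri C L M N f g h"
      using t_decomposition[OF M(1)] by blast
    have LA: "L \<in> CA" using CA_truncation[OF M(2) L N T] .
    have NA: "N \<in> CA" using CA_cone[OF T LA M(2)] .
    have "dist_tri ?D L M N f g h"
      using T LA NA M(2) CA_sho_iff[OF wge_obj[OF L]] by (simp add: dist_tri_full_subcat)
    moreover have "N \<in> {N \<in> obj ?D. sho ?D N \<in> tle \<inter> CA}"
      using N NA CA_sho_iff[OF N(1)] sho by simp
    ultimately show "\<exists>L\<in>wge \<inter> CA. \<exists>N\<in>{N \<in> obj ?D. sho ?D N \<in> tle \<inter> CA}.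
      \<exists>f g h. dist_tri ?D L M N f g h"
      using L LA by blast
  qed
qed

text \<open>
  Two steps lead from \<open>Hw\<close> to all of \<open>C0\<close>: kernels give the objects of \<open>C0\<close> in \<open>wge\<close>, and cokernels the
  remaining ones.
\<close>

lemma CA_if_heart:
  assumes N: "N \<in> tle" "N \<in> wge" and P: "\<And>P. P \<in> Hw \<Longrightarrow> hm P N \<in> A"
  shows "N \<in> CA"
proof (rule CA_if_wge[OF N(2)])
  fix G assume G: "G \<in> wge" "G \<in> C0"
  obtain P0 P1 p e where P0: "P0 \<in> Hw" and P1: "P1 \<in> Hw" and p: "p \<in> Hom C P0 G"
    and e: "e \<in> Hom C P1 P0" and pe: "p \<cdot> e = zmor C P1 G"
    and inj: "\<And>N u. N \<in> tle \<Longrightarrow> u \<in> Hom C G N \<Longrightarrow> u \<cdot> p = zmor C P0 N \<Longrightarrow> u = zmor C G N"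
    and ex: "\<And>N v. N \<in> tle \<Longrightarrow> v \<in> Hom C P0 N \<Longrightarrow> v \<cdot> e = zmor C P1 N \<Longrightarrow> \<exists>u\<in>Hom C G N. u \<cdot> p = v"
    by (rule wge_tle_presentation[OF G]) blast
  have PC: "P0 \<in> C0" "P1 \<in> C0" using P0 P1 by auto
  note No = tle_obj[OF N(1)]
  show "hm G N \<in> A"
  proof (rule weak_Serre_kernel[OF A P[OF P0] P[OF P1] precomp_hom[OF PC(2,1) e]
        hm_obj[OF G(2) No] precomp_hom[OF PC(1) G(2) p]])
    show "inj_on (\<lambda>g. g \<cdot> p) (carrier (hm G N))"
    proof (rule inj_onI)
      fix u v assume "u \<in> carrier (hm G N)" "v \<in> carrier (hm G N)" and eq: "u \<cdot> p = v \<cdot> p"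
      then have u: "u \<in> Hom C G N" and v: "v \<in> Hom C G N" by simp_all
      have "(u \<boxminus> v) \<cdot> p = zmor C P0 N"
        using diff_cmp[OF p u v] diff_eq_zmor[OF cmp_Hom[OF p u] cmp_Hom[OF p v]] eq by simp
      then show "u = v" using inj[OF N(1) diff_Hom[OF u v]] diff_eq_zmor[OF u v] by simp
    qed
    have "(u \<cdot> p) \<cdot> e = zmor C P1 N" if "u \<in> Hom C G N" for u
      using cmp_assoc[OF e p that] pe cmp_zmor[OF that C0_obj[OF PC(2)]] by simp
    then show "(\<lambda>g. g \<cdot> p) ` carrier (hm G N) = a_kernel (hm P0 N) (hm P1 N) (\<lambda>g. g \<cdot> e)"
      using ex[OF N(1)] cmp_Hom[OF p] by (auto simp: a_kernel_def' image_iff)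
  qed
qed

lemma C0_subset_if_generated:
  assumes "\<And>M N. M \<in> C0 \<Longrightarrow> N \<in> C0 \<Longrightarrow> generated_by_less \<beta> R (hm M N)"
  shows "C0 \<subseteq> objects_with_homs_in C sc C0 (modules_generated_by_less \<kappa> \<beta> R)"
  using assms hm_obj C0_obj unfolding objects_with_homs_in_def modules_generated_by_less_def by auto

end


section \<open>The heart as a category of linear functors\<close>

context linear_adjacent_structures
begin

abbreviation "H \<equiv> full_subcat C Hw"
abbreviation "MA \<equiv> full_subcat (module_cat \<kappa> R) A"
abbreviation "FunA \<equiv> functor_cat (opposite H) MA"
abbreviation "LF \<equiv> linear_functor_cat \<kappa> R H sc A"
abbreviation "YO \<equiv> yoneda_obj C sc H"
abbreviation "Y \<equiv> restricted_yoneda C sc H"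
abbreviation "heartA \<equiv> full_subcat C (tle \<inter> wge \<inter> CA)"

lemma obj_H: "obj H = Hw"
  using C0_obj by auto

lemma obj_opposite_H: "P \<in> obj (opposite H) \<longleftrightarrow> P \<in> Hw"
  by (simp only: opposite_simps obj_H)

lemma Hom_H: "Hom H P Q = (if P \<in> Hw \<and> Q \<in> Hw then Hom C P Q else {})"
  by (rule Hom_full_subcat)

lemma arr_H: "f \<in> Hom C P Q \<Longrightarrow> P \<in> Hw \<Longrightarrow> Q \<in> Hw \<Longrightarrow> f \<in> arr H \<and> src H f = P \<and> tgt H f = Q"
  by (auto simp: full_subcat_def Hom_def)

lemma Hom_MA:
  "a \<in> Hom MA M N \<longleftrightarrow> M \<in> A \<and> N \<in> A \<and>
    (\<exists>\<phi>. a = (M, N, \<phi>) \<and> \<phi> \<in> module_hom R M N \<and> \<phi> \<in> extensional (carrier M))"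
  using weak_Serre_obj[OF A] by (auto simp: Hom_full_subcat Hom_module_cat)

lemma category_MA: "category MA"
  by (rule category_full_subcat[OF category_module_cat])

lemma category_H: "category H"
  by (rule category_full_subcat) (rule category_axioms)

lemma category_FunA: "category FunA"
  by (rule category_functor_cat[OF category_opposite[OF category_H] category_MA])

lemma LF_def: "LF = full_subcat FunA {F. linear_functor R H sc F}"
  by (simp add: linear_functor_cat_def)

lemma obj_LF: "F \<in> obj LF \<longleftrightarrow> F \<in> obj FunA \<and> linear_functor R H sc F"
  by (simp add: LF_def)

lemma category_LF: "category LF"
  unfolding LF_def by (rule category_full_subcat[OF category_FunA])

lemma YO_fobj: "P \<in> Hw \<Longrightarrow> fobj (YO N) P = hm P N"
  using obj_H by (simp add: yoneda_obj_def)

lemma YO_farr: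
  "f \<in> Hom C P Q \<Longrightarrow> P \<in> Hw \<Longrightarrow> Q \<in> Hw \<Longrightarrow>
    farr (YO N) f = (hm Q N, hm P N, \<lambda>g\<in>Hom C Q N. g \<cdot> f)"
  using arr_H[of f P Q] by (simp add: yoneda_obj_def)

lemma YO_obj_LF:
  assumes N: "N \<in> CA"
  shows "YO N \<in> obj LF"
proof -
  have No: "N \<in> obj C" and NA: "\<And>P. P \<in> Hw \<Longrightarrow> hm P N \<in> A" using N by (auto simp: CA_iff)
  have "is_functor (opposite H) MA (YO N)"
    unfolding is_functor_def
  proof (intro conjI allI ballI)
    fix P assume "P \<in> obj (opposite H)"
    then have P: "P \<in> Hw" and Po: "P \<in> obj C" using obj_H by auto
    show "fobj (YO N) P \<in> obj MA"
      using YO_fobj[OF P] NA[OF P] weak_Serre_obj[OF A NA[OF P]] by simp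
    show "farr (YO N) (ident (opposite H) P) = ident MA (fobj (YO N) P)"
      using YO_farr[OF ident_Hom[OF Po] P P] YO_fobj[OF P]
      by (auto simp: ident_module_cat cmp_ident intro!: restrict_ext)
  next
    fix P Q f assume "f \<in> Hom (opposite H) P Q"
    then have P: "P \<in> Hw" and Q: "Q \<in> Hw" and f: "f \<in> Hom C Q P" by (auto simp: Hom_H split: if_splits)
    have C0: "P \<in> C0" "Q \<in> C0" using P Q by auto
    have "restrict (\<lambda>g. g \<cdot> f) (carrier (hm P N)) \<in> module_hom R (hm P N) (hm Q N)"
      by (rule module_hom_restrict[OF hm_module[OF C0(1) No] precomp_hom[OF C0(2,1) f]])
    then show "farr (YO N) f \<in> Hom MA (fobj (YO N) P) (fobj (YO N) Q)"
      using YO_farr[OF f Q P] YO_fobj P Q NA by (simp add: Hom_MA)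
  next
    fix P Q T f g assume "f \<in> Hom (opposite H) P Q" "g \<in> Hom (opposite H) Q T"
    then have P: "P \<in> Hw" and Q: "Q \<in> Hw" and T: "T \<in> Hw" and f: "f \<in> Hom C Q P" and g: "g \<in> Hom C T Q"
      by (auto simp: Hom_H split: if_splits)
    show "farr (YO N) (g \<cdot>\<^bsub>opposite H\<^esub> f) = farr (YO N) g \<cdot>\<^bsub>MA\<^esub> farr (YO N) f"
      using YO_farr[OF f Q P] YO_farr[OF g T Q] YO_farr[OF cmp_Hom[OF g f] T P] cmp_Hom[OF f] cmp_assoc[OF g f]
      by (auto simp: cmp_module_cat intro!: restrict_ext)
  qed
  moreover have "fobj (YO N) \<in> extensional (obj (opposite H))" "farr (YO N) \<in> extensional (arr (opposite H))"
    by (simp_all add: yoneda_obj_def)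
  moreover have "linear_functor R H sc (YO N)"
    unfolding linear_functor_def Let_def obj_H
  proof (intro ballI conjI)
    fix P Q x f g assume P: "P \<in> Hw" and Q: "Q \<in> Hw" and "x \<in> carrier (fobj (YO N) Q)"
      and "f \<in> Hom H P Q" "g \<in> Hom H P Q"
    then have x: "x \<in> Hom C Q N" and f: "f \<in> Hom C P Q" and g: "g \<in> Hom C P Q"
      by (simp_all add: YO_fobj Hom_H)
    have "amor H = amor C" by (simp add: full_subcat_def)
    then show "snd (snd (farr (YO N) (f \<boxplus>\<^bsub>H\<^esub> g))) x =
        snd (snd (farr (YO N) f)) x \<oplus>\<^bsub>fobj (YO N) P\<^esub> snd (snd (farr (YO N) g)) x"
      using YO_farr[OF f P Q] YO_farr[OF g P Q] YO_farr[OF add_Hom[OF f g] P Q] x cmp_add[OF f g x]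
      by (simp add: YO_fobj[OF P])
  next
    fix P Q x r f assume P: "P \<in> Hw" and Q: "Q \<in> Hw" and "x \<in> carrier (fobj (YO N) Q)"
      and r: "r \<in> carrier R" and "f \<in> Hom H P Q"
    then have x: "x \<in> Hom C Q N" and f: "f \<in> Hom C P Q" by (simp_all add: YO_fobj Hom_H)
    have C0: "P \<in> C0" "Q \<in> C0" using P Q by auto
    show "snd (snd (farr (YO N) (sc r f))) x = r \<odot>\<^bsub>fobj (YO N) P\<^esub> snd (snd (farr (YO N) f)) x"
      using YO_farr[OF f P Q] YO_farr[OF sc_Hom[OF C0 r f] P Q] x sc_eq(1)[OF f C0 r]
        cmp_assoc[OF sc_ident[OF C0(1) r] f x] by (simp add: YO_fobj[OF P])
  qed
  ultimately show ?thesis by (simp add: obj_LF obj_functor_cat)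
qed

lemma Hom_LF:
  assumes "F \<in> obj LF" "G \<in> obj LF"
  shows "\<alpha> \<in> Hom LF F G \<longleftrightarrow>
    (\<exists>\<eta>. \<alpha> = (F, G, \<eta>) \<and> nat_trans (opposite H) MA F G \<eta> \<and> \<eta> \<in> extensional Hw)"
  using assms obj_H by (simp add: LF_def Hom_full_subcat Hom_functor_cat)

lemma Y_farr:
  "h \<in> Hom C N N' \<Longrightarrow>
    farr Y h = (YO N, YO N', \<lambda>P\<in>Hw. (hm P N, hm P N', \<lambda>g\<in>Hom C P N. h \<cdot> g))"
  using obj_H by (auto simp: restricted_yoneda_def Hom_def)

lemma Y_farr_Hom:
  assumes N: "N \<in> CA" and N': "N' \<in> CA" and h: "h \<in> Hom C N N'"
  shows "farr Y h \<in> Hom LF (YO N) (YO N')"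
proof -
  have No: "N \<in> obj C" and NA: "\<And>P. P \<in> Hw \<Longrightarrow> hm P N \<in> A" using N by (auto simp: CA_iff)
  have NA': "\<And>P. P \<in> Hw \<Longrightarrow> hm P N' \<in> A" using N' by (auto simp: CA_iff)
  let ?\<eta> = "\<lambda>P\<in>Hw. (hm P N, hm P N', \<lambda>g\<in>Hom C P N. h \<cdot> g)"
  have "nat_trans (opposite H) MA (YO N) (YO N') ?\<eta>"
    unfolding nat_trans_def
  proof (intro conjI ballI allI)
    fix P assume "P \<in> obj (opposite H)"
    then have P: "P \<in> Hw" and C0: "P \<in> C0" using obj_H by auto
    have "restrict (\<lambda>g. h \<cdot> g) (carrier (hm P N)) \<in> module_hom R (hm P N) (hm P N')"
      by (rule module_hom_restrict[OF hm_module[OF C0 No] postcomp_hom[OF C0 h]])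
    then show "?\<eta> P \<in> Hom MA (fobj (YO N) P) (fobj (YO N') P)"
      using P NA NA' by (simp add: Hom_MA YO_fobj)
  next
    fix Q P f assume "f \<in> Hom (opposite H) Q P"
    then have P: "P \<in> Hw" and Q: "Q \<in> Hw" and f: "f \<in> Hom C P Q" by (auto simp: Hom_H split: if_splits)
    show "?\<eta> P \<cdot>\<^bsub>MA\<^esub> farr (YO N) f = farr (YO N') f \<cdot>\<^bsub>MA\<^esub> ?\<eta> Q"
      using P Q YO_farr[OF f P Q] cmp_Hom[OF f] cmp_Hom[OF _ h] cmp_assoc[OF f _ h]
      by (auto simp: cmp_module_cat intro!: restrict_ext)
  qed
  then show ?thesis
    unfolding Hom_LF[OF YO_obj_LF[OF N] YO_obj_LF[OF N']] Y_farr[OF h] by simp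
qed

lemma Y_functor: "is_functor heartA LF Y"
  unfolding is_functor_def
proof (intro conjI allI ballI)
  have fY: "fobj Y N = YO N" for N by (simp add: restricted_yoneda_def)
  fix N assume "N \<in> obj heartA"
  then have N: "N \<in> CA" and No: "N \<in> obj C" by auto
  show "fobj Y N \<in> obj LF" using YO_obj_LF[OF N] fY by simp
  have "ident LF (YO N) = (YO N, YO N, \<lambda>P\<in>Hw. ident MA (hm P N))"
    using obj_H by (auto simp: LF_def ident_functor_cat YO_fobj intro!: restrict_ext)
  then show "farr Y (ident heartA N) = ident LF (fobj Y N)"
    using Y_farr[OF ident_Hom[OF No]] fY
    by (auto simp: ident_module_cat ident_cmp intro!: restrict_ext)
next
  have fY: "fobj Y N = YO N" for N by (simp add: restricted_yoneda_def)
  fix N N' h assume "h \<in> Hom heartA N N'"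
  then have "N \<in> CA" "N' \<in> CA" "h \<in> Hom C N N'" by (auto simp: Hom_full_subcat split: if_splits)
  then show "farr Y h \<in> Hom LF (fobj Y N) (fobj Y N')" using Y_farr_Hom fY by simp
next
  fix N N' N'' h h' assume "h \<in> Hom heartA N N'" "h' \<in> Hom heartA N' N''"
  then have h: "h \<in> Hom C N N'" and h': "h' \<in> Hom C N' N''"
    by (auto simp: Hom_full_subcat split: if_splits)
  have "(\<lambda>g\<in>Hom C P N. (h' \<cdot> h) \<cdot> g) =
      (\<lambda>g\<in>Hom C P N. (\<lambda>g\<in>Hom C P N'. h' \<cdot> g) ((\<lambda>g\<in>Hom C P N. h \<cdot> g) g))" for P
    using cmp_Hom[OF _ h] cmp_assoc[OF _ h h'] by (auto intro!: restrict_ext)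
  then show "farr Y (h' \<cdot>\<^bsub>heartA\<^esub> h) = farr Y h' \<cdot>\<^bsub>LF\<^esub> farr Y h"
    using Y_farr[OF h] Y_farr[OF h'] Y_farr[OF cmp_Hom[OF h h']] obj_H
    by (auto simp: LF_def cmp_functor_cat cmp_module_cat intro!: restrict_ext)
qed

lemma Y_fully_faithful:
  assumes N: "N \<in> obj heartA" and N': "N' \<in> obj heartA"
  shows "bij_betw (farr Y) (Hom heartA N N') (Hom LF (fobj Y N) (fobj Y N'))"
proof -
  have fY: "fobj Y N = YO N" for N by (simp add: restricted_yoneda_def)
  have HK: "Hom heartA N N' = Hom C N N'" using N N' by (simp add: Hom_full_subcat)
  have Nw: "N \<in> wge" and N't: "N' \<in> tle" and NA: "N \<in> CA" and N'A: "N' \<in> CA" using N N' by auto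
  note LFN = YO_obj_LF[OF NA] YO_obj_LF[OF N'A]
  show ?thesis
    unfolding HK fY bij_betw_def
  proof
    show "inj_on (farr Y) (Hom C N N')"
    proof (rule inj_onI)
      fix h h' assume h: "h \<in> Hom C N N'" and h': "h' \<in> Hom C N N'" and eq: "farr Y h = farr Y h'"
      show "h = h'"
      proof (rule Hw_faithful[OF Nw N't h h'])
        fix P y assume P: "P \<in> Hw" and y: "y \<in> Hom C P N"
        have "(\<lambda>P\<in>Hw. (hm P N, hm P N', \<lambda>g\<in>Hom C P N. h \<cdot> g)) =
            (\<lambda>P\<in>Hw. (hm P N, hm P N', \<lambda>g\<in>Hom C P N. h' \<cdot> g))"
          using eq Y_farr[OF h] Y_farr[OF h'] by simp
        then have "(\<lambda>g\<in>Hom C P N. h \<cdot> g) = (\<lambda>g\<in>Hom C P N. h' \<cdot> g)"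
          using P by (metis (no_types, lifting) prod.inject restrict_apply')
        then show "h \<cdot> y = h' \<cdot> y" using y by (metis restrict_apply')
      qed
    qed
    show "farr Y ` Hom C N N' = Hom LF (YO N) (YO N')"
    proof
      show "farr Y ` Hom C N N' \<subseteq> Hom LF (YO N) (YO N')" using Y_farr_Hom[OF NA N'A] by blast
      show "Hom LF (YO N) (YO N') \<subseteq> farr Y ` Hom C N N'"
      proof
        fix \<alpha> assume "\<alpha> \<in> Hom LF (YO N) (YO N')"
        then obtain \<eta> where \<alpha>: "\<alpha> = (YO N, YO N', \<eta>)" and \<eta>: "nat_trans (opposite H) MA (YO N) (YO N') \<eta>"
          and ext: "\<eta> \<in> extensional Hw"
          using Hom_LF[OF LFN] by blast
        define \<phi> where "\<phi> P = snd (snd (\<eta> P))" for P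
        have \<eta>P: "\<eta> P = (hm P N, hm P N', \<phi> P)" and \<phi>h: "\<phi> P \<in> module_hom R (hm P N) (hm P N')"
          and \<phi>e: "\<phi> P \<in> extensional (Hom C P N)" if P: "P \<in> Hw" for P
        proof -
          have "\<eta> P \<in> Hom MA (hm P N) (hm P N')"
            using \<eta>[unfolded nat_trans_def, THEN conjunct1, rule_format, of P] P obj_opposite_H[of P]
              YO_fobj[OF P] by metis
          then obtain \<psi> where "\<eta> P = (hm P N, hm P N', \<psi>)" "\<psi> \<in> module_hom R (hm P N) (hm P N')"
            "\<psi> \<in> extensional (carrier (hm P N))"
            unfolding Hom_MA by blast
          then show "\<eta> P = (hm P N, hm P N', \<phi> P)" "\<phi> P \<in> module_hom R (hm P N) (hm P N')"
            "\<phi> P \<in> extensional (Hom C P N)"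
            by (simp_all add: \<phi>_def)
        qed
        have nat: "\<phi> P (y \<cdot> a) = \<phi> Q y \<cdot> a"
          if P: "P \<in> Hw" and Q: "Q \<in> Hw" and a: "a \<in> Hom C P Q" and y: "y \<in> Hom C Q N" for P Q a y
        proof -
          have "\<eta> P \<cdot>\<^bsub>MA\<^esub> farr (YO N) a = farr (YO N') a \<cdot>\<^bsub>MA\<^esub> \<eta> Q"
            using \<eta> a P Q unfolding nat_trans_def by (auto simp: Hom_H)
          then have "(\<lambda>y\<in>Hom C Q N. \<phi> P ((\<lambda>g\<in>Hom C Q N. g \<cdot> a) y)) =
              (\<lambda>y\<in>Hom C Q N. (\<lambda>g\<in>Hom C Q N'. g \<cdot> a) (\<phi> Q y))"
            by (simp add: YO_farr[OF a P Q] \<eta>P[OF P] \<eta>P[OF Q] cmp_module_cat)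
          from fun_cong[OF this, of y] show ?thesis
            using y module_homD(1)[OF \<phi>h[OF Q]] by simp
        qed
        obtain h where h: "h \<in> Hom C N N'" and h\<phi>: "\<forall>P\<in>Hw. \<forall>y\<in>Hom C P N. h \<cdot> y = \<phi> P y"
          using Hw_full[OF Nw N't, of \<phi>] module_homD(1,2)[OF \<phi>h] nat by auto
        have "\<eta> = (\<lambda>P\<in>Hw. (hm P N, hm P N', \<lambda>g\<in>Hom C P N. h \<cdot> g))"
        proof (rule extensionalityI[OF ext restrict_extensional])
          fix P assume P: "P \<in> Hw"
          have "\<phi> P = (\<lambda>g\<in>Hom C P N. h \<cdot> g)"
            by (rule extensionalityI[OF \<phi>e[OF P] restrict_extensional]) (use h\<phi> P in simp)
          then show "\<eta> P = (\<lambda>P\<in>Hw. (hm P N, hm P N', \<lambda>g\<in>Hom C P N. h \<cdot> g)) P"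
            using \<eta>P[OF P] P by simp
        qed
        then have "\<alpha> = farr Y h" using \<alpha> Y_farr[OF h] by simp
        then show "\<alpha> \<in> farr Y ` Hom C N N'" using h by blast
      qed
    qed
  qed
qed

text \<open>
  The comparison map is additive and natural. It is linear because scalars act on both sides through
  the scalar multiples of identities.
\<close>

lemma Y_essentially_surjective:
  assumes F: "F \<in> obj LF"
  shows "\<exists>N\<in>obj heartA. isomorphic LF (fobj Y N) F"
proof -
  have fY: "fobj Y N = YO N" for N by (simp add: restricted_yoneda_def)
  have FF: "F \<in> obj FunA" and lin: "linear_functor R H sc F" using F by (simp_all add: obj_LF)
  have Ff: "is_functor (opposite H) MA F" using FF by (simp add: obj_functor_cat)
  define FM where "FM = fobj F"
  define ap where "ap f = snd (snd (farr F f))" for f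
  have FMA: "FM P \<in> A" if "P \<in> Hw" for P
    using Ff[unfolded is_functor_def, THEN conjunct1, rule_format, of P] that obj_opposite_H[of P]
    by (simp add: FM_def)
  have FMm: "module R (FM P)" and FMs: "small \<kappa> (carrier (FM P))" if "P \<in> Hw" for P
    using weak_Serre_obj[OF A FMA[OF that]] by (simp_all add: obj_module_cat)
  have apF: "farr F f = (FM Q, FM P, ap f)" and aph: "ap f \<in> module_hom R (FM Q) (FM P)"
    if P: "P \<in> Hw" and Q: "Q \<in> Hw" and f: "f \<in> Hom C P Q" for P Q f
  proof -
    have "f \<in> Hom (opposite H) Q P" using P Q f by (simp add: Hom_H)
    then have "farr F f \<in> Hom MA (FM Q) (FM P)" using Ff unfolding is_functor_def FM_def by blast
    then obtain \<psi> where "farr F f = (FM Q, FM P, \<psi>)" "\<psi> \<in> module_hom R (FM Q) (FM P)"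
      unfolding Hom_MA by blast
    then show "farr F f = (FM Q, FM P, ap f)" "ap f \<in> module_hom R (FM Q) (FM P)"
      by (simp_all add: ap_def)
  qed
  note ap = module_homD[OF aph]
  have ap_ident: "ap (ident C P) x = x" if P: "P \<in> Hw" and x: "x \<in> carrier (FM P)" for P x
  proof -
    have i: "ident C P \<in> Hom C P P" using P ident_Hom C0_obj by blast
    have "farr F (ident C P) = ident MA (FM P)" 
      using Ff[unfolded is_functor_def, THEN conjunct2, THEN conjunct2, THEN conjunct1, rule_format, of P]
        P obj_opposite_H[of P] by (simp add: FM_def)
    then show ?thesis using apF[OF P P i] x by (simp add: ident_module_cat)
  qed
  have ap_cmp: "ap (g \<cdot> f) x = ap f (ap g x)"
    if P: "P \<in> Hw" and Q: "Q \<in> Hw" and T: "T \<in> Hw" and f: "f \<in> Hom C P Q" and g: "g \<in> Hom C Q T"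
      and x: "x \<in> carrier (FM T)" for P Q T f g x
  proof -
    have "g \<in> Hom (opposite H) T Q" "f \<in> Hom (opposite H) Q P" using P Q T f g by (simp_all add: Hom_H)
    then have "farr F (f \<cdot>\<^bsub>opposite H\<^esub> g) = farr F f \<cdot>\<^bsub>MA\<^esub> farr F g"
      using Ff unfolding is_functor_def by blast
    then show ?thesis
      using apF[OF P Q f] apF[OF Q T g] apF[OF P T cmp_Hom[OF f g]] x by (simp add: cmp_module_cat)
  qed
  have add_ap: "ap (f \<boxplus> g) x = ap f x \<oplus>\<^bsub>FM P\<^esub> ap g x"
    if "P \<in> Hw" "Q \<in> Hw" "f \<in> Hom C P Q" "g \<in> Hom C P Q" "x \<in> carrier (FM Q)" for P Q f g x
  proof -
    have "amor H = amor C" by (simp add: full_subcat_def)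
    then show ?thesis
      using lin that unfolding linear_functor_def Let_def obj_H ap_def FM_def by (simp add: Hom_H)
  qed
  have sc_ap: "ap (sc r (ident C P)) x = r \<odot>\<^bsub>FM P\<^esub> x"
    if P: "P \<in> Hw" and r: "r \<in> carrier R" and x: "x \<in> carrier (FM P)" for P r x
  proof -
    have i: "ident C P \<in> Hom H P P" using P ident_Hom C0_obj by (auto simp: Hom_H)
    have "ap (sc r (ident C P)) x = r \<odot>\<^bsub>FM P\<^esub> ap (ident C P) x"
      using lin P r x i unfolding linear_functor_def Let_def obj_H ap_def FM_def by blast
    then show ?thesis using ap_ident[OF P x] by simp
  qed
  have "\<exists>N \<theta>. N \<in> tle \<and> N \<in> wge \<and>
    (\<forall>P\<in>Hw. bij_betw (\<theta> P) (Hom C P N) (carrier (FM P))) \<and>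
    (\<forall>P\<in>Hw. \<forall>y\<in>Hom C P N. \<forall>z\<in>Hom C P N. \<theta> P (y \<boxplus> z) = \<theta> P y \<oplus>\<^bsub>FM P\<^esub> \<theta> P z) \<and>
    (\<forall>P\<in>Hw. \<forall>Q\<in>Hw. \<forall>f\<in>Hom C P Q. \<forall>y\<in>Hom C Q N. \<theta> P (y \<cdot> f) = ap f (\<theta> Q y))"
    by (rule functor_realized_in_heart[OF module.axioms(2)[OF FMm] FMs ap(1,2) ap_ident ap_cmp add_ap])
  then obtain N \<theta> where N: "N \<in> tle" "N \<in> wge"
    and bij: "\<And>P. P \<in> Hw \<Longrightarrow> bij_betw (\<theta> P) (Hom C P N) (carrier (FM P))"
    and add: "\<And>P y z. P \<in> Hw \<Longrightarrow> y \<in> Hom C P N \<Longrightarrow> z \<in> Hom C P N \<Longrightarrow> \<theta> P (y \<boxplus> z) = \<theta> P y \<oplus>\<^bsub>FM P\<^esub> \<theta> P z"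
    and nat: "\<And>P Q f y. P \<in> Hw \<Longrightarrow> Q \<in> Hw \<Longrightarrow> f \<in> Hom C P Q \<Longrightarrow> y \<in> Hom C Q N \<Longrightarrow>
      \<theta> P (y \<cdot> f) = ap f (\<theta> Q y)"
    by blast
  note No = tle_obj[OF N(1)]
  have \<theta>_closed: "\<theta> P y \<in> carrier (FM P)" if "P \<in> Hw" "y \<in> Hom C P N" for P y
    using bij[OF that(1)] that(2) by (auto simp: bij_betw_def)
  have \<theta>h: "\<theta> P \<in> module_hom R (hm P N) (FM P)" if P: "P \<in> Hw" for P
  proof -
    have "\<theta> P (y \<cdot> sc r (ident C P)) = r \<odot>\<^bsub>FM P\<^esub> \<theta> P y" if "r \<in> carrier R" "y \<in> Hom C P N" for r y
      using nat[OF P P sc_ident[of P r] that(2)] sc_ap[OF P that(1) \<theta>_closed[OF P that(2)]] P that(1) by auto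
    then show ?thesis using add[OF P] \<theta>_closed[OF P] by (auto simp: module_hom_def)
  qed
  have hmA: "hm P N \<in> A" if P: "P \<in> Hw" for P
    using weak_Serre_iso[OF A FMA[OF P] hm_obj[OF _ No] \<theta>h[OF P]] bij[OF P] P by simp
  have NA: "N \<in> CA" by (rule CA_if_heart[OF N hmA])
  then have NK: "N \<in> obj heartA" using N No by simp
  define \<eta> where "\<eta> = (\<lambda>P\<in>Hw. (hm P N, FM P, restrict (\<theta> P) (Hom C P N)))"
  have \<theta>r: "restrict (\<theta> P) (Hom C P N) \<in> module_hom R (hm P N) (FM P)" if P: "P \<in> Hw" for P
    using module_hom_restrict[OF hm_module[OF _ No] \<theta>h[OF P]] P by simp
  have nt: "nat_trans (opposite H) MA (YO N) F \<eta>"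
    unfolding nat_trans_def
  proof (intro conjI ballI allI)
    fix P assume "P \<in> obj (opposite H)"
    then have P: "P \<in> Hw" using obj_H by simp
    show "\<eta> P \<in> Hom MA (fobj (YO N) P) (fobj F P)"
      using P hmA FMA \<theta>r by (simp add: \<eta>_def Hom_MA YO_fobj FM_def)
  next
    fix Q P f assume "f \<in> Hom (opposite H) Q P"
    then have P: "P \<in> Hw" and Q: "Q \<in> Hw" and f: "f \<in> Hom C P Q" by (auto simp: Hom_H split: if_splits)
    show "\<eta> P \<cdot>\<^bsub>MA\<^esub> farr (YO N) f = farr F f \<cdot>\<^bsub>MA\<^esub> \<eta> Q"
      using P Q YO_farr[OF f P Q] apF[OF P Q f] cmp_Hom[OF f] nat[OF P Q f]
      by (auto simp: \<eta>_def cmp_module_cat intro!: restrict_ext)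
  qed
  have iso: "iso_arrow MA (fobj (YO N) P) (fobj F P) (\<eta> P)" if "P \<in> obj (opposite H)" for P
  proof -
    have P: "P \<in> Hw" using that obj_H by simp
    have "bij_betw (restrict (\<theta> P) (Hom C P N)) (Hom C P N) (carrier (FM P))"
      using bij[OF P] by simp
    then have "iso_arrow (module_cat \<kappa> R) (hm P N) (FM P) (hm P N, FM P, restrict (\<theta> P) (Hom C P N))"
      using iso_arrow_module_cat[OF weak_Serre_obj[OF A hmA[OF P]] weak_Serre_obj[OF A FMA[OF P]] \<theta>r[OF P]]
      by simp
    then show ?thesis
      using P hmA[OF P] FMA[OF P] by (simp add: \<eta>_def YO_fobj iso_arrow_full_subcat FM_def)
  qed
  note YLF = YO_obj_LF[OF NA]
  have "\<eta> \<in> extensional (obj (opposite H))" using obj_H by (simp add: \<eta>_def)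
  then have "iso_arrow FunA (YO N) F (YO N, F, \<eta>)"
    using iso_arrow_functor_cat[OF category_opposite[OF category_H] category_MA _ FF nt _ iso] YLF
    by (simp add: obj_LF)
  then have "iso_arrow LF (YO N) F (YO N, F, \<eta>)"
    using YLF F iso_arrow_full_subcat[of "YO N" "{F. linear_functor R H sc F}" F FunA]
    by (simp add: LF_def obj_LF)
  then show ?thesis using NK fY unfolding isomorphic_def by auto
qed

lemma heart_equivalent_to_linear_functors: "equivalence_of_categories heartA LF Y"
proof (rule equivalence_if_fully_faithful_essentially_surjective[OF _ category_LF Y_functor])
  show "category heartA" by (rule category_full_subcat) (rule category_axioms)
qed (fact Y_fully_faithful Y_essentially_surjective)+

end

theorem proposition3p3p4:
  fixes C :: "('o, 'a) tri_cat"
    and \<kappa> :: "'a rel"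
    and C0 wle0 wge0 wle wge tle tge :: "'o set"
    and R :: "'r ring"
    and sc :: "'r \<Rightarrow> 'a \<Rightarrow> 'a"
    and A :: "('r, 'a) module set"
    and \<beta> :: "'b rel"
  assumes "universe_card \<kappa>"
    and "triangulated_category C"
    and "smashing_category \<kappa> C"
    and "triangulated_subcat C C0"
    and "\<forall>M\<in>C0. compact_object \<kappa> C M"
    and "essentially_small \<kappa> (full_subcat C C0)"
    and "\<forall>M\<in>C0. \<forall>N\<in>obj C. small \<kappa> (Hom C M N)"
    and "generates \<kappa> C C0"
    and "weight_structure (full_subcat C C0) wle0 wge0"
    and "smashing_weight_structure \<kappa> C wle wge"
    and "wle0 = wle \<inter> C0" and "wge0 = wge \<inter> C0"
    and "t_structure C tle tge" and "tge = wge"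
    and "cring R"
    and "linear_triangulated R (full_subcat C C0) sc"
    and "weak_Serre \<kappa> R A"
  shows "let Hw0 = heart (full_subcat C C0) wle0 wge0;
             CA = objects_with_homs_in C sc C0 A;
             CB = objects_with_homs_in C sc C0 (modules_generated_by_less \<kappa> \<beta> R)
         in (triangulated_subcat C CA \<and> t_restricts C tle tge CA) \<and>
            equivalence_of_categories (heart (full_subcat C CA) (tle \<inter> CA) (tge \<inter> CA))
              (linear_functor_cat \<kappa> R Hw0 sc A) (restricted_yoneda C sc Hw0) \<and>
            (Cinfinite \<beta> \<and> noetherian_ring R \<and>
               (\<forall>M\<in>C0. \<forall>N\<in>C0. generated_by_less \<beta> R (hom_module C sc M N))
             \<longrightarrow> C0 \<subseteq> CB)"
proof -
  interpret linear_adjacent_structures C \<kappa> C0 wle wge tle R sc A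
    unfolding linear_adjacent_structures_def adjacent_structures_def adjacent_structures_axioms_def
      linear_adjacent_structures_axioms_def
    using assms by simp
  have "heart (full_subcat C C0) wle0 wge0 = full_subcat C Hw"
    unfolding heart_def full_subcat_full_subcat assms(11,12)
    by (rule arg_cong[where f = "full_subcat C"]) blast
  moreover have "heart (full_subcat C CA) (tle \<inter> CA) (tge \<inter> CA) = full_subcat C (tle \<inter> wge \<inter> CA)"
    unfolding heart_def full_subcat_full_subcat assms(14)
    by (rule arg_cong[where f = "full_subcat C"]) blast
  ultimately show ?thesis
    unfolding Let_def assms(14)
    using CA_triangulated t_restricts_to_CA heart_equivalent_to_linear_functors
      C0_subset_if_generated[of \<beta>] by auto
qed

end
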